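(* Let $G=(V,E)$ be a directed graph with $n$ nodes, $c\in(0,1)$, $\varepsilon>0$, $\delta\in(0,1)$, $j_0\in\{0,\dots,n\}$, and $u\in V$. Then, with probability at least $1-\delta$, the estimates $\hat s(u,v)$ returned by the PRSim Query Algorithm (described in the context) satisfy $|\hat s(u,v)-s(u,v)|\le\varepsilon$ for every $v\in V$ (taking $\hat s(u,v)=0$ for nodes not returned).
   Context: For $v\in V$, $\mathcal{I}(v)$, $\mathcal{O}(v)$ are in-/out-neighbor sets, $d_{in}(v)=|\mathcal I(v)|$. SimRank: $s(u,u)=1$ and for $u\ne v$, $s(u,v)=\frac{c}{|\mathcal I(u)||\mathcal I(v)|}\sum_{u'\in\mathcal I(u)}\sum_{v'\in\mathcal I(v)}s(u',v')$. A $\sqrt{c}$-walk from $u$ starts at $u$ and at each step either terminates with probability $1-\sqrt{c}$ or, with probability $\sqrt{c}$, moves to a uniformly random in-neighbor. Two walks meet if they are at the same node after the same number of steps. $\pi_\ell(u,w)$ is the probability that a $\sqrt{c}$-walk from $u$ terminates at $w$ after exactly $\ell$ steps; $\pi(w)=\frac1n\sum_u\sum_\ell\pi_\ell(u,w)$ is the reverse PageRank. Order nodes as $w_1,\dots,w_n$ with $\pi(w_1)\ge\dots\ge\pi(w_n)$; $w_1,\dots,w_{j_0}$ are hub nodes. Index: for each hub $w$, backward search with $r_{max}=\frac{(1-\sqrt c)^2\varepsilon}{12}$: residues $r_\ell(v,w)$ and reserves $\psi_\ell(v,w)$ start at $0$ except $r_0(w,w)=1$; for $\ell=0,1,\dots$,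 for each $v$ with $r_\ell(v,w)>r_{max}$: add $\sqrt c\,r_\ell(v,w)/d_{in}(z)$ to $r_{\ell+1}(z,w)$ for each $z\in\mathcal O(v)$, add $(1-\sqrt c)r_\ell(v,w)$ to $\psi_\ell(v,w)$, set $r_\ell(v,w)=0$; then store in list $L_\ell(w)$ the tuples $(v,\psi_\ell(v,w))$ with $\psi_\ell(v,w)>r_{max}$. Variance Bounded Backward Walk (VBBW) on $w$, target level $\ell$: $\hat\pi_i(x,w)=0$ except $\hat\pi_0(w,w)=1-\sqrt c$; for $i=0,\dots,\ell-1$, for each $x$ with $\hat\pi_i(x,w)\ne0$, independently with probability $\sqrt c$: add $\hat\pi_i(x,w)/d_{in}(y)$ to $\hat\pi_{i+1}(y,w)$ for each $y\in\mathcal O(x)$ with $d_{in}(y)\le\hat\pi_i(x,w)/(1-\sqrt c)$; draw $r$ uniform in $(0,1)$ and add $1-\sqrt c$ to $\hat\pi_{i+1}(y,w)$ for each $y\in\mathcal O(x)$ with $\hat\pi_i(x,w)/(1-\sqrt c)<d_{in}(y)\le \hat\pi_i(x,w)/(r(1-\sqrt c))$; output $\hat\pi_\ell(\cdot,w)$. PRSim Query Algorithm on $u$: $c_1=\frac{12}{(1-\sqrt c)^2}$, $d_r=c_1/\varepsilon^2$, $f_r=3\log\frac n\delta$, $n_r=d_rf_r$; all estimators start at $0$. For $i=1,\dots,f_r$ and $j=1,\dots,d_r$: sample a $\sqrt c$-walk from $u$, say terminating at $w$ after $\ell$ steps; sample two independent $\sqrt c$-walks from $w$; if they do not meet at any step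 $\ge1$: add $1/n_r$ to $\widehat{\eta\pi}_\ell(u,w)$, and if $w$ is not a hub, run VBBW on $w$ with target level $\ell$ (fresh randomness) and add $\frac{\hat\pi_\ell(v,w)}{(1-\sqrt c)^2d_r}$ to $\hat s_B^i(u,v)$ for every $v$. Then $\hat s_B(u,v)=\mathrm{Median}_{1\le i\le f_r}\hat s_B^i(u,v)$, and $\hat s_I(u,v)=\sum\frac{\widehat{\eta\pi}_\ell(u,w)\psi_\ell(v,w)}{(1-\sqrt c)^2}$, summed over pairs $(w,\ell)$ with $w$ a hub and $\widehat{\eta\pi}_\ell(u,w)>\varepsilon/c_1$ and over tuples $(v,\psi_\ell(v,w))\in L_\ell(w)$. Output all nonzero $\hat s(u,v)=\hat s_I(u,v)+\hat s_B(u,v)$. *)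

theory Defs
  imports "HOL-Probability.Probability" "Graph_Theory.Pair_Digraph"
begin

text \<open>
  Graphs are finite, without parallel arcs; self-loops and nodes without in-neighbours are
  allowed (\<^locale>\<open>pair_fin_digraph\<close>).
\<close>

definition in_nbrs :: "'a pair_pre_digraph \<Rightarrow> 'a \<Rightarrow> 'a set" where
  "in_nbrs G v = {x. (x, v) \<in> parcs G}"

definition out_nbrs :: "'a pair_pre_digraph \<Rightarrow> 'a \<Rightarrow> 'a set" where
  "out_nbrs G v = {y. (v, y) \<in> parcs G}"

definition d_in :: "'a pair_pre_digraph \<Rightarrow> 'a \<Rightarrow> nat" where
  "d_in G v = card (in_nbrs G v)"

lemma finite_in_nbrs: "pair_fin_digraph G \<Longrightarrow> finite (in_nbrs G v)"
  unfolding in_nbrs_def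
  by (rule finite_subset[of _ "fst ` parcs G"])
     (force, simp add: pair_fin_digraph.pair_finite_arcs)

lemma finite_out_nbrs: "pair_fin_digraph G \<Longrightarrow> finite (out_nbrs G v)"
  unfolding out_nbrs_def
  by (rule finite_subset[of _ "snd ` parcs G"])
     (force, simp add: pair_fin_digraph.pair_finite_arcs)

lemma in_nbrs_subset: "pair_fin_digraph G \<Longrightarrow> in_nbrs G v \<subseteq> pverts G"
  unfolding in_nbrs_def pair_fin_digraph_def pair_wf_digraph_def by force


section \<open>SimRank\<close>

text \<open>
  If \<open>u\<close> or \<open>v\<close> has no in-neighbour, the double sum is empty and the right-hand side is \<open>0\<close>.
  Outside the node set the value is fixed to \<open>0\<close> so that the solution is unique
  (\<open>simrank_ex1\<close> below).
\<close>

definition is_simrank :: "'a pair_pre_digraph \<Rightarrow> real \<Rightarrow> ('a \<Rightarrow> 'a \<Rightarrow> real) \<Rightarrow> bool" where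
  "is_simrank G c s \<longleftrightarrow>
     (\<forall>u\<in>pverts G. s u u = 1) \<and>
     (\<forall>u\<in>pverts G. \<forall>v\<in>pverts G. u \<noteq> v \<longrightarrow>
        s u v = c / (real (card (in_nbrs G u)) * real (card (in_nbrs G v))) *
          (\<Sum>u'\<in>in_nbrs G u. \<Sum>v'\<in>in_nbrs G v. s u' v')) \<and>
     (\<forall>u v. u \<notin> pverts G \<or> v \<notin> pverts G \<longrightarrow> s u v = 0)"

definition simrank :: "'a pair_pre_digraph \<Rightarrow> real \<Rightarrow> 'a \<Rightarrow> 'a \<Rightarrow> real" where
  "simrank G c = (THE s. is_simrank G c s)"


section \<open>Walks\<close>

text \<open>
  A run is the list of the visited nodes together with a flag. The flag is \<open>True\<close> if the walk
  terminated at its last node. It is \<open>False\<close> if the walk was to move (probability \<open>sqrt c\<close>) but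
  its current node has no in-neighbour: the walk then stops to exist without terminating at any
  node, so that a walk at \<open>w\<close> terminates there with probability \<open>1 - sqrt c\<close> whether or not
  \<open>w\<close> has in-neighbours.
\<close>

partial_function (spmf) walk_spmf ::
    "'a pair_pre_digraph \<Rightarrow> real \<Rightarrow> 'a \<Rightarrow> ('a list \<times> bool) spmf" where
  "walk_spmf G c v =
     bind_spmf (spmf_of_pmf (bernoulli_pmf (sqrt c))) (\<lambda>move.
       if \<not> move then return_spmf ([v], True)
       else if in_nbrs G v = {} then return_spmf ([v], False)
       else bind_spmf (spmf_of_set (in_nbrs G v)) (\<lambda>x.
              map_spmf (\<lambda>(xs, t). (v # xs, t)) (walk_spmf G c x)))"

text \<open>
  For \<open>0 < c < 1\<close> a run is finite with probability one (\<open>lossless_walk_spmf\<close> below), so \<open>the\<close>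
  is applied to \<open>None\<close> with probability zero only.
\<close>

definition walk :: "'a pair_pre_digraph \<Rightarrow> real \<Rightarrow> 'a \<Rightarrow> ('a list \<times> bool) pmf" where
  "walk G c v = map_pmf the (walk_spmf G c v)"

definition terminates_at :: "'a list \<times> bool \<Rightarrow> nat \<Rightarrow> 'a \<Rightarrow> bool" where
  "terminates_at t l w \<longleftrightarrow> snd t \<and> length (fst t) = Suc l \<and> last (fst t) = w"

text \<open>Step \<open>0\<close> is the start node and is excluded here.\<close>

definition meet_later :: "'a list \<times> bool \<Rightarrow> 'a list \<times> bool \<Rightarrow> bool" where
  "meet_later s t \<longleftrightarrow>
     (\<exists>k\<ge>1. k < length (fst s) \<and> k < length (fst t) \<and> fst s ! k = fst t ! k)"

definition walk_prob :: "'a pair_pre_digraph \<Rightarrow> real \<Rightarrow> nat \<Rightarrow> 'a \<Rightarrow> 'a \<Rightarrow> real" where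
  "walk_prob G c l u w = measure_pmf.prob (walk G c u) {t. terminates_at t l w}"

definition reverse_pagerank :: "'a pair_pre_digraph \<Rightarrow> real \<Rightarrow> 'a \<Rightarrow> real" where
  "reverse_pagerank G c w =
     1 / real (card (pverts G)) * (\<Sum>u\<in>pverts G. \<Sum>l. walk_prob G c l u w)"

definition pagerank_order :: "'a pair_pre_digraph \<Rightarrow> real \<Rightarrow> 'a list \<Rightarrow> bool" where
  "pagerank_order G c ws \<longleftrightarrow> distinct ws \<and> set ws = pverts G \<and>
     sorted_wrt (\<lambda>x y. reverse_pagerank G c x \<ge> reverse_pagerank G c y) ws"


section \<open>Index: backward search\<close>

definition r_max :: "real \<Rightarrow> real \<Rightarrow> real" where
  "r_max c \<epsilon> = (1 - sqrt c)\<^sup>2 * \<epsilon> / 12"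

text \<open>
  The state consists of the residues \<open>r l v\<close> and the reserves \<open>\<psi> l v\<close>. Pushing at level \<open>l\<close> only
  adds to residues of level \<open>l + 1\<close>, so all pushes of one level can be done at once.
\<close>

type_synonym 'a search_state = "(nat \<Rightarrow> 'a \<Rightarrow> real) \<times> (nat \<Rightarrow> 'a \<Rightarrow> real)"

definition push_level ::
    "'a pair_pre_digraph \<Rightarrow> real \<Rightarrow> real \<Rightarrow> nat \<Rightarrow> 'a search_state \<Rightarrow> 'a search_state" where
  "push_level G c \<epsilon> l = (\<lambda>(r, \<psi>).
     let active = {v \<in> pverts G. r l v > r_max c \<epsilon>} in
     (\<lambda>k z. if k = Suc l
            then r k z + (\<Sum>v\<in>{v \<in> active. z \<in> out_nbrs G v}. sqrt c * r l v / real (d_in G z))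
            else if k = l \<and> z \<in> active then 0 else r k z,
      \<lambda>k v. if k = l \<and> v \<in> active then \<psi> k v + (1 - sqrt c) * r l v else \<psi> k v))"

primrec search_state ::
    "'a pair_pre_digraph \<Rightarrow> real \<Rightarrow> real \<Rightarrow> 'a \<Rightarrow> nat \<Rightarrow> 'a search_state" where
  "search_state G c \<epsilon> w 0 = (\<lambda>k v. if k = 0 \<and> v = w then 1 else 0, \<lambda>k v. 0)"
| "search_state G c \<epsilon> w (Suc l) = push_level G c \<epsilon> l (search_state G c \<epsilon> w l)"

text \<open>The reserves of level \<open>l\<close> are final once the levels \<open>0, \<dots>, l\<close> have been processed.\<close>

definition reserve :: "'a pair_pre_digraph \<Rightarrow> real \<Rightarrow> real \<Rightarrow> nat \<Rightarrow> 'a \<Rightarrow> 'a \<Rightarrow> real" where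
  "reserve G c \<epsilon> l v w = snd (search_state G c \<epsilon> w (Suc l)) l v"

definition index_list ::
    "'a pair_pre_digraph \<Rightarrow> real \<Rightarrow> real \<Rightarrow> nat \<Rightarrow> 'a \<Rightarrow> ('a \<times> real) set" where
  "index_list G c \<epsilon> l w =
     {(v, reserve G c \<epsilon> l v w) | v. v \<in> pverts G \<and> reserve G c \<epsilon> l v w > r_max c \<epsilon>}"


section \<open>Variance bounded backward walk\<close>

text \<open>
  The law of \<open>f r\<close> for \<open>r\<close> uniform in \<open>(0,1)\<close>. It is a \<open>pmf\<close> only if \<open>f r\<close> is a discrete random
  variable; \<open>measure_pmf_vbbw_increment\<close> below shows this for the only use.
\<close>

definition uniform_law :: "(real \<Rightarrow> 'b) \<Rightarrow> 'b pmf" where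
  "uniform_law f =
     Abs_pmf (distr (uniform_measure lborel {0<..<1}) (count_space UNIV) f)"

text \<open>
  What a node \<open>x\<close> with current value \<open>h\<close> adds to the next level at \<open>y\<close>, once the draw \<open>r\<close> is made.
\<close>

definition vbbw_increment ::
    "'a pair_pre_digraph \<Rightarrow> real \<Rightarrow> real \<Rightarrow> 'a \<Rightarrow> real \<Rightarrow> 'a \<Rightarrow> real" where
  "vbbw_increment G c h x r y =
     (if y \<in> out_nbrs G x \<and> real (d_in G y) \<le> h / (1 - sqrt c) then h / real (d_in G y)
      else if y \<in> out_nbrs G x \<and> h / (1 - sqrt c) < real (d_in G y)
              \<and> real (d_in G y) \<le> h / (r * (1 - sqrt c)) then 1 - sqrt c
      else 0)"

definition vbbw_push ::
    "'a pair_pre_digraph \<Rightarrow> real \<Rightarrow> real \<Rightarrow> 'a \<Rightarrow> ('a \<Rightarrow> real) pmf" where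
  "vbbw_push G c h x =
     do { b \<leftarrow> bernoulli_pmf (sqrt c);
          if b then uniform_law (vbbw_increment G c h x) else return_pmf (\<lambda>y. 0) }"

primrec vbbw :: "'a pair_pre_digraph \<Rightarrow> real \<Rightarrow> 'a \<Rightarrow> nat \<Rightarrow> ('a \<Rightarrow> real) pmf" where
  "vbbw G c w 0 = return_pmf (\<lambda>x. if x = w then 1 - sqrt c else 0)"
| "vbbw G c w (Suc i) =
     do { p \<leftarrow> vbbw G c w i;
          inc \<leftarrow> Pi_pmf {x \<in> pverts G. p x \<noteq> 0} (\<lambda>y. 0) (\<lambda>x. vbbw_push G c (p x) x);
          return_pmf (\<lambda>y. \<Sum>x\<in>{x \<in> pverts G. p x \<noteq> 0}. inc x y) }"


section \<open>Query algorithm\<close>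

definition c_one :: "real \<Rightarrow> real" where
  "c_one c = 12 / (1 - sqrt c)\<^sup>2"

text \<open>The numbers of repetitions are rounded up to integers.\<close>

definition d_r :: "real \<Rightarrow> real \<Rightarrow> nat" where
  "d_r c \<epsilon> = nat \<lceil>c_one c / \<epsilon>\<^sup>2\<rceil>"

definition f_r :: "'a pair_pre_digraph \<Rightarrow> real \<Rightarrow> nat" where
  "f_r G \<delta> = nat \<lceil>3 * ln (real (card (pverts G)) / \<delta>)\<rceil>"

text \<open>
  One sample is \<open>None\<close> if the walk from \<open>u\<close> ends without terminating at a node or if the two
  walks from \<open>w\<close> meet: nothing is added then. Otherwise it records \<open>(l, w)\<close> and the output of the
  backward walk, the latter being replaced by \<open>0\<close> if \<open>w\<close> is a hub.
\<close>

type_synonym 'a sample = "((nat \<times> 'a) \<times> ('a \<Rightarrow> real)) option"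

definition query_sample ::
    "'a pair_pre_digraph \<Rightarrow> real \<Rightarrow> 'a set \<Rightarrow> 'a \<Rightarrow> 'a sample pmf" where
  "query_sample G c hubs u =
     do { t \<leftarrow> walk G c u;
          if \<not> snd t then return_pmf None
          else do {
            let w = last (fst t);
            let l = length (fst t) - 1;
            t1 \<leftarrow> walk G c w;
            t2 \<leftarrow> walk G c w;
            if meet_later t1 t2 then return_pmf None
            else do {
              p \<leftarrow> (if w \<in> hubs then return_pmf (\<lambda>v. 0) else vbbw G c w l);
              return_pmf (Some ((l, w), p)) } } }"

text \<open>The median of an even number of values is the mean of the two middle ones.\<close>

definition median :: "real list \<Rightarrow> real" where
  "median xs =
     (let ys = sort xs; m = length xs div 2 in
      if odd (length xs) then ys ! m else (ys ! (m - 1) + ys ! m) / 2)"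

context
  fixes G :: "'a pair_pre_digraph" and c \<epsilon> \<delta> :: real and hubs :: "'a set"
begin

text \<open>The argument \<open>S\<close> collects the samples of all iterations \<open>(i, j)\<close>.\<close>

definition eta_pi_hat :: "(nat \<times> nat \<Rightarrow> 'a sample) \<Rightarrow> nat \<Rightarrow> 'a \<Rightarrow> real" where
  "eta_pi_hat S l w =
     (\<Sum>ij\<in>{..<f_r G \<delta>} \<times> {..<d_r c \<epsilon>}.
        case S ij of None \<Rightarrow> 0
        | Some (lw, p) \<Rightarrow> if lw = (l, w) then 1 / real (d_r c \<epsilon> * f_r G \<delta>) else 0)"

definition s_B_round :: "(nat \<times> nat \<Rightarrow> 'a sample) \<Rightarrow> nat \<Rightarrow> 'a \<Rightarrow> real" where
  "s_B_round S i v =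
     (\<Sum>j<d_r c \<epsilon>.
        case S (i, j) of None \<Rightarrow> 0
        | Some (lw, p) \<Rightarrow> p v / ((1 - sqrt c)\<^sup>2 * real (d_r c \<epsilon>)))"

definition s_B_hat :: "(nat \<times> nat \<Rightarrow> 'a sample) \<Rightarrow> 'a \<Rightarrow> real" where
  "s_B_hat S v = median (map (\<lambda>i. s_B_round S i v) [0..<f_r G \<delta>])"

definition s_I_hat :: "(nat \<times> nat \<Rightarrow> 'a sample) \<Rightarrow> 'a \<Rightarrow> real" where
  "s_I_hat S v =
     (\<Sum>(w, l)\<in>{(w, l). w \<in> hubs \<and> eta_pi_hat S l w > \<epsilon> / c_one c}.
        \<Sum>(x, \<psi>)\<in>{e \<in> index_list G c \<epsilon> l w. fst e = v}.
          eta_pi_hat S l w * \<psi> / (1 - sqrt c)\<^sup>2)"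

definition s_hat :: "(nat \<times> nat \<Rightarrow> 'a sample) \<Rightarrow> 'a \<Rightarrow> real" where
  "s_hat S v = s_I_hat S v + s_B_hat S v"

definition query_output :: "(nat \<times> nat \<Rightarrow> 'a sample) \<Rightarrow> 'a \<rightharpoonup> real" where
  "query_output S = (\<lambda>v. if v \<in> pverts G \<and> s_hat S v \<noteq> 0 then Some (s_hat S v) else None)"

definition prsim_query :: "'a \<Rightarrow> ('a \<rightharpoonup> real) pmf" where
  "prsim_query u =
     map_pmf query_output
       (Pi_pmf ({..<f_r G \<delta>} \<times> {..<d_r c \<epsilon>}) None (\<lambda>ij. query_sample G c hubs u))"

end


section \<open>Well-definedness\<close>

lemma simrank_ex1:
  assumes G: "pair_fin_digraph G" and c: "0 < c" "c < 1"
  shows "\<exists>!s. is_simrank G c s"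
proof -
  let ?V = "pverts G" and ?I = "in_nbrs G"
  have fV: "finite ?V" using G by (simp add: pair_fin_digraph.pair_finite_verts)
  have fI: "finite (?I v)" for v using G by (rule finite_in_nbrs)
  have IV: "?I v \<subseteq> ?V" for v using G by (rule in_nbrs_subset)
  let ?k = "\<lambda>u v. c / (real (card (?I u)) * real (card (?I v)))"
  define T where "T s u v = (if u \<notin> ?V \<or> v \<notin> ?V then 0 else if u = v then 1
      else ?k u v * (\<Sum>u'\<in>?I u. \<Sum>v'\<in>?I v. s u' v'))" for s :: "'a \<Rightarrow> 'a \<Rightarrow> real" and u v
  have sr: "is_simrank G c s \<longleftrightarrow> (\<forall>u v. s u v = T s u v)" for s
    unfolding is_simrank_def T_def by (auto split: if_splits)
  have k0: "?k u v \<ge> 0" for u v using c by simp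
  have bound: "?k u v * (\<Sum>u'\<in>?I u. \<Sum>v'\<in>?I v. s u' v') \<le> c * M"
    if "\<And>x y. s x y \<le> M" "M \<ge> 0" for s :: "'a \<Rightarrow> 'a \<Rightarrow> real" and u v M
  proof -
    have "(\<Sum>u'\<in>?I u. \<Sum>v'\<in>?I v. s u' v') \<le> (\<Sum>u'\<in>?I u. \<Sum>v'\<in>?I v. M)"
      by (intro sum_mono that)
    also have "\<dots> = real (card (?I u)) * real (card (?I v)) * M" by simp
    finally have "?k u v * (\<Sum>u'\<in>?I u. \<Sum>v'\<in>?I v. s u' v')
        \<le> ?k u v * (real (card (?I u)) * real (card (?I v)) * M)"
      by (intro mult_left_mono k0)
    also have "\<dots> \<le> c * M" using c that(2) by (cases "card (?I u) = 0 \<or> card (?I v) = 0") auto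
    finally show ?thesis .
  qed
  define X where "X n = (T ^^ n) (\<lambda>_ _. 0)" for n
  have X0: "X 0 = (\<lambda>_ _. 0)" and XS: "X (Suc n) = T (X n)" for n by (auto simp: X_def)
  have Xle: "X n u v \<le> 1" for n u v
  proof (induction n arbitrary: u v)
    case 0 show ?case by (simp add: X0)
  next
    case (Suc n)
    have "?k u v * (\<Sum>u'\<in>?I u. \<Sum>v'\<in>?I v. X n u' v') \<le> c * 1" by (rule bound) (use Suc in auto)
    then show ?case using c unfolding XS T_def by auto
  qed
  have Xmono: "X n u v \<le> X (Suc n) u v" for n u v
  proof (induction n arbitrary: u v)
    case 0 show ?case using c by (simp add: X0 XS T_def)
  next
    case (Suc n)
    have "?k u v * (\<Sum>u'\<in>?I u. \<Sum>v'\<in>?I v. X n u' v')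
        \<le> ?k u v * (\<Sum>u'\<in>?I u. \<Sum>v'\<in>?I v. X (Suc n) u' v')"
      by (intro mult_left_mono sum_mono k0 Suc)
    then have "T (X n) u v \<le> T (X (Suc n)) u v" unfolding T_def by auto
    then show ?case by (simp only: XS)
  qed
  define s where "s u v = lim (\<lambda>n. X n u v)" for u v
  have lim: "(\<lambda>n. X n u v) \<longlonglongrightarrow> s u v" for u v
  proof -
    have "incseq (\<lambda>n. X n u v)" by (rule incseq_SucI) (rule Xmono)
    moreover have "\<forall>n. X n u v \<le> 1" using Xle by blast
    ultimately obtain L where "(\<lambda>n. X n u v) \<longlonglongrightarrow> L"
      by (rule incseq_convergent)
    then show ?thesis unfolding s_def using limI by metis
  qed
  have "s u v = T s u v" for u v
  proof (rule LIMSEQ_unique)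
    show "(\<lambda>n. X (Suc n) u v) \<longlonglongrightarrow> s u v" using lim by (rule LIMSEQ_Suc)
    show "(\<lambda>n. X (Suc n) u v) \<longlonglongrightarrow> T s u v"
    proof (cases "u \<in> ?V \<and> v \<in> ?V \<and> u \<noteq> v")
      case True
      then have T_eq: "T t u v = ?k u v * (\<Sum>u'\<in>?I u. \<Sum>v'\<in>?I v. t u' v')" for t
        by (simp add: T_def)
      show ?thesis unfolding XS T_eq
        by (intro tendsto_mult tendsto_const tendsto_sum lim)
    next
      case False
      then have "T (X n) u v = T s u v" for n by (auto simp: T_def)
      then show ?thesis by (simp add: XS)
    qed
  qed
  then have "is_simrank G c s" by (simp add: sr)
  moreover have "s1 = s2" if "is_simrank G c s1" "is_simrank G c s2" for s1 s2
  proof -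
    have le: "a u v - b u v \<le> 0" if a: "is_simrank G c a" and b: "is_simrank G c b" for a b u v
    proof (cases "u \<in> ?V \<and> v \<in> ?V")
      case False
      then show ?thesis using a b unfolding is_simrank_def by simp
    next
      case True
      let ?D = "(\<lambda>(x, y). a x y - b x y) ` (?V \<times> ?V)"
      define M where "M = Max ?D"
      have fD: "finite ?D" using fV by blast
      have ne: "?D \<noteq> {}" using True by blast
      have "M \<in> ?D" unfolding M_def by (rule Max_in[OF fD ne])
      then obtain x y where xy: "x \<in> ?V" "y \<in> ?V" "M = a x y - b x y" by auto
      have leM: "a p q - b p q \<le> M" if "p \<in> ?V" "q \<in> ?V" for p q
        unfolding M_def by (rule Max_ge[OF fD]) (use that in auto)
      have "a x x - b x x = 0" using a b xy unfolding is_simrank_def by simp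
      then have M0: "M \<ge> 0" using leM[of x x] xy by simp
      have all: "a p q - b p q \<le> M" for p q
      proof (cases "p \<in> ?V \<and> q \<in> ?V")
        case False
        then have "a p q = 0" "b p q = 0" using a b by (auto simp: sr T_def)
        then show ?thesis using M0 by simp
      qed (use leM in auto)
      have "M \<le> c * M"
      proof (cases "x = y")
        case True
        then show ?thesis using \<open>a x x - b x x = 0\<close> xy by simp
      next
        case False
        have "a x y = T a x y" "b x y = T b x y" using a b unfolding sr by blast+
        then have "M = ?k x y * (\<Sum>u'\<in>?I x. \<Sum>v'\<in>?I y. a u' v' - b u' v')"
          using False xy by (simp add: T_def sum_subtractf right_diff_distrib)
        also have "\<dots> \<le> c * M" by (rule bound) (use all M0 in auto)
        finally show ?thesis .
      qed
      then have "(1 - c) * M \<le> 0" by (simp add: algebra_simps)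
      then have "M \<le> 0" using c by (simp add: mult_le_0_iff)
      then show ?thesis using all[of u v] by linarith
    qed
    show ?thesis
    proof (intro ext)
      fix u v show "s1 u v = s2 u v" using le[OF that, of u v] le[OF that(2,1), of u v] by simp
    qed
  qed
  ultimately show ?thesis by blast
qed

lemma is_simrank_simrank:
  assumes "pair_fin_digraph G" "0 < c" "c < 1"
  shows "is_simrank G c (simrank G c)"
  unfolding simrank_def using simrank_ex1[OF assms] by (rule theI')

lemma lossless_walk_spmf:
  assumes G: "pair_fin_digraph G" and c: "0 < c" "c < 1"
  shows "lossless_spmf (walk_spmf G c v)"
proof -
  have sc: "0 \<le> sqrt c" "sqrt c < 1" using c by auto
  have None_map: "pmf (map_spmf f p) None = pmf p None"
    for f :: "'a list \<times> bool \<Rightarrow> 'a list \<times> bool" and p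
    by (simp add: pmf_None_eq_weight_spmf)
  have le: "pmf (walk_spmf G c v) None \<le> sqrt c ^ n" for n v
  proof (induction n arbitrary: v)
    case 0 show ?case by (simp add: pmf_le_1)
  next
    case (Suc n)
    have fin: "finite (in_nbrs G v)" using G by (rule finite_in_nbrs)
    have "pmf (walk_spmf G c v) None =
        sqrt c * (if in_nbrs G v = {} then 0
          else pmf (bind_spmf (spmf_of_set (in_nbrs G v))
                 (\<lambda>x. map_spmf (\<lambda>(xs, t). (v # xs, t)) (walk_spmf G c x))) None)"
      by (subst walk_spmf.simps) (use sc in \<open>simp add: pmf_bind\<close>)
    also have "\<dots> \<le> sqrt c * sqrt c ^ n"
    proof (intro mult_left_mono sc)
      show "(if in_nbrs G v = {} then 0
          else pmf (bind_spmf (spmf_of_set (in_nbrs G v))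
                 (\<lambda>x. map_spmf (\<lambda>(xs, t). (v # xs, t)) (walk_spmf G c x))) None) \<le> sqrt c ^ n"
      proof (cases "in_nbrs G v = {}")
        case True then show ?thesis using sc by simp
      next
        case False
        have "pmf (bind_spmf (spmf_of_set (in_nbrs G v))
                 (\<lambda>x. map_spmf (\<lambda>(xs, t). (v # xs, t)) (walk_spmf G c x))) None =
            (\<Sum>x\<in>in_nbrs G v. pmf (walk_spmf G c x) None) / card (in_nbrs G v)"
          using False fin
          by (simp add: pmf_bind_spmf_None measure_spmf_spmf_of_set integral_pmf_of_set None_map)
        also have "\<dots> \<le> (\<Sum>x\<in>in_nbrs G v. sqrt c ^ n) / card (in_nbrs G v)"
          by (intro divide_right_mono sum_mono Suc.IH) simp
        also have "\<dots> = sqrt c ^ n" using False fin by simp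
        finally show ?thesis using False by simp
      qed
    qed
    finally show ?case by simp
  qed
  have "(\<lambda>n. sqrt c ^ n) \<longlonglongrightarrow> 0" using sc by (intro LIMSEQ_realpow_zero)
  then have "pmf (walk_spmf G c v) None \<le> 0"
    by (rule LIMSEQ_le_const) (use le in blast)
  then show ?thesis by (simp add: lossless_iff_pmf_None order_antisym)
qed

lemma measure_pmf_vbbw_increment:
  assumes G: "pair_fin_digraph G"
  shows "measure_pmf (uniform_law (vbbw_increment G c h x)) =
    distr (uniform_measure lborel {0<..<1}) (count_space UNIV) (vbbw_increment G c h x)"
proof -
  let ?U = "uniform_measure lborel {0<..<1::real}" and ?O = "out_nbrs G x"
  let ?f = "vbbw_increment G c h x"
  let ?A = "\<lambda>r. {y \<in> ?O. real (d_in G y) \<le> h / (r * (1 - sqrt c))}"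
  let ?g = "\<lambda>A y. if y \<in> ?O \<and> real (d_in G y) \<le> h / (1 - sqrt c) then h / real (d_in G y)
      else if y \<in> A \<and> h / (1 - sqrt c) < real (d_in G y) then 1 - sqrt c else 0"
  have fO: "finite ?O" using G by (rule finite_out_nbrs)
  interpret U: prob_space ?U by (rule prob_space_uniform_measure) auto
  have A: "?A \<in> ?U \<rightarrow>\<^sub>M count_space (Pow ?O)"
  proof (subst measurable_count_space_eq2)
    show "finite (Pow ?O)" using fO by simp
    have "?A -` {S} \<inter> space ?U \<in> sets ?U" if "S \<in> Pow ?O" for S
    proof -
      have "?A -` {S} \<inter> space ?U =
          {r \<in> space borel. \<forall>y\<in>?O. (real (d_in G y) \<le> h / (r * (1 - sqrt c))) = (y \<in> S)}"
        using that by auto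
      also have "\<dots> \<in> sets borel" using fO by measurable
      finally show ?thesis by simp
    qed
    then show "?A \<in> space ?U \<rightarrow> Pow ?O \<and> (\<forall>S\<in>Pow ?O. ?A -` {S} \<inter> space ?U \<in> sets ?U)" by blast
  qed
  have "?g \<circ> ?A \<in> ?U \<rightarrow>\<^sub>M count_space UNIV" by (rule measurable_comp[OF A]) simp
  moreover have feq: "?f = ?g \<circ> ?A" by (auto simp: vbbw_increment_def fun_eq_iff)
  ultimately have f: "?f \<in> ?U \<rightarrow>\<^sub>M count_space UNIV" by simp
  let ?D = "distr ?U (count_space UNIV) ?f"
  interpret D: prob_space ?D by (rule U.prob_space_distr) (rule f)
  have fin: "finite (range ?f)"
    by (rule finite_subset[of _ "?g ` Pow ?O"]) (use fO feq in \<open>auto simp del: o_apply simp: o_def\<close>)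
  have "AE z in ?D. measure ?D {z} \<noteq> 0"
  proof -
    have "AE z in ?D. z \<in> range ?f" by (subst AE_distr_iff[OF f]) auto
    moreover have "AE z in ?D. \<forall>y\<in>range ?f. measure ?D {y} = 0 \<longrightarrow> z \<noteq> y"
    proof (subst AE_finite_all[OF fin], intro ballI)
      fix y assume "y \<in> range ?f"
      show "AE z in ?D. measure ?D {y} = 0 \<longrightarrow> z \<noteq> y"
      proof (cases "measure ?D {y} = 0")
        case True
        then have "{y} \<in> null_sets ?D" by (auto simp: null_sets_def D.emeasure_eq_measure)
        then show ?thesis using AE_not_in by force
      qed simp
    qed
    ultimately show ?thesis by eventually_elim blast
  qed
  then show ?thesis unfolding uniform_law_def
    by (subst Abs_pmf_inverse) (use D.prob_space_axioms in auto)
qed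

end

theory Submission
  imports Defs
begin

text \<open>
  Write \<open>a = sqrt c\<close> and let \<open>hit l u w\<close> be the probability that a walk from \<open>u\<close> visits \<open>w\<close> after
  \<open>l\<close> steps, so that \<open>(1 - a) * hit l u w\<close> is the probability that it terminates there. SimRank is
  the meeting probability of two walks; splitting at the last meeting,
  \<open>s u v\<close> is the sum of \<open>hit l u w * hit l v w * eta w\<close> over all \<open>l\<close> and \<open>w\<close>. The
  contribution of the hubs and that of the other nodes are estimated separately.

  The index estimate lies between an average of independent samples with values in
  \<open>[0, 1 / (1 - a)]\<close> and that average minus \<open>\<epsilon> / 4\<close>, where \<open>\<epsilon> / 12\<close> is lost by discarding small
  frequencies and \<open>\<epsilon> / 6\<close> by the residues and the discarded reserves. Hoeffding's inequality controls
  the average.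

  For the other nodes the usual bound \<open>\<pi>\<close> on the second moment of a backward walk is too weak for the
  \<open>3 * ln (n / \<delta>)\<close> rounds of the median. At level \<open>l\<close> it improves to \<open>(1 - a ^ Suc l) * \<pi>\<close>, and
  as the levels \<open>\<ge> k\<close> contribute at most \<open>c ^ k\<close> to SimRank, the variance of one round is at most
  \<open>\<epsilon>\<^sup>2 / 30\<close>. Chebyshev's inequality then bounds the probability that a round is off by
  \<open>21 / 40 * \<epsilon>\<close>, which is small enough for the median.
\<close>

section \<open>Products of discrete distributions and medians\<close>

lemma integrable_Pi_pmf_component:
  fixes g :: "'b \<Rightarrow> real"
  assumes "finite A" "x \<in> A" "integrable (measure_pmf (p x)) g"
  shows "integrable (measure_pmf (Pi_pmf A d p)) (\<lambda>f. g (f x))"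
    and "measure_pmf.expectation (Pi_pmf A d p) (\<lambda>f. g (f x)) = measure_pmf.expectation (p x) g"
proof -
  have eq: "map_pmf (\<lambda>f. f x) (Pi_pmf A d p) = p x"
    using assms by (simp add: Pi_pmf_component)
  have "integrable (measure_pmf (map_pmf (\<lambda>f. f x) (Pi_pmf A d p))) g"
    by (simp add: eq assms)
  then show "integrable (measure_pmf (Pi_pmf A d p)) (\<lambda>f. g (f x))"
    by (simp add: integrable_map_pmf_eq)
  have "measure_pmf.expectation (map_pmf (\<lambda>f. f x) (Pi_pmf A d p)) g = measure_pmf.expectation (p x) g"
    by (simp only: eq)
  then show "measure_pmf.expectation (Pi_pmf A d p) (\<lambda>f. g (f x)) = measure_pmf.expectation (p x) g"
    by simp
qed

text \<open>Different components are independent, so their cross terms factorize and all covariances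
  vanish. Besides the means only second moments are assumed integrable, because the values of a
  query sample need not be bounded.\<close>

lemma Pi_pmf_sum_moments:
  fixes g :: "'i \<Rightarrow> 'b \<Rightarrow> real"
  assumes A: "finite A"
    and i1: "\<And>x. x \<in> A \<Longrightarrow> integrable (measure_pmf (p x)) (g x)"
    and i2: "\<And>x. x \<in> A \<Longrightarrow> integrable (measure_pmf (p x)) (\<lambda>y. (g x y)\<^sup>2)"
  shows "integrable (measure_pmf (Pi_pmf A d p)) (\<lambda>f. (\<Sum>x\<in>A. g x (f x)))"
    and "measure_pmf.expectation (Pi_pmf A d p) (\<lambda>f. (\<Sum>x\<in>A. g x (f x)))
      = (\<Sum>x\<in>A. measure_pmf.expectation (p x) (g x))"
    and "integrable (measure_pmf (Pi_pmf A d p)) (\<lambda>f. (\<Sum>x\<in>A. g x (f x))\<^sup>2)"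
    and "measure_pmf.expectation (Pi_pmf A d p) (\<lambda>f. (\<Sum>x\<in>A. g x (f x))\<^sup>2)
      = (\<Sum>x\<in>A. measure_pmf.expectation (p x) (g x))\<^sup>2
        + (\<Sum>x\<in>A. measure_pmf.expectation (p x) (\<lambda>y. (g x y)\<^sup>2) - (measure_pmf.expectation (p x) (g x))\<^sup>2)"
proof -
  let ?P = "measure_pmf (Pi_pmf A d p)"
  let ?\<mu> = "\<lambda>x. measure_pmf.expectation (p x) (g x)"
  let ?q = "\<lambda>x. measure_pmf.expectation (p x) (\<lambda>y. (g x y)\<^sup>2)"
  note comp1 = integrable_Pi_pmf_component[where p=p and d=d, OF A _ i1]
  note comp2 = integrable_Pi_pmf_component[where p=p and d=d, OF A _ i2]
  show "integrable ?P (\<lambda>f. (\<Sum>x\<in>A. g x (f x)))"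
    by (intro Bochner_Integration.integrable_sum comp1)
  show "integral\<^sup>L ?P (\<lambda>f. (\<Sum>x\<in>A. g x (f x))) = (\<Sum>x\<in>A. ?\<mu> x)"
    by (subst Bochner_Integration.integral_sum) (simp_all add: comp1)
  have cross: "integrable ?P (\<lambda>f. g x (f x) * g y (f y)) \<and>
      integral\<^sup>L ?P (\<lambda>f. g x (f x) * g y (f y)) = (if x = y then ?q x else ?\<mu> x * ?\<mu> y)"
    if xy: "x \<in> A" "y \<in> A" for x y
  proof (cases "x = y")
    case True
    then show ?thesis using comp2[of x] xy by (simp add: power2_eq_square)
  next
    case False
    have "prob_space.indep_vars ?P (\<lambda>_. count_space UNIV) (\<lambda>x f. f x) A"
      by (rule indep_vars_Pi_pmf[OF A])
    then have "prob_space.indep_vars ?P (\<lambda>_. count_space UNIV) (\<lambda>x f. f x) {x,y}"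
      by (rule prob_space.indep_vars_subset[OF measure_pmf.prob_space_axioms]) (use xy in auto)
    then have ind: "prob_space.indep_vars ?P (\<lambda>_. borel) (\<lambda>x f. g x (f x)) {x,y}"
      by (rule prob_space.indep_vars_compose2[OF measure_pmf.prob_space_axioms]) auto
    have int: "integrable ?P (\<lambda>f. g z (f z))" if "z \<in> {x,y}" for z
      using that xy comp1(1) by auto
    have "integrable ?P (\<lambda>f. \<Prod>z\<in>{x,y}. g z (f z))"
      by (rule prob_space.indep_vars_integrable[OF measure_pmf.prob_space_axioms _ ind int]) auto
    moreover have "integral\<^sup>L ?P (\<lambda>f. \<Prod>z\<in>{x,y}. g z (f z)) = (\<Prod>z\<in>{x,y}. integral\<^sup>L ?P (\<lambda>f. g z (f z)))"
      by (rule prob_space.indep_vars_lebesgue_integral[OF measure_pmf.prob_space_axioms _ ind int]) auto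
    ultimately show ?thesis using False comp1(2) xy by simp
  qed
  have sq: "(\<lambda>f. (\<Sum>x\<in>A. g x (f x))\<^sup>2) = (\<lambda>f. \<Sum>x\<in>A. \<Sum>y\<in>A. g x (f x) * g y (f y))"
    by (simp add: power2_eq_square sum_product)
  show "integrable ?P (\<lambda>f. (\<Sum>x\<in>A. g x (f x))\<^sup>2)"
    unfolding sq using cross by (intro Bochner_Integration.integrable_sum) auto
  have "integral\<^sup>L ?P (\<lambda>f. (\<Sum>x\<in>A. g x (f x))\<^sup>2)
      = (\<Sum>x\<in>A. \<Sum>y\<in>A. integral\<^sup>L ?P (\<lambda>f. g x (f x) * g y (f y)))"
    unfolding sq using cross by (simp add: Bochner_Integration.integral_sum)
  \<comment> \<open>The diagonal is written as a product of means plus a correction, so that the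
    double sum splits into the squared mean and the sum of the variances.\<close>
  also have "\<dots> = (\<Sum>x\<in>A. \<Sum>y\<in>A. ?\<mu> x * ?\<mu> y + (if x = y then ?q x - (?\<mu> x)\<^sup>2 else 0))"
    by (intro sum.cong refl) (use cross in \<open>auto simp: power2_eq_square\<close>)
  also have "\<dots> = (\<Sum>x\<in>A. ?\<mu> x)\<^sup>2 + (\<Sum>x\<in>A. ?q x - (?\<mu> x)\<^sup>2)"
    using A by (simp add: sum.distrib power2_eq_square sum_product)
  finally show "integral\<^sup>L ?P (\<lambda>f. (\<Sum>x\<in>A. g x (f x))\<^sup>2)
      = (\<Sum>x\<in>A. ?\<mu> x)\<^sup>2 + (\<Sum>x\<in>A. ?q x - (?\<mu> x)\<^sup>2)" .
qed

section \<open>Independent rounds and their median\<close>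

lemma prob_pair_pmf_Times:
  "measure_pmf.prob (pair_pmf M N) (A \<times> B) = measure_pmf.prob M A * measure_pmf.prob N B"
proof -
  have "emeasure (pair_pmf M N) (A \<times> B) = (\<integral>\<^sup>+x. \<integral>\<^sup>+y. indicator A x * indicator B y \<partial>N \<partial>M)"
    by (subst nn_integral_indicator[symmetric])
       (simp_all add: nn_integral_pair_pmf' indicator_times)
  also have "\<dots> = emeasure M A * emeasure N B"
    by (simp add: nn_integral_cmult nn_integral_multc)
  finally show ?thesis
    by (simp add: measure_pmf.emeasure_eq_measure ennreal_mult''[symmetric])
qed

text \<open>By \<open>dep\<close> the event \<open>bad i\<close> reads only row \<open>i\<close> of
  the samples. Distinct rows are independent, so the probabilities multiply; the induction splits
  off one row at a time.\<close>

lemma prob_all_blocks: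
  assumes I: "finite I" and J: "finite J"
    and dep: "\<And>i S S'. (\<And>j. j \<in> J \<Longrightarrow> S (i, j) = S' (i, j)) \<Longrightarrow> bad i S = bad i S'"
    and p: "\<And>i. i \<in> I \<Longrightarrow> measure_pmf.prob (Pi_pmf ({i} \<times> J) d q) {S. bad i S} \<le> p"
  shows "measure_pmf.prob (Pi_pmf (I \<times> J) d q) {S. \<forall>i\<in>I. bad i S} \<le> p ^ card I"
  using I p
proof (induction I)
  case empty
  show ?case by simp
next
  case (insert i I)
  \<comment> \<open>Glues the samples of row \<open>i\<close> to those of the remaining
    rows.\<close>
  let ?h = "\<lambda>(f, g) x. if x \<in> {i} \<times> J then f x else g x"
  have U: "insert i I \<times> J = {i} \<times> J \<union> I \<times> J" by auto
  have "Pi_pmf (insert i I \<times> J) d q = map_pmf ?h (pair_pmf (Pi_pmf ({i} \<times> J) d q) (Pi_pmf (I \<times> J) d q))"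
    unfolding U using insert J by (intro Pi_pmf_union) auto
  then have "measure_pmf.prob (Pi_pmf (insert i I \<times> J) d q) {S. \<forall>i\<in>insert i I. bad i S}
      = measure_pmf.prob (pair_pmf (Pi_pmf ({i} \<times> J) d q) (Pi_pmf (I \<times> J) d q))
        (?h -` {S. \<forall>i\<in>insert i I. bad i S})"
    by simp
  also have "?h -` {S. \<forall>i\<in>insert i I. bad i S} = {S. bad i S} \<times> {S. \<forall>i\<in>I. bad i S}"
  proof -
    have 1: "bad i (?h (f, g)) = bad i f" for f g by (rule dep) auto
    have 2: "bad k (?h (f, g)) = bad k g" if "k \<in> I" for f g k
      by (rule dep) (use that insert in auto)
    have "(f, g) \<in> ?h -` {S. \<forall>i\<in>insert i I. bad i S} \<longleftrightarrow> bad i f \<and> (\<forall>k\<in>I. bad k g)" for f g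
      using 1[of f g] 2[of _ f g] by (simp del: split_conv)
    then show ?thesis by auto
  qed
  also have "measure_pmf.prob (pair_pmf (Pi_pmf ({i} \<times> J) d q) (Pi_pmf (I \<times> J) d q))
      ({S. bad i S} \<times> {S. \<forall>i\<in>I. bad i S})
      \<le> p * p ^ card I"
    unfolding prob_pair_pmf_Times
  proof (rule mult_mono)
    show "measure_pmf.prob (Pi_pmf ({i} \<times> J) d q) {S. bad i S} \<le> p"
      using insert.prems[of i] by auto
    then show "0 \<le> p" by (rule order_trans[rotated]) simp
    show "measure_pmf.prob (Pi_pmf (I \<times> J) d q) {S. \<forall>i\<in>I. bad i S} \<le> p ^ card I"
      by (rule insert.IH) (use insert.prems in auto)
  qed simp
  finally show ?case using insert by simp
qed

text \<open>By Pascal's rule the coefficient is the sum of two neighbouring entries of row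
  \<open>g\<close>, hence at most the whole row sum. This gains the factor 1/2 in
  \<open>prob_half_blocks_bad\<close>.\<close>

lemma binomial_ceil_half_le: "Suc g choose (Suc (Suc g) div 2) \<le> 2 ^ g"
proof -
  obtain j where j: "Suc (Suc g) div 2 = Suc j" by (cases "Suc (Suc g) div 2") auto
  have "Suc g choose (Suc (Suc g) div 2) = (\<Sum>k\<in>{j, Suc j}. g choose k)"
    unfolding j by simp
  \<comment> \<open>The range goes one past the row because \<open>Suc j\<close> exceeds
    \<open>g\<close> when \<open>g = 0\<close>; the extra coefficient is 0.\<close>
  also have "\<dots> \<le> (\<Sum>k\<le>Suc g. g choose k)"
    using j by (intro sum_mono2) auto
  also have "\<dots> = 2 ^ g" using choose_row_sum[of g] by simp
  finally show ?thesis .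
qed

text \<open>If at least half of the rounds are bad, then some set of \<open>k = Suc f div 2\<close>
  rounds consists of bad ones only. The union bound runs over these \<open>f choose k\<close> sets,
  each of probability at most \<open>p ^ k\<close>.\<close>

lemma prob_half_blocks_bad:
  assumes f: "0 < f" and J: "finite J"
    and dep: "\<And>i S S'. (\<And>j. j \<in> J \<Longrightarrow> S (i, j) = S' (i, j)) \<Longrightarrow> bad i S = bad i S'"
    and p: "\<And>i. measure_pmf.prob (Pi_pmf ({i} \<times> J) d q) {S. bad i S} \<le> p" and p1: "p \<le> 1"
  shows "measure_pmf.prob (Pi_pmf ({..<f} \<times> J) d q) {S. f \<le> 2 * card {i\<in>{..<f}. bad i S}}
     \<le> (2 * sqrt p) ^ f / 2"
proof -
  let ?P = "Pi_pmf ({..<f} \<times> J) d q"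
  have p0: "0 \<le> p" using p[of 0] by (rule order_trans[rotated]) simp
  define k where "k = Suc f div 2"
  define F where "F = {B. B \<subseteq> {..<f} \<and> card B = k}"
  have finF: "finite F" unfolding F_def by (rule finite_subset[of _ "Pow {..<f}"]) auto
  have cardF: "card F = f choose k" unfolding F_def using n_subsets[of "{..<f}" k] by simp
  have sub: "{S. f \<le> 2 * card {i\<in>{..<f}. bad i S}} \<subseteq> (\<Union>B\<in>F. {S. \<forall>i\<in>B. bad i S})"
  proof
    fix S assume "S \<in> {S. f \<le> 2 * card {i\<in>{..<f}. bad i S}}"
    then have "k \<le> card {i\<in>{..<f}. bad i S}" unfolding k_def by auto
    then obtain B where "B \<subseteq> {i\<in>{..<f}. bad i S}" "card B = k"
      by (rule obtain_subset_with_card_n) blast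
    then show "S \<in> (\<Union>B\<in>F. {S. \<forall>i\<in>B. bad i S})" unfolding F_def by blast
  qed
  have one: "measure_pmf.prob ?P {S. \<forall>i\<in>B. bad i S} \<le> p ^ k" if B: "B \<in> F" for B
  proof -
    have Bs: "B \<subseteq> {..<f}" "card B = k" using B by (auto simp: F_def)
    have fB: "finite B" by (rule finite_subset[OF Bs(1)]) simp
    \<comment> \<open>The marginal on the rows of \<open>B\<close>: all other samples are reset to
      the default \<open>d\<close>, which no event of a row in \<open>B\<close> can see.\<close>
    let ?m = "\<lambda>f x. if x \<in> B \<times> J then f x else d"
    have "Pi_pmf (B \<times> J) d q = map_pmf ?m ?P"
      using Bs J by (intro Pi_pmf_subset) auto
    moreover have "bad i (?m S) = bad i S" if "i \<in> B" for i S
      by (rule dep) (use that in auto)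
    then have "?m -` {S. \<forall>i\<in>B. bad i S} = {S. \<forall>i\<in>B. bad i S}" by auto
    ultimately have "measure_pmf.prob ?P {S. \<forall>i\<in>B. bad i S}
        = measure_pmf.prob (Pi_pmf (B \<times> J) d q) {S. \<forall>i\<in>B. bad i S}"
      by simp
    also have "\<dots> \<le> p ^ card B"
      by (rule prob_all_blocks[OF fB J dep]) (use p in auto)
    finally show ?thesis using Bs by simp
  qed
  have "measure_pmf.prob ?P {S. f \<le> 2 * card {i\<in>{..<f}. bad i S}}
      \<le> measure_pmf.prob ?P (\<Union>B\<in>F. {S. \<forall>i\<in>B. bad i S})"
    by (intro measure_pmf.finite_measure_mono sub) auto
  also have "\<dots> \<le> (\<Sum>B\<in>F. measure_pmf.prob ?P {S. \<forall>i\<in>B. bad i S})"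
    by (rule measure_UNION_le[OF finF]) auto
  also have "\<dots> \<le> (\<Sum>B\<in>F. p ^ k)" by (intro sum_mono one)
  also have "\<dots> = real (f choose k) * p ^ k" by (simp add: cardF)
  also have "\<dots> \<le> 2 ^ (f - 1) * sqrt p ^ f"
  proof (rule mult_mono)
    have "f choose k \<le> 2 ^ (f - 1)"
      using f binomial_ceil_half_le[of "f - 1"] unfolding k_def by simp
    then show "real (f choose k) \<le> 2 ^ (f - 1)"
      by (metis of_nat_le_iff of_nat_numeral of_nat_power)
    \<comment> \<open>As \<open>f <= 2 * k\<close> and \<open>sqrt p <= 1\<close>, passing to the
      exponent \<open>f\<close> removes the dependence on the parity of \<open>f\<close>.\<close>
    have "p ^ k = sqrt p ^ (2 * k)" using p0 by (simp add: power_mult)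
    also have "\<dots> \<le> sqrt p ^ f"
      by (rule power_decreasing) (use p0 p1 in \<open>auto simp: k_def\<close>)
    finally show "p ^ k \<le> sqrt p ^ f" .
  qed (use p0 in auto)
  also have "\<dots> = (2 * sqrt p) ^ f / 2"
    using f by (cases f) (auto simp: power_mult_distrib)
  finally show ?thesis .
qed

text \<open>If a middle entry of the sorted list exceeded \<open>b + t\<close>, so would all later
  entries, at least half of the list; symmetrically below \<open>b - t\<close>. For even length this
  is applied to both middle entries.\<close>

lemma median_deviation_le:
  assumes len: "0 < length xs"
    and few: "2 * card {i. i < length xs \<and> \<bar>xs ! i - b\<bar> \<ge> t} < length xs"
  shows "\<bar>median xs - b\<bar> \<le> t"
proof -
  define ys where "ys = sort xs"
  have srt: "sorted ys" and ly: "length ys = length xs" by (simp_all add: ys_def)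
  have "length (filter (\<lambda>x. \<bar>x - b\<bar> \<ge> t) ys) = length (filter (\<lambda>x. \<bar>x - b\<bar> \<ge> t) xs)"
    unfolding ys_def by (metis mset_sort mset_filter size_mset)
  then have cnt: "2 * card {i. i < length xs \<and> \<bar>ys ! i - b\<bar> \<ge> t} < length xs"
    using few by (simp add: length_filter_conv_card ly)
  have up: "ys ! k \<le> b + t" if k: "k < length xs" "length xs \<le> 2 * (length xs - k)" for k
  proof (rule ccontr)
    assume "\<not> ?thesis"
    then have "{k..<length xs} \<subseteq> {i. i < length xs \<and> \<bar>ys ! i - b\<bar> \<ge> t}"
      using sorted_nth_mono[OF srt, of k] by (auto simp: ly) (smt (verit))
    then have "card {k..<length xs} \<le> card {i. i < length xs \<and> \<bar>ys ! i - b\<bar> \<ge> t}"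
      by (intro card_mono) auto
    then show False using cnt k by simp
  qed
  have lo: "b - t \<le> ys ! k" if k: "k < length xs" "length xs \<le> 2 * Suc k" for k
  proof (rule ccontr)
    assume "\<not> ?thesis"
    then have "{..k} \<subseteq> {i. i < length xs \<and> \<bar>ys ! i - b\<bar> \<ge> t}"
      using sorted_nth_mono[OF srt, of _ k] k by (auto simp: ly) (smt (verit))
    then have "card {..k} \<le> card {i. i < length xs \<and> \<bar>ys ! i - b\<bar> \<ge> t}"
      by (intro card_mono) auto
    then show False using cnt k by simp
  qed
  let ?m = "length xs div 2"
  show ?thesis
  proof (cases "odd (length xs)")
    case True
    then have "median xs = ys ! ?m" by (simp add: median_def ys_def)
    moreover have "ys ! ?m \<le> b + t" "b - t \<le> ys ! ?m"
      using True len by (intro up lo; presburger)+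
    ultimately show ?thesis by linarith
  next
    case False
    then have "median xs = (ys ! (?m - 1) + ys ! ?m) / 2" by (simp add: median_def ys_def Let_def)
    moreover have "ys ! ?m \<le> b + t" "b - t \<le> ys ! ?m" "ys ! (?m - 1) \<le> b + t" "b - t \<le> ys ! (?m - 1)"
      using False len by (intro up lo; presburger)+
    ultimately show ?thesis by (auto simp: abs_le_iff field_simps)
  qed
qed

text \<open>Both tails of Hoeffding's inequality for the average of identically distributed samples
  in \<open>[0, B]\<close>; a deviation \<open>t\<close> of the average is a deviation
  \<open>N * t\<close> of the sum.\<close>

lemma Hoeffding_Pi_pmf:
  fixes Y :: "'b \<Rightarrow> real"
  assumes I: "finite I" "I \<noteq> {}" and B: "0 < B" "\<And>x. 0 \<le> Y x \<and> Y x \<le> B" and t: "0 \<le> t"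
    and N: "N = real (card I)"
  shows "measure_pmf.prob (Pi_pmf I d (\<lambda>_. q)) {S. measure_pmf.expectation q Y + t \<le> (\<Sum>i\<in>I. Y (S i)) / N}
      \<le> exp (- 2 * N * t\<^sup>2 / B\<^sup>2)" (is "?A \<le> _")
    and "measure_pmf.prob (Pi_pmf I d (\<lambda>_. q)) {S. (\<Sum>i\<in>I. Y (S i)) / N \<le> measure_pmf.expectation q Y - t}
      \<le> exp (- 2 * N * t\<^sup>2 / B\<^sup>2)" (is "?C \<le> _")
proof -
  let ?P = "measure_pmf (Pi_pmf I d (\<lambda>_. q))"
  have N0: "0 < N" using I N by (simp add: card_gt_0_iff)
  have intY: "integrable (measure_pmf q) Y"
    by (rule measure_pmf.integrable_const_bound[where B=B]) (use B in auto)
  have ind: "prob_space.indep_vars ?P (\<lambda>_. borel) (\<lambda>i S. Y (S i)) I"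
    by (rule prob_space.indep_vars_compose2[OF measure_pmf.prob_space_axioms indep_vars_Pi_pmf[OF I(1)]]) auto
  interpret H: Hoeffding_ineq ?P I "\<lambda>i S. Y (S i)" "\<lambda>_. 0" "\<lambda>_. B" "\<Sum>i\<in>I. integral\<^sup>L ?P (\<lambda>S. Y (S i))"
    by unfold_locales (use I ind B in auto)
  have \<mu>: "(\<Sum>i\<in>I. integral\<^sup>L ?P (\<lambda>S. Y (S i))) = N * measure_pmf.expectation q Y"
    using integrable_Pi_pmf_component(2)[OF I(1), of _ "\<lambda>_. q" Y] intY by (simp add: N)
  have sum: "(\<Sum>i\<in>I. (B - 0)\<^sup>2) = N * B\<^sup>2" by (simp add: N)
  have ex: "- 2 * (N * t)\<^sup>2 / (N * B\<^sup>2) = - 2 * N * t\<^sup>2 / B\<^sup>2"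
    using N0 by (simp add: power2_eq_square field_simps)
  have "?A = measure ?P {S\<in>space ?P. N * measure_pmf.expectation q Y + N * t \<le> (\<Sum>i\<in>I. Y (S i))}"
    using N0 by (intro arg_cong[where f="measure ?P"]) (auto simp: field_simps)
  also have "\<dots> \<le> exp (- 2 * (N * t)\<^sup>2 / (N * B\<^sup>2))"
    using H.Hoeffding_ineq_ge[of "N * t"] N0 t B unfolding \<mu> sum by simp
  finally show "?A \<le> exp (- 2 * N * t\<^sup>2 / B\<^sup>2)" unfolding ex .
  have "?C = measure ?P {S\<in>space ?P. (\<Sum>i\<in>I. Y (S i)) \<le> N * measure_pmf.expectation q Y - N * t}"
    using N0 by (intro arg_cong[where f="measure ?P"]) (auto simp: field_simps)
  also have "\<dots> \<le> exp (- 2 * (N * t)\<^sup>2 / (N * B\<^sup>2))"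
    using H.Hoeffding_ineq_le[of "N * t"] N0 t B unfolding \<mu> sum by simp
  finally show "?C \<le> exp (- 2 * N * t\<^sup>2 / B\<^sup>2)" unfolding ex .
qed

section \<open>A fixed graph and decay factor: basic facts\<close>

locale pagerank_graph =
  fixes G :: "'a pair_pre_digraph" and c :: real
  assumes graph: "pair_fin_digraph G" and c0: "0 < c" and c1: "c < 1"
begin

abbreviation "a \<equiv> sqrt c"
abbreviation "V \<equiv> pverts G"
abbreviation "I \<equiv> in_nbrs G"

lemma a_pos: "0 < a" and a_less: "a < 1" and a_sq: "a * a = c"
  using c0 c1 by auto

lemma finite_V: "finite V" using graph by (simp add: pair_fin_digraph.pair_finite_verts)
lemma finite_I: "finite (I v)" using graph by (rule finite_in_nbrs)
lemma I_sub: "x \<in> I v \<Longrightarrow> x \<in> V" using in_nbrs_subset[OF graph] by blast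

text \<open>The condition \<open>0 <= M\<close> covers a node without in-neighbours, where division
  by zero makes the average 0.\<close>

lemma average_le:
  assumes "\<And>x. x \<in> I v \<Longrightarrow> h x \<le> M" "0 \<le> M"
  shows "(\<Sum>x\<in>I v. h x) / real (card (I v)) \<le> M"
proof -
  have "(\<Sum>x\<in>I v. h x) \<le> real (card (I v)) * M" by (rule sum_bounded_above) (rule assms)
  then show ?thesis using assms(2)
    by (cases "card (I v) = 0") (simp_all add: divide_le_eq mult.commute)
qed

section \<open>Walks and SimRank\<close>

text \<open>First-step recursion for the probability that a walk from \<open>v\<close> is at
  \<open>w\<close> after \<open>l\<close> steps. At a node without in-neighbours the quotient is 0,
  in accordance with the walk that stops there.\<close>

primrec hit :: "nat \<Rightarrow> 'a \<Rightarrow> 'a \<Rightarrow> real" where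
  "hit 0 v w = (if v = w then 1 else 0)"
| "hit (Suc l) v w = a * ((\<Sum>x\<in>I v. hit l x w) / real (card (I v)))"

lemma hit_nonneg: "0 \<le> hit l v w"
proof (induction l arbitrary: v)
  case (Suc l)
  then have "0 \<le> (\<Sum>x\<in>I v. hit l x w) / real (card (I v))"
    by (intro divide_nonneg_nonneg sum_nonneg) auto
  then show ?case using a_pos by (metis hit.simps(2) mult_nonneg_nonneg less_imp_le)
qed simp

lemma hit_le: "hit l v w \<le> a ^ l"
proof (induction l arbitrary: v)
  case (Suc l)
  have "(\<Sum>x\<in>I v. hit l x w) / real (card (I v)) \<le> a ^ l"
    by (rule average_le) (use Suc c0 in auto)
  then show ?case using a_pos by (simp only: hit.simps power_Suc mult_left_mono less_imp_le)
qed simp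

lemma hit_outside: "v \<in> V \<Longrightarrow> w \<notin> V \<Longrightarrow> hit l v w = 0"
proof (induction l arbitrary: v)
  case (Suc l)
  then show ?case using I_sub[of _ v] by simp
qed auto

lemma sum_hit_le: "v \<in> V \<Longrightarrow> (\<Sum>w\<in>V. hit l v w) \<le> a ^ l"
proof (induction l arbitrary: v)
  case 0
  then show ?case using finite_V by simp
next
  case (Suc l)
  have "(\<Sum>w\<in>V. hit (Suc l) v w) = a * ((\<Sum>x\<in>I v. \<Sum>w\<in>V. hit l x w) / real (card (I v)))"
    by (simp add: sum_distrib_left sum_divide_distrib sum.swap[of _ V])
  also have "(\<Sum>x\<in>I v. \<Sum>w\<in>V. hit l x w) / real (card (I v)) \<le> a ^ l"
    by (rule average_le) (use Suc I_sub c0 in auto)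
  finally show ?case using a_pos by simp
qed

text \<open>Since \<open>walk_spmf\<close> is lossless, it is the embedding of \<open>walk\<close>,
  and its defining equation can be carried over to \<open>pmf\<close>.\<close>

lemma walk_unfold:
  "walk G c v = bernoulli_pmf a \<bind> (\<lambda>move.
     if \<not> move then return_pmf ([v], True)
     else if I v = {} then return_pmf ([v], False)
     else pmf_of_set (I v) \<bind> (\<lambda>x. map_pmf (\<lambda>(xs, t). (v # xs, t)) (walk G c x)))"
  (is "_ = ?R")
proof -
  have S: "walk_spmf G c v = spmf_of_pmf (walk G c v)" for v
  proof -
    obtain p where p: "walk_spmf G c v = spmf_of_pmf p"
      using lossless_walk_spmf[OF graph c0 c1, of v] unfolding lossless_spmf_conv_spmf_of_pmf by blast
    then have "walk G c v = p"
      unfolding walk_def by (simp add: spmf_of_pmf_def pmf.map_comp o_def)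
    then show ?thesis using p by simp
  qed
  have "spmf_of_pmf (walk G c v) = spmf_of_pmf ?R"
    unfolding S[symmetric] spmf_of_pmf_bind
    by (subst walk_spmf.simps, unfold bind_spmf_of_pmf, intro bind_pmf_cong refl)
       (use finite_I[of v] in \<open>simp add: S spmf_of_pmf_bind map_spmf_of_pmf spmf_of_pmf_pmf_of_set[symmetric]
          del: spmf_of_pmf_pmf_of_set\<close>)
  then have "map_pmf the (spmf_of_pmf (walk G c v)) = map_pmf the (spmf_of_pmf ?R)" by simp
  then show ?thesis by (simp add: spmf_of_pmf_def pmf.map_comp o_def)
qed

lemma walk_start: "t \<in> set_pmf (walk G c v) \<Longrightarrow> \<exists>xs. fst t = v # xs"
  by (subst (asm) walk_unfold) (auto split: if_splits)

lemma nn_integral_walk: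
  fixes F :: "'a list \<times> bool \<Rightarrow> ennreal"
  shows "(\<integral>\<^sup>+t. F t \<partial>walk G c v) = ennreal (1 - a) * F ([v], True) + ennreal a *
     (if I v = {} then F ([v], False)
      else (\<Sum>x\<in>I v. \<integral>\<^sup>+t. F (v # fst t, snd t) \<partial>walk G c x) / ennreal (real (card (I v))))"
  using a_pos a_less finite_I[of v]
  by (subst walk_unfold) (simp add: nn_integral_pmf_of_set case_prod_unfold mult.commute add.commute
     ennreal_of_nat_eq_real_of_nat)

text \<open>First-step analysis for bounded \<open>F\<close>. It is computed with nonnegative
  integrals and then read back as a real identity, boundedness giving integrability.\<close>

lemma expectation_walk:
  fixes F :: "_ \<Rightarrow> real"
  assumes F: "\<And>t. 0 \<le> F t" "\<And>t. F t \<le> B"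
  shows "measure_pmf.expectation (walk G c v) F = (1 - a) * F ([v], True) + a *
     (if I v = {} then F ([v], False)
      else (\<Sum>x\<in>I v. measure_pmf.expectation (walk G c x) (\<lambda>t. F (v # fst t, snd t))) / card (I v))"
proof -
  have int: "integrable (measure_pmf p) (\<lambda>t. F (h t))" for p :: "('a list \<times> bool) pmf" and h
    by (rule measure_pmf.integrable_const_bound[where B=B]) (use F in auto)
  have nn: "(\<integral>\<^sup>+t. ennreal (F (h t)) \<partial>measure_pmf p) = ennreal (measure_pmf.expectation p (\<lambda>t. F (h t)))"
    for p :: "('a list \<times> bool) pmf" and h
    by (rule nn_integral_eq_integral[OF int]) (use F in auto)
  have nonneg: "0 \<le> measure_pmf.expectation p (\<lambda>t. F (h t))" for p :: "('a list \<times> bool) pmf" and h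
    by (rule Bochner_Integration.integral_nonneg) (use F in auto)
  have "ennreal (measure_pmf.expectation (walk G c v) F) = (\<integral>\<^sup>+t. ennreal (F t) \<partial>walk G c v)"
    using nn[of "walk G c v" "\<lambda>t. t"] by simp
  also have "\<dots> = ennreal ((1 - a) * F ([v], True) + a *
     (if I v = {} then F ([v], False)
      else (\<Sum>x\<in>I v. measure_pmf.expectation (walk G c x) (\<lambda>t. F (v # fst t, snd t))) / card (I v)))"
  proof (cases "I v = {}")
    case True
    then show ?thesis using a_pos a_less F
      by (subst nn_integral_walk) (simp add: ennreal_mult' ennreal_plus)
  next
    case False
    then have pos: "0 < card (I v)" using finite_I by (simp add: card_gt_0_iff)
    have "(\<Sum>x\<in>I v. \<integral>\<^sup>+t. ennreal (F (v # fst t, snd t)) \<partial>walk G c x) / ennreal (real (card (I v)))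
      = ennreal ((\<Sum>x\<in>I v. measure_pmf.expectation (walk G c x) (\<lambda>t. F (v # fst t, snd t))) / card (I v))"
      using pos by (simp add: nn sum_ennreal nonneg divide_ennreal sum_nonneg)
    moreover define X where "X = (\<Sum>x\<in>I v. measure_pmf.expectation (walk G c x) (\<lambda>t. F (v # fst t, snd t))) / card (I v)"
    ultimately have "(\<integral>\<^sup>+t. ennreal (F t) \<partial>walk G c v) = ennreal (1 - a) * ennreal (F ([v], True)) + ennreal a * ennreal X"
      using False by (subst nn_integral_walk) simp
    also have "\<dots> = ennreal ((1 - a) * F ([v], True) + a * X)"
    proof -
      have "0 \<le> X" unfolding X_def by (intro divide_nonneg_nonneg sum_nonneg nonneg) auto
      then show ?thesis using F a_pos a_less
        by (simp add: ennreal_mult[symmetric] ennreal_plus[symmetric] del: ennreal_plus)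
    qed
    finally show ?thesis using False by (simp add: X_def)
  qed
  finally show ?thesis
    by (subst (asm) ennreal_inj)
       (use a_pos a_less F nonneg[of "walk G c v" "\<lambda>t. t"] in \<open>auto intro!: add_nonneg_nonneg mult_nonneg_nonneg divide_nonneg_nonneg sum_nonneg nonneg\<close>)
qed


lemma expectation_of_bool: "measure_pmf.expectation p (\<lambda>t. of_bool (P t) :: real) = measure_pmf.prob p {t. P t}"
proof -
  have "(\<lambda>t. of_bool (P t) :: real) = indicator {t. P t}" by (auto simp: indicator_def)
  then show ?thesis by simp
qed

lemma prob_eq_pmfI:
  "(\<And>t. t \<in> set_pmf p \<Longrightarrow> P t = Q t) \<Longrightarrow> measure_pmf.prob p {t. P t} = measure_pmf.prob p {t. Q t}"
  by (intro measure_pmf.finite_measure_eq_AE AE_pmfI) auto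

lemma prob_terminates_at:
  "measure_pmf.prob (walk G c v) {t. terminates_at t l w} = (1 - a) * hit l v w"
proof (induction l arbitrary: v)
  case 0
  \<comment> \<open>A walk that has moved has visited at least two nodes, so it cannot terminate
    after 0 steps.\<close>
  have "measure_pmf.prob (walk G c x) {t. terminates_at (v # fst t, snd t) 0 w} = measure_pmf.prob (walk G c x) {t. False}" for x
    by (rule prob_eq_pmfI) (auto simp: terminates_at_def dest!: walk_start)
  then have eq: "measure_pmf.expectation (walk G c x) (\<lambda>t. of_bool (terminates_at (v # fst t, snd t) 0 w) :: real) = 0" for x
    by (simp add: expectation_of_bool)
  show ?case
    unfolding expectation_of_bool[symmetric]
    by (subst expectation_walk[where B=1], simp_all only: eq of_bool_eq(1))
       (auto simp: terminates_at_def of_bool_def)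
next
  case (Suc l)
  have "measure_pmf.prob (walk G c x) {t. terminates_at (v # fst t, snd t) (Suc l) w}
    = measure_pmf.prob (walk G c x) {t. terminates_at t l w}" for x
    by (rule prob_eq_pmfI) (auto simp: terminates_at_def dest!: walk_start)
  then have eq: "measure_pmf.expectation (walk G c x) (\<lambda>t. of_bool (terminates_at (v # fst t, snd t) (Suc l) w) :: real)
    = (1 - a) * hit l x w" for x
    by (simp add: expectation_of_bool Suc)
  show ?case
    unfolding expectation_of_bool[symmetric]
    by (subst expectation_walk[where B=1], simp_all only: eq)
       (auto simp: terminates_at_def of_bool_def sum_distrib_left[symmetric])
qed

text \<open>The events of terminating at \<open>w\<close> after \<open>l\<close> steps are disjoint
  and cover every run with flag \<open>True\<close>, so the integral splits into a series over the
  possible ends.\<close>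

lemma nn_integral_walk_end:
  assumes v: "v \<in> V"
  shows "(\<integral>\<^sup>+t. (if snd t then \<Phi> (length (fst t) - 1) (last (fst t)) else 0) \<partial>walk G c v)
    = (\<Sum>l. \<Sum>w\<in>V. ennreal ((1 - a) * hit l v w) * \<Phi> l w)"
proof -
  have pt: "(if snd t then \<Phi> (length (fst t) - 1) (last (fst t)) else 0)
    = (\<Sum>l. \<Sum>w\<in>V. indicator {t. terminates_at t l w} t * \<Phi> l w)"
    if t: "t \<in> set_pmf (walk G c v)" for t
  proof (cases "snd t")
    case False
    then show ?thesis by (simp add: terminates_at_def)
  next
    case True
    define l0 where "l0 = length (fst t) - 1"
    have at_iff: "terminates_at t l w \<longleftrightarrow> l = l0 \<and> w = last (fst t)" for l w
      using walk_start[OF t] True by (auto simp: terminates_at_def l0_def)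
    \<comment> \<open>Otherwise \<open>t\<close> would be a possible run inside an event of
      probability 0, as \<open>hit\<close> vanishes outside \<open>V\<close>.\<close>
    have "last (fst t) \<in> V"
    proof (rule ccontr)
      assume "\<not> ?thesis"
      then have "measure_pmf.prob (walk G c v) {s. terminates_at s l0 (last (fst t))} = 0"
        using v by (simp add: prob_terminates_at hit_outside)
      then have "t \<notin> {s. terminates_at s l0 (last (fst t))}"
        using t by (auto simp: measure_pmf_zero_iff)
      then show False using at_iff by blast
    qed
    then have "(\<Sum>w\<in>V. indicator {t. terminates_at t l w} t * \<Phi> l w)
       = (if l = l0 then \<Phi> l0 (last (fst t)) else 0)" for l
      using finite_V by (simp add: at_iff indicator_def if_distrib if_distribR cong: if_cong)
    then show ?thesis using True sums_unique[OF sums_single[of l0 "\<lambda>_. \<Phi> l0 (last (fst t))"]] by (simp add: l0_def)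
  qed
  have "(\<integral>\<^sup>+t. (if snd t then \<Phi> (length (fst t) - 1) (last (fst t)) else 0) \<partial>walk G c v)
    = (\<integral>\<^sup>+t. (\<Sum>l. \<Sum>w\<in>V. indicator {t. terminates_at t l w} t * \<Phi> l w) \<partial>walk G c v)"
    by (intro nn_integral_cong_AE AE_pmfI pt)
  also have "\<dots> = (\<Sum>l. \<Sum>w\<in>V. emeasure (walk G c v) {t. terminates_at t l w} * \<Phi> l w)"
    by (simp add: nn_integral_suminf nn_integral_sum nn_integral_multc)
  finally show ?thesis
    by (simp add: measure_pmf.emeasure_eq_measure prob_terminates_at)
qed

section \<open>SimRank as a meeting probability\<close>

definition meet_prob :: "'a \<Rightarrow> 'a \<Rightarrow> real" where
  "meet_prob u v = measure_pmf.expectation (walk G c u)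
     (\<lambda>s. measure_pmf.prob (walk G c v) {t. meet_later s t})"

lemma meet_later_Cons:
  "meet_later (u # fst s, p) (v # fst t, q) \<longleftrightarrow>
    (fst s \<noteq> [] \<and> fst t \<noteq> [] \<and> hd (fst s) = hd (fst t)) \<or> meet_later s t"
proof -
  let ?xs = "fst s" and ?ys = "fst t"
  have shift: "(\<exists>k\<ge>1. P k) \<longleftrightarrow> (\<exists>k. P (Suc k))" for P :: "nat \<Rightarrow> bool"
  proof
    assume "\<exists>k\<ge>1. P k"
    then obtain k where "1 \<le> k" "P k" by blast
    then have "P (Suc (k - 1))" by simp
    then show "\<exists>k. P (Suc k)" by blast
  qed auto
  define P where "P k \<longleftrightarrow> k < length ?xs \<and> k < length ?ys \<and> ?xs ! k = ?ys ! k" for k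
  have "meet_later (u # ?xs, p) (v # ?ys, q) \<longleftrightarrow> (\<exists>k. P k)"
    unfolding meet_later_def shift by (simp add: P_def)
  also have "\<dots> \<longleftrightarrow> P 0 \<or> (\<exists>k\<ge>1. P k)"
    unfolding shift by (metis not0_implies_Suc)
  also have "P 0 \<longleftrightarrow> ?xs \<noteq> [] \<and> ?ys \<noteq> [] \<and> hd ?xs = hd ?ys"
    by (auto simp: P_def hd_conv_nth)
  also have "(\<exists>k\<ge>1. P k) \<longleftrightarrow> meet_later s t"
    by (simp add: P_def meet_later_def)
  finally show ?thesis .
qed

lemma meet_later_start:
  "fst s = x # xs \<Longrightarrow> fst t = y # ys \<Longrightarrow>
    meet_later (u # fst s, p) (v # fst t, q) \<longleftrightarrow> x = y \<or> meet_later s t"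
  unfolding meet_later_Cons by simp

lemma meet_prob_nonneg: "0 \<le> meet_prob u v"
  unfolding meet_prob_def by (rule Bochner_Integration.integral_nonneg) simp

lemma meet_prob_le_1: "meet_prob u v \<le> 1"
  unfolding meet_prob_def
  by (rule measure_pmf.integral_le_const) (auto intro!: measure_pmf.integrable_const_bound[where B=1])

text \<open>First-step analysis of both walks: each moves with probability \<open>a\<close>, which
  gives \<open>c\<close> together. Landing on the same node is already a meeting, whence the value 1
  on the diagonal.\<close>

lemma meet_prob_rec:
  "meet_prob u v = c / (real (card (I u)) * real (card (I v))) *
     (\<Sum>x\<in>I u. \<Sum>y\<in>I v. if x = y then 1 else meet_prob x y)"
proof -
  \<comment> \<open>The first walk is held fixed, having moved to \<open>x\<close>, and only the
    second one is unfolded.\<close>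
  have inner: "measure_pmf.prob (walk G c v) {t. meet_later (u # fst s, b) t} = a *
     ((\<Sum>y\<in>I v. if x = y then 1 else measure_pmf.prob (walk G c y) {t. meet_later s t}) / card (I v))"
    if s: "s \<in> set_pmf (walk G c x)" for s x b
  proof -
    obtain xs where xs: "fst s = x # xs" using walk_start[OF s] by blast
    have no: "\<not> meet_later p ([v], b)" for p b by (auto simp: meet_later_def)
    have "measure_pmf.prob (walk G c y) {t. meet_later (u # fst s, b) (v # fst t, snd t)}
      = (if x = y then 1 else measure_pmf.prob (walk G c y) {t. meet_later s t})" for y
    proof (cases "x = y")
      case True
      have "measure_pmf.prob (walk G c y) {t. meet_later (u # fst s, b) (v # fst t, snd t)}
         = measure_pmf.prob (walk G c y) {t. True}"
        by (rule prob_eq_pmfI) (use True meet_later_start[OF xs] walk_start in metis)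
      then show ?thesis using True by simp
    next
      case False
      have "measure_pmf.prob (walk G c y) {t. meet_later (u # fst s, b) (v # fst t, snd t)}
         = measure_pmf.prob (walk G c y) {t. meet_later s t}"
      proof (rule prob_eq_pmfI)
        fix t assume "t \<in> set_pmf (walk G c y)"
        then obtain ys where "fst t = y # ys" using walk_start by blast
        then show "meet_later (u # fst s, b) (v # fst t, snd t) = meet_later s t"
          using False meet_later_start[OF xs] by metis
      qed
      then show ?thesis using False by simp
    qed
    note eq = this
    have "measure_pmf.expectation (walk G c v) (\<lambda>t. of_bool (meet_later (u # fst s, b) t) :: real)
      = a * ((\<Sum>y\<in>I v. measure_pmf.prob (walk G c y) {t. meet_later (u # fst s, b) (v # fst t, snd t)}) / card (I v))"
      by (subst expectation_walk[where B=1]) (simp_all add: no expectation_of_bool)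
    then show ?thesis by (simp only: eq expectation_of_bool)
  qed
  have no: "meet_later ([u], b) = (\<lambda>_. False)" for b by (auto simp: meet_later_def fun_eq_iff)
  have int: "integrable (measure_pmf (walk G c x)) (\<lambda>s. if x = y then 1 else measure_pmf.prob (walk G c y) {t. meet_later s t})" for x y
    by (rule measure_pmf.integrable_const_bound[where B=1]) auto
  have outer: "measure_pmf.expectation (walk G c x)
      (\<lambda>s. measure_pmf.prob (walk G c v) {t. meet_later (u # fst s, snd s) t})
    = a * ((\<Sum>y\<in>I v. if x = y then 1 else meet_prob x y) / card (I v))" (is "?L = _") for x
  proof -
    have "?L = measure_pmf.expectation (walk G c x) (\<lambda>s. a * ((\<Sum>y\<in>I v. if x = y then 1
        else measure_pmf.prob (walk G c y) {t. meet_later s t}) / card (I v)))"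
      by (intro integral_cong_AE AE_pmfI inner) auto
    also have "\<dots> = a * ((\<Sum>y\<in>I v. measure_pmf.expectation (walk G c x) (\<lambda>s. if x = y then 1
        else measure_pmf.prob (walk G c y) {t. meet_later s t})) / card (I v))"
      by (simp only: Bochner_Integration.integral_mult_right_zero Bochner_Integration.integral_divide_zero)
         (subst Bochner_Integration.integral_sum, rule int, rule refl)
    also have "\<dots> = a * ((\<Sum>y\<in>I v. if x = y then 1 else meet_prob x y) / card (I v))"
      by (simp add: meet_prob_def if_distrib cong: if_cong) (auto intro!: sum.cong)
    finally show ?thesis .
  qed
  have "meet_prob u v = a * ((\<Sum>x\<in>I u. a * ((\<Sum>y\<in>I v. if x = y then 1 else meet_prob x y) / card (I v))) / card (I u))"
    unfolding meet_prob_def[of u v]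
    by (subst expectation_walk[where B=1]) (simp_all add: no outer)
  also have "\<dots> = (a * a) / (real (card (I u)) * real (card (I v))) *
     (\<Sum>x\<in>I u. \<Sum>y\<in>I v. if x = y then 1 else meet_prob x y)"
  proof -
    have "q * ((\<Sum>x\<in>A. q * (g x / n)) / m) = (q * q) / (m * n) * sum g A" for q n m :: real and g :: "'a \<Rightarrow> real" and A
      by (simp add: sum_distrib_left[symmetric] sum_divide_distrib[symmetric], simp add: mult_ac)
    then show ?thesis .
  qed
  finally show ?thesis using a_sq by simp
qed

abbreviation "s \<equiv> simrank G c"

text \<open>\<open>meet_prob\<close> with its diagonal replaced by 1 satisfies the SimRank equations
  by \<open>meet_prob_rec\<close>, and these have only one solution.\<close>

lemma simrank_eq_meet_prob:
  "s u v = (if u \<in> V \<and> v \<in> V then if u = v then 1 else meet_prob u v else 0)"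
proof -
  define m where "m u v = (if u \<in> V \<and> v \<in> V then if u = v then 1 else meet_prob u v else 0)" for u v
  have "(\<Sum>x\<in>I u. \<Sum>y\<in>I v. m x y) = (\<Sum>x\<in>I u. \<Sum>y\<in>I v. if x = y then 1 else meet_prob x y)" for u v
    by (intro sum.cong refl) (use I_sub in \<open>simp add: m_def\<close>)
  then have "m u v = c / (real (card (I u)) * real (card (I v))) * (\<Sum>x\<in>I u. \<Sum>y\<in>I v. m x y)"
    if "u \<in> V" "v \<in> V" "u \<noteq> v" for u v
    using that meet_prob_rec[of u v] unfolding m_def[of u v] by presburger
  moreover have "m u u = 1" if "u \<in> V" for u using that by (simp add: m_def)
  moreover have "m u v = 0" if "u \<notin> V \<or> v \<notin> V" for u v using that by (auto simp: m_def)
  ultimately have "is_simrank G c m" unfolding is_simrank_def by blast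
  then have "s = m"
    using simrank_ex1[OF graph c0 c1] is_simrank_simrank[OF graph c0 c1] by blast
  then show ?thesis by (simp add: m_def)
qed

lemma simrank_bounds: "0 \<le> s u v" "s u v \<le> 1"
  by (simp_all add: simrank_eq_meet_prob meet_prob_nonneg meet_prob_le_1)

section \<open>Decomposition of SimRank by the last meeting\<close>

definition eta :: "'a \<Rightarrow> real" where "eta w = 1 - meet_prob w w"

lemma eta_bounds: "0 \<le> eta w" "eta w \<le> 1"
  by (simp_all add: eta_def meet_prob_nonneg meet_prob_le_1)

text \<open>The SimRank operator without its diagonal condition, that is, the expectation of
  \<open>f\<close> after both walks have made one step. It is linear and scales upper bounds by
  \<open>c\<close>.\<close>

definition avg2 :: "('a \<Rightarrow> 'a \<Rightarrow> real) \<Rightarrow> 'a \<Rightarrow> 'a \<Rightarrow> real" where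
  "avg2 f u v = c / (real (card (I u)) * real (card (I v))) * (\<Sum>x\<in>I u. \<Sum>y\<in>I v. f x y)"

lemma avg2_le:
  assumes "\<And>x y. f x y \<le> M" "0 \<le> M"
  shows "avg2 f u v \<le> c * M"
proof -
  have "(\<Sum>x\<in>I u. (\<Sum>y\<in>I v. f x y) / card (I v)) / card (I u) \<le> M"
    by (intro average_le assms)
  then have "c * ((\<Sum>x\<in>I u. (\<Sum>y\<in>I v. f x y) / card (I v)) / card (I u)) \<le> c * M"
    by (rule mult_left_mono) (use c0 in simp)
  then show ?thesis unfolding avg2_def by (simp add: sum_divide_distrib[symmetric] mult.commute)
qed

lemma avg2_nonneg: "(\<And>x y. 0 \<le> f x y) \<Longrightarrow> 0 \<le> avg2 f u v"
  unfolding avg2_def using c0 by (intro mult_nonneg_nonneg divide_nonneg_nonneg sum_nonneg) auto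

lemma avg2_cong: "(\<And>x y. x \<in> V \<Longrightarrow> y \<in> V \<Longrightarrow> f x y = g x y) \<Longrightarrow> avg2 f u v = avg2 g u v"
  unfolding avg2_def by (intro arg_cong2[where f="(*)"] sum.cong refl) (use I_sub in blast)

lemma avg2_diff: "avg2 (\<lambda>x y. f x y - g x y) u v = avg2 f u v - avg2 g u v"
  unfolding avg2_def by (simp add: sum_subtractf right_diff_distrib)

text \<open>The probability that independent walks from \<open>u\<close> and \<open>v\<close> are
  both at \<open>w\<close> after \<open>l\<close> steps and never meet afterwards.\<close>

definition level_term :: "nat \<Rightarrow> 'a \<Rightarrow> 'a \<Rightarrow> 'a \<Rightarrow> real" where
  "level_term l u v w = hit l u w * hit l v w * eta w"

lemma level_term_nonneg: "0 \<le> level_term l u v w"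
  by (simp add: level_term_def hit_nonneg eta_bounds)

lemma level_term_Suc: "level_term (Suc l) u v w = avg2 (\<lambda>x y. level_term l x y w) u v"
proof -
  have "(\<Sum>x\<in>I u. \<Sum>y\<in>I v. hit l x w * hit l y w * eta w) = (\<Sum>x\<in>I u. hit l x w) * (\<Sum>y\<in>I v. hit l y w) * eta w"
    unfolding sum_product by (simp only: sum_distrib_right)
  moreover have "(q * (X / m)) * (q * (Y / n)) * e = (q * q) / (m * n) * (X * Y * e)" for q X Y m n e :: real
    by simp
  ultimately show ?thesis unfolding level_term_def avg2_def hit.simps by (simp only: a_sq)
qed

text \<open>SimRank is a fixed point of \<open>avg2\<close> off the diagonal. On it,
  \<open>avg2\<close> yields only \<open>meet_prob u u\<close> instead of 1, and the defect
  \<open>eta u\<close> is exactly the level 0 term.\<close>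

lemma simrank_minus_avg2:
  assumes "u \<in> V" "v \<in> V"
  shows "s u v - avg2 s u v = (\<Sum>w\<in>V. level_term 0 u v w)"
proof -
  have "avg2 s u v = meet_prob u v"
    unfolding avg2_def meet_prob_rec[of u v] using I_sub
    by (intro arg_cong2[where f="(*)"] sum.cong refl) (simp add: simrank_eq_meet_prob)
  moreover have "(\<Sum>w\<in>V. level_term 0 u v w) = (if u = v then eta u else 0)"
  proof -
    have "level_term 0 u v w = (if w = u then if u = v then eta u else 0 else 0)" for w
      by (simp add: level_term_def)
    then show ?thesis using assms finite_V by simp
  qed
  ultimately show ?thesis using assms by (simp add: simrank_eq_meet_prob eta_def)
qed

text \<open>Applying the linear operator \<open>avg2\<close> to the defect raises the level by
  one.\<close>

lemma simrank_tail:
  assumes "u \<in> V" "v \<in> V"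
  shows "(avg2 ^^ k) s u v - (avg2 ^^ Suc k) s u v = (\<Sum>w\<in>V. level_term k u v w)"
  using assms
proof (induction k arbitrary: u v)
  case 0
  then show ?case by (simp add: simrank_minus_avg2)
next
  case (Suc k)
  have "(avg2 ^^ Suc k) s u v - (avg2 ^^ Suc (Suc k)) s u v
    = avg2 (\<lambda>x y. (avg2 ^^ k) s x y - (avg2 ^^ Suc k) s x y) u v"
    by (simp add: avg2_diff)
  also have "\<dots> = avg2 (\<lambda>x y. \<Sum>w\<in>V. level_term k x y w) u v"
    by (intro avg2_cong Suc.IH)
  also have "\<dots> = (\<Sum>w\<in>V. avg2 (\<lambda>x y. level_term k x y w) u v)"
    unfolding avg2_def by (simp add: sum_distrib_left sum.swap[of _ V])
  finally show ?case by (simp add: level_term_Suc)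
qed

lemma avg2_pow_bounds: "0 \<le> (avg2 ^^ k) s u v \<and> (avg2 ^^ k) s u v \<le> c ^ k"
proof (induction k arbitrary: u v)
  case 0
  then show ?case by (simp add: simrank_bounds)
next
  case (Suc k)
  then have "avg2 ((avg2 ^^ k) s) u v \<le> c * c ^ k" using c0 by (intro avg2_le) auto
  then show ?case using Suc by (simp add: avg2_nonneg)
qed

text \<open>The sum telescopes to a difference of two iterates of \<open>avg2\<close> on SimRank,
  and the \<open>k\<close>-th iterate lies between 0 and \<open>c ^ k\<close>. This decay is what
  the variance bound relies on.\<close>

lemma level_sum_le:
  assumes "u \<in> V" "v \<in> V"
  shows "(\<Sum>l=k..<k + m. \<Sum>w\<in>V. level_term l u v w) \<le> c ^ k"
proof -
  have "(\<Sum>l=k..<k + m. \<Sum>w\<in>V. level_term l u v w) = (avg2 ^^ k) s u v - (avg2 ^^ (k + m)) s u v"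
  proof (induction m)
    case (Suc m)
    then show ?case using simrank_tail[OF assms, of "k + m"] by simp
  qed simp
  then show ?thesis using avg2_pow_bounds[of k u v] avg2_pow_bounds[of "k + m" u v] by linarith
qed

text \<open>The partial sums telescope, leaving the remainder \<open>(avg2 ^^ k) s\<close>, which
  vanishes since \<open>c < 1\<close>.\<close>

lemma simrank_sums:
  assumes "u \<in> V" "v \<in> V"
  shows "(\<lambda>l. \<Sum>w\<in>V. level_term l u v w) sums s u v"
proof -
  have "(\<Sum>l<k. \<Sum>w\<in>V. level_term l u v w) = s u v - (avg2 ^^ k) s u v" for k
  proof (induction k)
    case (Suc k)
    then show ?case using simrank_tail[OF assms, of k] by simp
  qed simp
  moreover have "(\<lambda>k. (avg2 ^^ k) s u v) \<longlonglongrightarrow> 0"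
    by (rule tendsto_sandwich[OF _ _ tendsto_const LIMSEQ_realpow_zero[of c]])
       (use avg2_pow_bounds c0 c1 in auto)
  then have "(\<lambda>k. s u v - (avg2 ^^ k) s u v) \<longlonglongrightarrow> s u v - 0"
    by (intro tendsto_diff tendsto_const)
  ultimately show ?thesis by (simp add: sums_def)
qed

end

lemma expectation_bind_pmf_finite:
  fixes h :: "'b \<Rightarrow> real"
  assumes "finite (set_pmf p)" "\<And>x. x \<in> set_pmf p \<Longrightarrow> finite (set_pmf (f x))"
  shows "measure_pmf.expectation (p \<bind> f) h = measure_pmf.expectation p (\<lambda>x. measure_pmf.expectation (f x) h)"
  using assms by (subst pmf_expectation_bind[where A="set_pmf p"])
    (auto simp: integral_measure_pmf_real[where A="set_pmf p"] mult.commute)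

text \<open>
  Both branches of a push are bounded by the same combination of \<open>h\<^sup>2\<close> and \<open>h\<close>. Its coefficients make the
  factor \<open>1 - a ^ Suc l\<close> in \<open>vbbw_moments\<close> inductive, whatever the in-degree \<open>D\<close> is.
\<close>

lemma push_variance_le:
  fixes q h D :: real
  assumes q: "0 < q" "q < 1" and D: "1 \<le> D" and h: "1 - q \<le> h"
  defines "R \<equiv> q / D * ((1 - q) / D * h\<^sup>2 + (1 - q) * (1 - 1 / D) * h)"
  shows "q * (h / D)\<^sup>2 - (q * (h / D))\<^sup>2 \<le> R" "q * ((1 - q) * (h / D)) - (q * (h / D))\<^sup>2 \<le> R"
proof -
  have h0: "0 \<le> h" and D0: "0 < D" using q h D by linarith+
  have "0 \<le> q / D * ((1 - q) * (1 - 1 / D) * h)"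
    using q D h0 by (intro mult_nonneg_nonneg divide_nonneg_nonneg) auto
  also have "\<dots> = R - (q * (h / D)\<^sup>2 - (q * (h / D))\<^sup>2)"
    using D0 by (simp add: R_def power2_eq_square field_simps)
  finally show "q * (h / D)\<^sup>2 - (q * (h / D))\<^sup>2 \<le> R" by simp
  \<comment> \<open>This uses \<open>1 - q <= h\<close>: a nonzero value of the backward walk is
    never below \<open>1 - a\<close>.\<close>
  have "0 \<le> q * (h * (h - (1 - q))) / (D * D)"
    using q h h0 D0 by (intro mult_nonneg_nonneg divide_nonneg_nonneg) auto
  also have "\<dots> = R - (q * ((1 - q) * (h / D)) - (q * (h / D))\<^sup>2)"
    using D0 by (simp add: R_def power2_eq_square field_simps)
  finally show "q * ((1 - q) * (h / D)) - (q * (h / D))\<^sup>2 \<le> R" by simp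
qed

context pagerank_graph
begin

section \<open>Moments of the backward walk\<close>

abbreviation "dg y \<equiv> real (d_in G y)"

lemma out_nbrs_iff: "y \<in> out_nbrs G x \<longleftrightarrow> x \<in> I y"
  by (simp add: out_nbrs_def in_nbrs_def)

lemma dg_card: "dg y = real (card (I y))"
  by (simp add: d_in_def)

lemma dg_ge_1: "x \<in> I y \<Longrightarrow> 1 \<le> dg y"
  using finite_I[of y] by (auto simp: dg_card Suc_le_eq card_gt_0_iff)

text \<open>A finite superset of the possible increments. It provides integrability and records the
  gap between 0 and \<open>1 - a\<close>.\<close>

definition inc_values :: "real \<Rightarrow> 'a \<Rightarrow> ('a \<Rightarrow> real) set" where
  "inc_values h x = PiE_dflt (out_nbrs G x) 0 (\<lambda>y. {z \<in> {0, 1 - a, h / dg y}. z = 0 \<or> 1 - a \<le> z})"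

lemma finite_inc_values: "finite (inc_values h x)"
  unfolding inc_values_def using finite_out_nbrs[OF graph] by (intro finite_PiE_dflt) auto

lemma vbbw_increment_values: "vbbw_increment G c h x r \<in> inc_values h x"
proof -
  have "1 - a \<le> h / dg y" if "y \<in> out_nbrs G x" "dg y \<le> h / (1 - a)" for y
  proof -
    have "0 < dg y" using that dg_ge_1 out_nbrs_iff by fastforce
    then show ?thesis using that a_less by (simp add: field_simps)
  qed
  then show ?thesis
    unfolding inc_values_def PiE_dflt_def vbbw_increment_def using a_less by simp
qed

abbreviation "unit_interval \<equiv> uniform_measure lborel {0<..<1::real}"

lemma measurable_vbbw_increment:
  "vbbw_increment G c h x \<in> unit_interval \<rightarrow>\<^sub>M count_space UNIV"
proof -
  let ?f = "vbbw_increment G c h x"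
  have "?f \<in> unit_interval \<rightarrow>\<^sub>M count_space (inc_values h x)"
  proof (subst measurable_count_space_eq2[OF finite_inc_values], intro conjI ballI)
    show "?f \<in> space unit_interval \<rightarrow> inc_values h x" using vbbw_increment_values by simp
    fix g assume g: "g \<in> inc_values h x"
    have "g y = 0" if "y \<notin> out_nbrs G x" for y
      using g that by (auto simp: inc_values_def PiE_dflt_def)
    moreover have "?f r y = 0" if "y \<notin> out_nbrs G x" for r y
      using that by (simp add: vbbw_increment_def)
    ultimately have "?f r = g \<longleftrightarrow> (\<forall>y\<in>out_nbrs G x. ?f r y = g y)" for r
      unfolding fun_eq_iff by metis
    then have "?f -` {g} \<inter> space unit_interval = {r \<in> space borel. \<forall>y\<in>out_nbrs G x. ?f r y = g y}"
      by auto
    also have "\<dots> \<in> sets borel"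
      unfolding vbbw_increment_def using finite_out_nbrs[OF graph, of x] by measurable
    finally show "?f -` {g} \<inter> space unit_interval \<in> sets unit_interval" by simp
  qed
  then show ?thesis
    using measurable_compose[of ?f unit_interval "count_space (inc_values h x)" "\<lambda>g. g" "count_space UNIV"] by simp
qed

lemma set_pmf_uniform_law: "set_pmf (uniform_law (vbbw_increment G c h x)) \<subseteq> inc_values h x"
proof -
  have "AE g in measure_pmf (uniform_law (vbbw_increment G c h x)). g \<in> inc_values h x"
    unfolding measure_pmf_vbbw_increment[OF graph]
    by (subst AE_distr_iff[OF measurable_vbbw_increment]) (auto simp: vbbw_increment_values)
  then show ?thesis by (auto simp: AE_measure_pmf_iff)
qed

text \<open>In the random branch the increment is \<open>1 - a\<close> with probability
  \<open>h / (dg y * (1 - a))\<close>, so the mean is \<open>h / dg y\<close> as in the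
  deterministic branch, and every further power costs a factor \<open>1 - a\<close>. The condition
  \<open>0 < k\<close> makes powers of a zero increment vanish.\<close>

lemma uniform_law_moment:
  assumes h: "0 < h" and k: "0 < k"
  shows "measure_pmf.expectation (uniform_law (vbbw_increment G c h x)) (\<lambda>g. g y ^ k)
    = (if x \<notin> I y then 0 else if dg y \<le> h / (1 - a) then (h / dg y) ^ k else (1 - a) ^ (k - 1) * (h / dg y))"
proof -
  have "measure_pmf.expectation (uniform_law (vbbw_increment G c h x)) (\<lambda>g. g y ^ k)
    = (\<integral>r. vbbw_increment G c h x r y ^ k \<partial>unit_interval)"
    unfolding measure_pmf_vbbw_increment[OF graph]
    by (rule integral_distr[OF measurable_vbbw_increment]) simp
  also have "\<dots> = (if x \<notin> I y then 0 else if dg y \<le> h / (1 - a) then (h / dg y) ^ k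
      else (1 - a) ^ (k - 1) * (h / dg y))"
  proof -
    interpret U: prob_space unit_interval by (rule prob_space_uniform_measure) auto
    consider "x \<notin> I y" | "x \<in> I y" "dg y \<le> h / (1 - a)" | "x \<in> I y" "h / (1 - a) < dg y" by fastforce
    then show ?thesis
    proof cases
      case 1
      then show ?thesis using k by (simp add: vbbw_increment_def out_nbrs_iff)
    next
      case 2
      then show ?thesis by (simp add: vbbw_increment_def out_nbrs_iff U.prob_space)
    next
      case 3
      \<comment> \<open>The largest draw \<open>r\<close> for which \<open>y\<close> passes the
        in-degree test, hence the probability of passing it.\<close>
      define q where "q = h / (dg y * (1 - a))"
      let ?A = "{r. dg y \<le> h / (r * (1 - a))}"
      have d1: "1 \<le> dg y" using 3 dg_ge_1 by blast
      have q: "0 < q" "q < 1" using 3 d1 a_less h by (auto simp: q_def field_simps)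
      have "dg y \<le> h / (r * (1 - a)) \<longleftrightarrow> r \<le> q" if "0 < r" for r
        using d1 a_less that unfolding q_def by (simp add: field_simps)
      then have "{0<..<1} \<inter> ?A = {0<..q}" using q by auto
      then have "measure unit_interval ?A = q"
        using q by (subst measure_uniform_measure) auto
      moreover have "(\<lambda>r. vbbw_increment G c h x r y ^ k) = (\<lambda>r. (1 - a) ^ k * indicator ?A r)"
        using 3 k by (auto simp: vbbw_increment_def out_nbrs_iff indicator_def fun_eq_iff)
      ultimately have "(\<integral>r. vbbw_increment G c h x r y ^ k \<partial>unit_interval) = (1 - a) ^ k * q"
        by simp
      also have "\<dots> = (1 - a) ^ (k - 1) * (h / dg y)"
        using k a_less by (cases k) (auto simp: q_def)
      finally show ?thesis using 3 by simp
    qed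
  qed
  finally show ?thesis .
qed

lemma set_pmf_vbbw_push: "g \<in> set_pmf (vbbw_push G c h x) \<Longrightarrow> g \<in> inc_values h x"
  using set_pmf_uniform_law[of h x]
  by (auto simp: vbbw_push_def inc_values_def PiE_dflt_def split: if_splits)

lemma finite_set_pmf_vbbw_push: "finite (set_pmf (vbbw_push G c h x))"
  using finite_inc_values by (rule finite_subset[rotated]) (auto intro: set_pmf_vbbw_push)

lemma vbbw_push_moment:
  assumes h: "0 < h" and k: "0 < k"
  shows "measure_pmf.expectation (vbbw_push G c h x) (\<lambda>g. g y ^ k)
    = (if x \<notin> I y then 0 else if dg y \<le> h / (1 - a) then a * (h / dg y) ^ k else a * ((1 - a) ^ (k - 1) * (h / dg y)))"
proof -
  have "finite (set_pmf (uniform_law (vbbw_increment G c h x)))"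
    using set_pmf_uniform_law finite_inc_values by (rule finite_subset)
  then have "measure_pmf.expectation (vbbw_push G c h x) (\<lambda>g. g y ^ k)
    = measure_pmf.expectation (bernoulli_pmf a) (\<lambda>b. measure_pmf.expectation
        (if b then uniform_law (vbbw_increment G c h x) else return_pmf (\<lambda>y. 0)) (\<lambda>g. g y ^ k))"
    unfolding vbbw_push_def by (intro expectation_bind_pmf_finite) auto
  also have "\<dots> = a * measure_pmf.expectation (uniform_law (vbbw_increment G c h x)) (\<lambda>g. g y ^ k)"
    using a_pos a_less k by simp
  finally show ?thesis using uniform_law_moment[OF h k, of x y] by simp
qed

text \<open>A sum of terms that are each 0 or at least \<open>1 - a\<close> has the same property,
  so the gap survives from level to level.\<close>

lemma vbbw_support:
  "finite (set_pmf (vbbw G c w l)) \<and> (\<forall>p\<in>set_pmf (vbbw G c w l). \<forall>y. p y = 0 \<or> 1 - a \<le> p y)"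
proof (induction l)
  case 0
  then show ?case by simp
next
  case (Suc l)
  let ?S = "\<lambda>p. {x \<in> V. p x \<noteq> 0}"
  let ?N = "\<lambda>p. Pi_pmf (?S p) (\<lambda>y. 0) (\<lambda>x. vbbw_push G c (p x) x)"
  have fS: "finite (?S p)" for p :: "'a \<Rightarrow> real" using finite_V by simp
  have "finite (set_pmf (?N p))" for p
    using fS by (simp add: set_Pi_pmf) (intro finite_PiE_dflt, simp_all add: finite_set_pmf_vbbw_push)
  moreover have "(\<Sum>x\<in>?S p. inc x y) = 0 \<or> 1 - a \<le> (\<Sum>x\<in>?S p. inc x y)"
    if "inc \<in> set_pmf (?N p)" for inc p y
  proof -
    have *: "inc x y = 0 \<or> 1 - a \<le> inc x y" if "x \<in> ?S p" for x
    proof -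
      have "inc x \<in> inc_values (p x) x"
        using \<open>inc \<in> set_pmf (?N p)\<close> that fS
        by (intro set_pmf_vbbw_push) (auto simp: set_Pi_pmf PiE_dflt_def)
      then show ?thesis
        by (cases "y \<in> out_nbrs G x") (auto simp: inc_values_def PiE_dflt_def)
    qed
    show ?thesis
    proof (cases "\<forall>x\<in>?S p. inc x y = 0")
      case True
      then show ?thesis by simp
    next
      case False
      then obtain x where x: "x \<in> ?S p" "inc x y \<noteq> 0" by blast
      have "1 - a \<le> inc x y" using * x by blast
      also have "\<dots> \<le> (\<Sum>x\<in>?S p. inc x y)"
      proof (intro member_le_sum[OF x(1)] fS)
        fix z assume "z \<in> ?S p - {x}"
        then have "inc z y = 0 \<or> 1 - a \<le> inc z y" using * by blast
        then show "0 \<le> inc z y" using a_less by linarith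
      qed
      finally show ?thesis by blast
    qed
  qed
  ultimately show ?case using Suc by (auto simp del: not_all)
qed

text \<open>Conditioned on the current level \<open>p\<close>, the pushes of different nodes are
  independent. The second moment is thus the squared mean, bounded by Cauchy-Schwarz, plus the
  single variances, bounded by \<open>push_variance_le\<close>.\<close>

lemma vbbw_step:
  assumes p: "\<And>y. p y = 0 \<or> 1 - a \<le> p y"
  defines "N \<equiv> Pi_pmf {x \<in> V. p x \<noteq> 0} (\<lambda>y. 0) (\<lambda>x. vbbw_push G c (p x) x)"
  shows "measure_pmf.expectation N (\<lambda>inc. \<Sum>x\<in>{x \<in> V. p x \<noteq> 0}. inc x y) = a * ((\<Sum>x\<in>I y. p x) / dg y)"
    and "measure_pmf.expectation N (\<lambda>inc. (\<Sum>x\<in>{x \<in> V. p x \<noteq> 0}. inc x y)\<^sup>2)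
      \<le> (\<Sum>x\<in>I y. (a / dg y) * ((a + (1 - a) / dg y) * (p x)\<^sup>2 + (1 - a) * (1 - 1 / dg y) * p x))"
proof -
  let ?S = "{x \<in> V. p x \<noteq> 0}"
  have fS: "finite ?S" using finite_V by simp
  have pos: "1 - a \<le> p x" "0 < p x" if "p x \<noteq> 0" for x
  proof -
    show "1 - a \<le> p x" using p[of x] that by blast
    then show "0 < p x" using a_less by linarith
  qed
  have int: "integrable (measure_pmf (vbbw_push G c (p x) x)) F" for x and F :: "_ \<Rightarrow> real"
    by (rule integrable_measure_pmf_finite[OF finite_set_pmf_vbbw_push])
  note moments = Pi_pmf_sum_moments[OF fS, where p = "\<lambda>x. vbbw_push G c (p x) x" and g = "\<lambda>x inc. inc y" and d = "\<lambda>y. 0",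
      OF int int, folded N_def]
  let ?\<mu> = "\<lambda>x. measure_pmf.expectation (vbbw_push G c (p x) x) (\<lambda>g. g y)"
  let ?q = "\<lambda>x. measure_pmf.expectation (vbbw_push G c (p x) x) (\<lambda>g. (g y)\<^sup>2)"
  have \<mu>: "?\<mu> x = (if x \<in> I y then a * (p x / dg y) else 0)" if "x \<in> ?S" for x
    using vbbw_push_moment[of "p x" 1 x y] pos[of x] that by auto
  have q: "?q x = (if x \<notin> I y then 0 else if dg y \<le> p x / (1 - a) then a * (p x / dg y)\<^sup>2 else a * ((1 - a) * (p x / dg y)))"
    if "x \<in> ?S" for x
    using vbbw_push_moment[of "p x" 2 x y] pos[of x] that by auto
  \<comment> \<open>In-neighbours outside \<open>?S\<close> have value 0, so they may be added to
    the sum freely.\<close>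
  have restrict: "(\<Sum>x\<in>?S. if x \<in> I y then F x else 0) = (\<Sum>x\<in>I y. F x)"
    if "\<And>x. p x = 0 \<Longrightarrow> F x = 0" for F :: "'a \<Rightarrow> real"
  proof -
    have "(\<Sum>x\<in>?S. if x \<in> I y then F x else 0) = (\<Sum>x\<in>?S \<inter> I y. F x)"
      using fS by (simp add: sum.inter_restrict)
    also have "\<dots> = (\<Sum>x\<in>I y. F x)"
      by (rule sum.mono_neutral_left) (use that finite_I I_sub in auto)
    finally show ?thesis .
  qed
  have mean: "(\<Sum>x\<in>?S. ?\<mu> x) = a * ((\<Sum>x\<in>I y. p x) / dg y)"
  proof -
    have "(\<Sum>x\<in>?S. ?\<mu> x) = (\<Sum>x\<in>?S. if x \<in> I y then a * (p x / dg y) else 0)"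
      by (intro sum.cong refl \<mu>)
    also have "\<dots> = (\<Sum>x\<in>I y. a * (p x / dg y))" by (rule restrict) simp
    finally show ?thesis by (simp only: sum_distrib_left[symmetric] sum_divide_distrib)
  qed
  then show "measure_pmf.expectation N (\<lambda>inc. \<Sum>x\<in>?S. inc x y) = a * ((\<Sum>x\<in>I y. p x) / dg y)"
    using moments(2) by simp
  have var: "?q x - (?\<mu> x)\<^sup>2 \<le> (if x \<in> I y then (a / dg y) * ((1 - a) / dg y * (p x)\<^sup>2 + (1 - a) * (1 - 1 / dg y) * p x) else 0)"
    if x: "x \<in> ?S" for x
  proof (cases "x \<in> I y")
    case True
    have "1 - a \<le> p x" using pos x by blast
    note push_variance_le[OF a_pos a_less dg_ge_1[OF True] this]
    then show ?thesis using True \<mu>[OF x] q[OF x] by presburger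
  next
    case False
    then show ?thesis using \<mu>[OF x] q[OF x] by simp
  qed
  have "(\<Sum>x\<in>?S. ?q x - (?\<mu> x)\<^sup>2) \<le> (\<Sum>x\<in>?S. if x \<in> I y then (a / dg y) * ((1 - a) / dg y * (p x)\<^sup>2 + (1 - a) * (1 - 1 / dg y) * p x) else 0)"
    by (intro sum_mono var)
  also have "\<dots> = (\<Sum>x\<in>I y. (a / dg y) * ((1 - a) / dg y * (p x)\<^sup>2 + (1 - a) * (1 - 1 / dg y) * p x))"
    by (rule restrict) simp
  finally have V: "(\<Sum>x\<in>?S. ?q x - (?\<mu> x)\<^sup>2) \<le> (\<Sum>x\<in>I y. (a / dg y) * ((1 - a) / dg y * (p x)\<^sup>2 + (1 - a) * (1 - 1 / dg y) * p x))" .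
  \<comment> \<open>The square of an average is at most the average of the squares. The factor
    \<open>a * a\<close> is kept, as one \<open>a\<close> becomes the contraction in the recursion
    for the second moment.\<close>
  have M: "(a * ((\<Sum>x\<in>I y. p x) / dg y))\<^sup>2 \<le> (\<Sum>x\<in>I y. (a / dg y) * (a * (p x)\<^sup>2))"
  proof (cases "I y = {}")
    case False
    then have d: "0 < dg y" using dg_ge_1[of _ y] by fastforce
    have "(\<Sum>x\<in>I y. p x)\<^sup>2 \<le> dg y * (\<Sum>x\<in>I y. (p x)\<^sup>2)"
      using Cauchy_Schwarz_ineq_sum[of "\<lambda>_. 1" p "I y"] by (simp add: dg_card)
    then have "(a * a) * ((\<Sum>x\<in>I y. p x)\<^sup>2 / (dg y * dg y)) \<le> (a * a) * ((dg y * (\<Sum>x\<in>I y. (p x)\<^sup>2)) / (dg y * dg y))"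
      using d c0 by (intro mult_left_mono divide_right_mono) auto
    also have "\<dots> = (\<Sum>x\<in>I y. (a / dg y) * (a * (p x)\<^sup>2))"
    proof -
      have "(b * b) * ((D * X) / (D * D)) = (b / D) * (b * X)" if "0 < D" for b D X :: real
        using that by (simp add: field_simps)
      note this[OF d]
      then show ?thesis by (simp only:) (simp only: sum_distrib_left)
    qed
    also have "(a * a) * ((\<Sum>x\<in>I y. p x)\<^sup>2 / (dg y * dg y)) = (a * ((\<Sum>x\<in>I y. p x) / dg y))\<^sup>2"
      by (simp only: power2_eq_square times_divide_times_eq times_divide_eq_right times_divide_eq_left divide_divide_eq_left mult_ac)
    finally show ?thesis .
  qed simp
  have "measure_pmf.expectation N (\<lambda>inc. (\<Sum>x\<in>?S. inc x y)\<^sup>2) = (\<Sum>x\<in>?S. ?\<mu> x)\<^sup>2 + (\<Sum>x\<in>?S. ?q x - (?\<mu> x)\<^sup>2)"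
    using moments(4) by simp
  also have "\<dots> \<le> (\<Sum>x\<in>I y. (a / dg y) * (a * (p x)\<^sup>2)) + (\<Sum>x\<in>I y. (a / dg y) * ((1 - a) / dg y * (p x)\<^sup>2 + (1 - a) * (1 - 1 / dg y) * p x))"
    unfolding mean by (intro add_mono M V)
  also have "\<dots> = (\<Sum>x\<in>I y. (a / dg y) * ((a + (1 - a) / dg y) * (p x)\<^sup>2 + (1 - a) * (1 - 1 / dg y) * p x))"
    by (simp only: sum.distrib[symmetric] distrib_left[symmetric] distrib_right add.assoc)
  finally show "measure_pmf.expectation N (\<lambda>inc. (\<Sum>x\<in>?S. inc x y)\<^sup>2)
      \<le> (\<Sum>x\<in>I y. (a / dg y) * ((a + (1 - a) / dg y) * (p x)\<^sup>2 + (1 - a) * (1 - 1 / dg y) * p x))" .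
qed

text \<open>Each step is unbiased, which gives the mean. The factor \<open>k\<close> of the second
  moment evolves at most by \<open>k \<mapsto> a * k + (1 - a)\<close>, which takes
  \<open>1 - a ^ Suc l\<close> to \<open>1 - a ^ Suc (Suc l)\<close>.\<close>

lemma vbbw_moments:
  "measure_pmf.expectation (vbbw G c w l) (\<lambda>p. p y) = (1 - a) * hit l y w"
  "measure_pmf.expectation (vbbw G c w l) (\<lambda>p. (p y)\<^sup>2) \<le> (1 - a ^ Suc l) * ((1 - a) * hit l y w)"
proof (induction l arbitrary: y)
  case 0
  {
    case 1
    show ?case by simp
  next
    case 2
    show ?case by (simp add: power2_eq_square)
  }
next
  case (Suc l)
  let ?E = "measure_pmf.expectation (vbbw G c w l)"
  let ?S = "\<lambda>p. {x \<in> V. p x \<noteq> 0}"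
  let ?N = "\<lambda>p. Pi_pmf (?S p) (\<lambda>y. 0) (\<lambda>x. vbbw_push G c (p x) x)"
  have fin: "finite (set_pmf (vbbw G c w l))" using vbbw_support by blast
  have finN: "finite (set_pmf (?N p))" for p
    using finite_V by (simp add: set_Pi_pmf) (intro finite_PiE_dflt, simp_all add: finite_set_pmf_vbbw_push)
  have int: "integrable (measure_pmf (vbbw G c w l)) F" for F :: "_ \<Rightarrow> real"
    by (rule integrable_measure_pmf_finite[OF fin])
  have E: "measure_pmf.expectation (vbbw G c w (Suc l)) F
     = ?E (\<lambda>p. measure_pmf.expectation (?N p) (\<lambda>inc. F (\<lambda>y. \<Sum>x\<in>?S p. inc x y)))" for F :: "_ \<Rightarrow> real"
    using fin finN by (simp add: expectation_bind_pmf_finite)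
  have supp: "p \<in> set_pmf (vbbw G c w l) \<Longrightarrow> p y = 0 \<or> 1 - a \<le> p y" for p y using vbbw_support by blast
  {
    case 1
    have "measure_pmf.expectation (vbbw G c w (Suc l)) (\<lambda>p. p y) = ?E (\<lambda>p. a * ((\<Sum>x\<in>I y. p x) / dg y))"
      unfolding E by (intro integral_cong_AE AE_pmfI vbbw_step supp) auto
    also have "\<dots> = a * ((\<Sum>x\<in>I y. ?E (\<lambda>p. p x)) / dg y)"
      by (simp only: Bochner_Integration.integral_mult_right_zero Bochner_Integration.integral_divide_zero)
         (subst Bochner_Integration.integral_sum, rule int, rule refl)
    also have "\<dots> = (1 - a) * hit (Suc l) y w"
      unfolding Suc.IH(1) by (simp add: dg_card sum_distrib_left[symmetric])
    finally show ?case .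
  next
    case 2
    define D where "D = dg y"
    have "measure_pmf.expectation (vbbw G c w (Suc l)) (\<lambda>p. (p y)\<^sup>2)
       \<le> ?E (\<lambda>p. \<Sum>x\<in>I y. (a / D) * ((a + (1 - a) / D) * (p x)\<^sup>2 + (1 - a) * (1 - 1 / D) * p x))"
      unfolding E D_def by (intro integral_mono_AE int AE_pmfI vbbw_step supp)
    also have "\<dots> = (\<Sum>x\<in>I y. (a / D) * ((a + (1 - a) / D) * ?E (\<lambda>p. (p x)\<^sup>2) + (1 - a) * (1 - 1 / D) * ?E (\<lambda>p. p x)))"
      by (simp add: Bochner_Integration.integral_sum int)
    also have "\<dots> \<le> (\<Sum>x\<in>I y. (a / D) * ((1 - a ^ Suc (Suc l)) * ((1 - a) * hit l x w)))"
    proof (rule sum_mono)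
      fix x assume x: "x \<in> I y"
      have D: "1 \<le> D" using dg_ge_1[OF x] by (simp add: D_def)
      define k P where "k = 1 - a ^ Suc l" and "P = (1 - a) * hit l x w"
      have k: "k \<le> 1" using a_pos by (simp add: k_def)
      have P: "0 \<le> P" using hit_nonneg a_less by (simp add: P_def)
      have "(a + (1 - a) / D) * ?E (\<lambda>p. (p x)\<^sup>2) \<le> (a + (1 - a) / D) * (k * P)"
        using Suc.IH(2)[of x] D a_less a_pos unfolding k_def P_def
        by (intro mult_left_mono add_nonneg_nonneg divide_nonneg_nonneg) (simp_all add: less_imp_le)
      then have "(a + (1 - a) / D) * ?E (\<lambda>p. (p x)\<^sup>2) + (1 - a) * (1 - 1 / D) * ?E (\<lambda>p. p x)
         \<le> (a + (1 - a) / D) * (k * P) + (1 - a) * (1 - 1 / D) * P"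
        by (simp add: Suc.IH(1) P_def)
      \<comment> \<open>All terms with \<open>1 / D\<close> collect into one term to be subtracted;
        it is nonnegative because \<open>k <= 1\<close>, so the in-degree disappears from the
        bound.\<close>
      also have "\<dots> = (a * k + (1 - a)) * P - ((1 - a) / D) * ((1 - k) * P)"
        using D by (simp add: field_simps)
      also have "\<dots> \<le> (a * k + (1 - a)) * P"
        using k P D a_less by simp
      also have "a * k + (1 - a) = 1 - a ^ Suc (Suc l)"
        by (simp add: k_def algebra_simps)
      finally show "(a / D) * ((a + (1 - a) / D) * ?E (\<lambda>p. (p x)\<^sup>2) + (1 - a) * (1 - 1 / D) * ?E (\<lambda>p. p x))
          \<le> (a / D) * ((1 - a ^ Suc (Suc l)) * ((1 - a) * hit l x w))"
        using D a_pos unfolding P_def by (intro mult_left_mono) auto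
    qed
    also have "\<dots> = (1 - a ^ Suc (Suc l)) * ((1 - a) * hit (Suc l) y w)"
    proof -
      have "(\<Sum>x\<in>A. (b / n) * (k * (b' * g x))) = k * (b' * (b * (sum g A / n)))"
        for b n k b' :: real and g :: "'a \<Rightarrow> real" and A
        by (simp add: sum_distrib_left[symmetric] sum_divide_distrib[symmetric])
      then show ?thesis by (simp only: hit.simps D_def dg_card)
    qed
    finally show ?case .
  }
qed

end

text \<open>The weight is \<open>(1 - q)\<close> times the sum of \<open>q ^ k\<close> over
  \<open>k <= l\<close>. Exchanging the sums turns it into tails of \<open>g\<close> weighted by
  \<open>q ^ k\<close>; a tail is at most \<open>q ^ (2 * k)\<close>, which leaves a geometric
  series in \<open>q ^ 3\<close>.\<close>

lemma weighted_tail_sum_le: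
  fixes g :: "nat \<Rightarrow> real" and q :: real
  assumes q: "0 < q" "q < 1"
    and tail: "\<And>k m. (\<Sum>l=k..<k + m. g l) \<le> (q * q) ^ k"
    and b: "\<And>m. (\<Sum>l<m. g l) \<le> b" "0 \<le> b"
  shows "(\<Sum>l<m. g l * (1 - q ^ Suc l)) \<le> (1 - q) * (b + q ^ 3 / (1 - q ^ 3))"
proof -
  have swap: "(\<Sum>l<m. g l * (\<Sum>k<Suc l. q ^ k)) = (\<Sum>k<m. q ^ k * (\<Sum>l=k..<m. g l))" for m
  proof (induction m)
    case (Suc m)
    have "(\<Sum>k<Suc m. q ^ k * (\<Sum>l=k..<Suc m. g l)) = (\<Sum>k<Suc m. q ^ k * (\<Sum>l=k..<m. g l) + q ^ k * g m)"
      by (intro sum.cong refl) (simp add: sum.atLeastLessThan_Suc distrib_left)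
    also have "\<dots> = (\<Sum>k<m. q ^ k * (\<Sum>l=k..<m. g l)) + g m * (\<Sum>k<Suc m. q ^ k)"
      by (simp add: sum.distrib sum_distrib_left distrib_left mult.commute)
    finally show ?case using Suc by simp
  qed simp
  have q3: "0 < q ^ 3" "q ^ 3 < 1" using q by (auto intro: power_less_one_iff[THEN iffD2] simp: power_less_one_iff)
  have "(\<Sum>k<m. q ^ k * (\<Sum>l=k..<m. g l)) \<le> b + (\<Sum>k<m. (q ^ 3) ^ Suc k)"
  proof (cases m)
    case 0
    then show ?thesis using b by simp
  next
    case (Suc n)
    \<comment> \<open>The full sum, \<open>k = 0\<close>, is separated: \<open>tail\<close> would
      bound it only by 1, not by \<open>b\<close>.\<close>
    have "(\<Sum>k<m. q ^ k * (\<Sum>l=k..<m. g l)) = (\<Sum>l<m. g l) + (\<Sum>k<n. q ^ Suc k * (\<Sum>l=Suc k..<m. g l))"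
      unfolding Suc sum.lessThan_Suc_shift by (simp add: atLeast0LessThan lessThan_Suc_atMost[symmetric] sum.lessThan_Suc_shift[symmetric])
    also have "(\<Sum>k<n. q ^ Suc k * (\<Sum>l=Suc k..<m. g l)) \<le> (\<Sum>k<n. q ^ Suc k * (q * q) ^ Suc k)"
    proof (intro sum_mono mult_left_mono)
      fix k assume "k \<in> {..<n}"
      then have "m = Suc k + (m - Suc k)" using Suc by simp
      then show "(\<Sum>l=Suc k..<m. g l) \<le> (q * q) ^ Suc k" using tail[of "Suc k" "m - Suc k"] by metis
    qed (use q in simp)
    also have "\<dots> = (\<Sum>k<n. (q ^ 3) ^ Suc k)"
      by (simp only: power_mult_distrib[symmetric] power3_eq_cube mult.assoc)
    also have "\<dots> \<le> (\<Sum>k<m. (q ^ 3) ^ Suc k)"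
      by (rule sum_mono2) (use Suc q in auto)
    finally show ?thesis using b(1)[of m] by linarith
  qed
  also have "(\<Sum>k<m. (q ^ 3) ^ Suc k) \<le> q ^ 3 / (1 - q ^ 3)"
  proof -
    have "(\<Sum>k<m. (q ^ 3) ^ Suc k) = q ^ 3 * (\<Sum>k<m. (q ^ 3) ^ k)" by (simp add: sum_distrib_left)
    also have "(\<Sum>k<m. (q ^ 3) ^ k) = (1 - (q ^ 3) ^ m) / (1 - q ^ 3)"
      by (rule sum_gp_strict[of "q^3" m, THEN trans]) (use q3 in auto)
    also have "\<dots> \<le> 1 / (1 - q ^ 3)" using q3 q by (intro divide_right_mono) auto
    finally show ?thesis using q3 by (simp add: mult_left_mono)
  qed
  finally have "(1 - q) * (\<Sum>l<m. g l * (\<Sum>k<Suc l. q ^ k)) \<le> (1 - q) * (b + q ^ 3 / (1 - q ^ 3))"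
    unfolding swap using q by (intro mult_left_mono) auto
  moreover have "(1 - q) * (\<Sum>l<m. g l * (\<Sum>k<Suc l. q ^ k)) = (\<Sum>l<m. g l * (1 - q ^ Suc l))"
    unfolding sum_distrib_left[of "1 - q"]
  proof (intro sum.cong refl)
    fix l
    have "(1 - q) * (\<Sum>k<Suc l. q ^ k) = 1 - q ^ Suc l" using one_diff_power_eq[of q "Suc l"] by simp
    then show "(1 - q) * (g l * (\<Sum>k<Suc l. q ^ k)) = g l * (1 - q ^ Suc l)" by (metis mult.left_commute)
  qed
  ultimately show ?thesis by simp
qed

text \<open>With \<open>x = (1 - q) * b\<close> the claim reads
  \<open>x - x^2 + q^3 / (1 + q + q^2) <= 2 / 5\<close>, where \<open>x <= 1 - q\<close>. For
  \<open>q <= 1 / 2\<close> the crude bounds 1/4 and 1/8 suffice; for larger \<open>q\<close> the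
  constraint on \<open>x\<close> is needed.\<close>

lemma variance_constant:
  fixes q b :: real
  assumes q: "0 < q" "q < 1" and b: "0 \<le> b" "b \<le> 1"
  shows "(1 - q) * (b + q ^ 3 / (1 - q ^ 3)) - ((1 - q) * b)\<^sup>2 \<le> 2 / 5"
proof -
  define x where "x = (1 - q) * b"
  have x: "0 \<le> x" "x \<le> 1 - q" using q b by (auto simp: x_def mult_left_le)
  have P: "0 < 1 + q + q\<^sup>2" using q zero_le_power2[of q] by linarith
  have "1 - q ^ 3 = (1 - q) * (1 + q + q\<^sup>2)" by (simp add: algebra_simps power2_eq_square power3_eq_cube)
  then have r: "(1 - q) * (q ^ 3 / (1 - q ^ 3)) = q ^ 3 / (1 + q + q\<^sup>2)" using q by simp
  have "x - x\<^sup>2 + q ^ 3 / (1 + q + q\<^sup>2) \<le> 2 / 5"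
  proof (cases "q \<le> 1 / 2")
    case True
    have "x - x\<^sup>2 \<le> 1 / 4" using zero_le_power2[of "x - 1/2"] by (simp add: power2_eq_square algebra_simps)
    moreover have "q ^ 3 / (1 + q + q\<^sup>2) \<le> 1 / 8"
    proof -
      have "q ^ 3 / (1 + q + q\<^sup>2) \<le> q ^ 3 / 1" using q P by (intro divide_left_mono) auto
      also have "\<dots> \<le> (1/2) ^ 3 / 1" using q True by (intro divide_right_mono power_mono) auto
      finally show ?thesis by (simp add: power3_eq_cube)
    qed
    ultimately show ?thesis by linarith
  next
    case False
    \<comment> \<open>Here \<open>1 - q < 1 / 2\<close>, so \<open>x - x^2\<close> is largest at the
      end point \<open>x = 1 - q\<close>.\<close>
    have "0 \<le> ((1 - q) - x) * (1 - (1 - q) - x)" using x False by (intro mult_nonneg_nonneg) auto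
    then have 1: "x - x\<^sup>2 \<le> (1 - q) - (1 - q)\<^sup>2" by (simp add: power2_eq_square algebra_simps)
    have "q ^ 3 \<le> (2 / 5 - (1 - q) + (1 - q)\<^sup>2) * (1 + q + q\<^sup>2)"
    proof -
      \<comment> \<open>A sum of squares that certifies positivity of the quartic.\<close>
      have "(2 / 5 - (1 - q) + (1 - q)\<^sup>2) * (1 + q + q\<^sup>2) - q ^ 3
          = (q\<^sup>2 - q / 2 - 3 / 10)\<^sup>2 + 3 / 4 * (q - 3 / 5)\<^sup>2 + 1 / 25"
        by (simp add: power2_eq_square power3_eq_cube field_simps)
      then show ?thesis
        using zero_le_power2[of "q\<^sup>2 - q / 2 - 3 / 10"] zero_le_power2[of "q - 3 / 5"] by linarith
    qed
    then have "q ^ 3 / (1 + q + q\<^sup>2) \<le> 2 / 5 - (1 - q) + (1 - q)\<^sup>2"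
      using P by (simp add: divide_le_eq)
    then show ?thesis using 1 by linarith
  qed
  then show ?thesis using r by (simp add: x_def distrib_left)
qed

context pagerank_graph
begin

section \<open>Moments of one sample\<close>

abbreviation "backward hubs l w \<equiv> (if w \<in> hubs then return_pmf (\<lambda>v. 0) else vbbw G c w l)"

lemma nn_integral_no_meeting:
  assumes F: "F None = 0"
  shows "(\<integral>\<^sup>+t1. \<integral>\<^sup>+t2. \<integral>\<^sup>+x. F x \<partial>(if meet_later t1 t2 then return_pmf None else B) \<partial>walk G c w \<partial>walk G c w)
    = ennreal (eta w) * (\<integral>\<^sup>+x. F x \<partial>measure_pmf B)"
proof -
  let ?K = "\<integral>\<^sup>+x. F x \<partial>measure_pmf B"
  let ?m = "\<lambda>t1. measure_pmf.prob (walk G c w) {t. meet_later t1 t}"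
  have int: "integrable (measure_pmf (walk G c w)) ?m"
    by (rule measure_pmf.integrable_const_bound[where B=1]) auto
  have "(\<integral>\<^sup>+t2. \<integral>\<^sup>+x. F x \<partial>(if meet_later t1 t2 then return_pmf None else B) \<partial>walk G c w) = ennreal (1 - ?m t1) * ?K" for t1
  proof -
    have "(\<integral>\<^sup>+t2. \<integral>\<^sup>+x. F x \<partial>(if meet_later t1 t2 then return_pmf None else B) \<partial>walk G c w)
      = (\<integral>\<^sup>+t2. indicator {t. \<not> meet_later t1 t} t2 * ?K \<partial>walk G c w)"
      by (intro nn_integral_cong) (simp add: F)
    also have "\<dots> = emeasure (walk G c w) {t. \<not> meet_later t1 t} * ?K"
      by (simp add: nn_integral_multc)
    also have "{t. \<not> meet_later t1 t} = UNIV - {t. meet_later t1 t}" by auto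
    also have "emeasure (walk G c w) \<dots> = ennreal (1 - ?m t1)"
      using measure_pmf.prob_compl[of "{t. meet_later t1 t}" "walk G c w"]
      by (simp add: measure_pmf.emeasure_eq_measure)
    finally show ?thesis .
  qed
  then have "(\<integral>\<^sup>+t1. \<integral>\<^sup>+t2. \<integral>\<^sup>+x. F x \<partial>(if meet_later t1 t2 then return_pmf None else B) \<partial>walk G c w \<partial>walk G c w)
    = (\<integral>\<^sup>+t1. ennreal (1 - ?m t1) \<partial>walk G c w) * ?K"
    by (simp add: nn_integral_multc)
  also have "(\<integral>\<^sup>+t1. ennreal (1 - ?m t1) \<partial>walk G c w) = ennreal (eta w)"
    using int by (subst nn_integral_eq_integral) (auto simp: eta_def meet_prob_def)
  finally show ?thesis .
qed

text \<open>The sample is split by the end \<open>(l, w)\<close> of the walk from \<open>u\<close>.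
  Given the end, the meeting test and the backward walk are independent and contribute
  \<open>eta w\<close> and the inner integral.\<close>

lemma nn_integral_query_sample:
  assumes F: "F None = 0" and u: "u \<in> V"
  shows "(\<integral>\<^sup>+x. F x \<partial>query_sample G c hubs u) =
    (\<Sum>l. \<Sum>w\<in>V. ennreal ((1 - a) * hit l u w) * (ennreal (eta w) * (\<integral>\<^sup>+p. F (Some ((l, w), p)) \<partial>backward hubs l w)))"
proof -
  let ?\<Phi> = "\<lambda>l w. ennreal (eta w) * (\<integral>\<^sup>+p. F (Some ((l, w), p)) \<partial>backward hubs l w)"
  have "(\<integral>\<^sup>+x. F x \<partial>query_sample G c hubs u)
    = (\<integral>\<^sup>+t. (if snd t then ?\<Phi> (length (fst t) - 1) (last (fst t)) else 0) \<partial>walk G c u)"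
    unfolding query_sample_def nn_integral_bind_pmf
  proof (rule nn_integral_cong)
    fix t :: "'a list \<times> bool"
    let ?w = "last (fst t)" and ?l = "length (fst t) - 1"
    let ?B = "backward hubs ?l ?w \<bind> (\<lambda>p. return_pmf (Some ((?l, ?w), p)))"
    have "(\<integral>\<^sup>+x. F x \<partial>measure_pmf ?B) = (\<integral>\<^sup>+p. F (Some ((?l, ?w), p)) \<partial>backward hubs ?l ?w)"
      by simp
    note inner = this
    show "(\<integral>\<^sup>+x. F x \<partial>measure_pmf (if \<not> snd t then return_pmf None else
        let w = last (fst t); l = length (fst t) - 1
        in walk G c w \<bind> (\<lambda>t1. walk G c w \<bind> (\<lambda>t2. if meet_later t1 t2 then return_pmf None
          else backward hubs l w \<bind> (\<lambda>p. return_pmf (Some ((l, w), p)))))))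
      = (if snd t then ?\<Phi> ?l ?w else 0)"
    proof (cases "snd t")
      case True
      then show ?thesis
        using nn_integral_no_meeting[where F=F and B="?B" and w="?w", OF F]
        by (simp only: inner Let_def not_True_eq_False if_False if_True nn_integral_bind_pmf) simp
    next
      case False
      then show ?thesis using F by simp
    qed
  qed
  then show ?thesis using nn_integral_walk_end[OF u] by simp
qed

section \<open>Hub part and non-hub part of SimRank\<close>

definition part_term :: "'a set \<Rightarrow> 'a \<Rightarrow> 'a \<Rightarrow> nat \<Rightarrow> real" where
  "part_term W u v l = (\<Sum>w\<in>V \<inter> W. level_term l u v w)"

definition part_sum :: "'a set \<Rightarrow> 'a \<Rightarrow> 'a \<Rightarrow> real" where
  "part_sum W u v = (\<Sum>l. part_term W u v l)"

lemma part_term_nonneg: "0 \<le> part_term W u v l"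
  unfolding part_term_def by (intro sum_nonneg level_term_nonneg)

lemma part_term_le: "part_term W u v l \<le> (\<Sum>w\<in>V. level_term l u v w)"
  unfolding part_term_def using finite_V by (intro sum_mono2 level_term_nonneg) auto

lemma part_summable: "u \<in> V \<Longrightarrow> v \<in> V \<Longrightarrow> summable (part_term W u v)"
  by (rule summable_comparison_test'[OF sums_summable[OF simrank_sums], of u v 0])
     (use part_term_nonneg part_term_le in auto)

lemma part_sum_nonneg: "u \<in> V \<Longrightarrow> v \<in> V \<Longrightarrow> 0 \<le> part_sum W u v"
  unfolding part_sum_def by (intro suminf_nonneg part_summable part_term_nonneg)

lemma part_sum_split:
  assumes "u \<in> V" "v \<in> V"
  shows "part_sum W u v + part_sum (- W) u v = s u v"
proof -
  have "part_term W u v l + part_term (- W) u v l = (\<Sum>w\<in>V. level_term l u v w)" for l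
    unfolding part_term_def using finite_V
    by (subst sum.union_disjoint[symmetric]) (auto intro!: arg_cong2[where f=sum])
  then have "(\<lambda>l. part_term W u v l + part_term (- W) u v l) sums s u v"
    using simrank_sums[OF assms] by simp
  moreover have "(\<lambda>l. part_term W u v l + part_term (- W) u v l) sums (part_sum W u v + part_sum (- W) u v)"
    unfolding part_sum_def by (intro sums_add summable_sums part_summable assms)
  ultimately show ?thesis by (rule sums_unique2[symmetric])
qed

lemma part_sum_le_1: "u \<in> V \<Longrightarrow> v \<in> V \<Longrightarrow> part_sum W u v \<le> 1"
  using part_sum_split[of u v W] part_sum_nonneg[of u v "- W"] simrank_bounds(2)[of u v] by linarith

text \<open>An idealized index contribution with exact hitting probabilities: a reserve approximates
  \<open>(1 - a) * hit l v w\<close>, and the algorithm divides it by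
  \<open>(1 - a)^2\<close>.\<close>

definition hub_value :: "'a set \<Rightarrow> 'a \<Rightarrow> 'a sample \<Rightarrow> real" where
  "hub_value hubs v x = (case x of None \<Rightarrow> 0 | Some ((l, w), p) \<Rightarrow> if w \<in> hubs then hit l v w / (1 - a) else 0)"

lemma hub_value_bounds: "0 \<le> hub_value hubs v x \<and> hub_value hubs v x \<le> 1 / (1 - a)"
proof -
  have "hit l v w \<le> 1" for l w
  proof -
    have "a ^ l \<le> 1" using a_pos a_less by (intro power_le_one) auto
    then show ?thesis using hit_le[of l v w] by linarith
  qed
  then show ?thesis
    using hit_nonneg a_less unfolding hub_value_def
    by (auto split: option.splits prod.splits intro!: divide_right_mono)
qed

lemma expectation_hub_value:
  assumes u: "u \<in> V" and v: "v \<in> V"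
  shows "measure_pmf.expectation (query_sample G c hubs u) (hub_value hubs v) = part_sum hubs u v"
proof -
  have "(\<integral>\<^sup>+x. ennreal (hub_value hubs v x) \<partial>query_sample G c hubs u) =
     (\<Sum>l. \<Sum>w\<in>V. ennreal ((1 - a) * hit l u w) * (ennreal (eta w) * (if w \<in> hubs then ennreal (hit l v w / (1 - a)) else 0)))"
    by (subst nn_integral_query_sample[OF _ u]) (auto simp: hub_value_def intro!: suminf_cong sum.cong)
  also have "\<dots> = (\<Sum>l. ennreal (part_term hubs u v l))"
  proof (intro suminf_cong)
    fix l
    have "ennreal ((1 - a) * hit l u w) * (ennreal (eta w) * (if w \<in> hubs then ennreal (hit l v w / (1 - a)) else 0))
       = ennreal (if w \<in> hubs then level_term l u v w else 0)" for w
    proof -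
      have "((1 - a) * hit l u w) * (eta w * (hit l v w / (1 - a))) = level_term l u v w"
        using a_less by (simp add: level_term_def)
      then show ?thesis using hit_nonneg eta_bounds a_less
        by (auto simp: ennreal_mult[symmetric])
    qed
    then show "(\<Sum>w\<in>V. ennreal ((1 - a) * hit l u w) * (ennreal (eta w) * (if w \<in> hubs then ennreal (hit l v w / (1 - a)) else 0)))
       = ennreal (part_term hubs u v l)"
      using finite_V by (simp add: level_term_nonneg part_term_def sum.inter_restrict)
  qed
  also have "\<dots> = ennreal (part_sum hubs u v)"
    unfolding part_sum_def by (intro suminf_ennreal2 part_term_nonneg part_summable u v)
  finally show ?thesis
    using hub_value_bounds part_sum_nonneg[OF u v]
    by (subst (asm) nn_integral_eq_integrable) auto
qed

text \<open>The contribution of one sample to a round before division by \<open>d_r\<close>. A hub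
  contributes 0 because its recorded function is 0.\<close>

definition backward_value :: "'a \<Rightarrow> 'a sample \<Rightarrow> real" where
  "backward_value v x = (case x of None \<Rightarrow> 0 | Some (lw, p) \<Rightarrow> p v / (1 - a)\<^sup>2)"

lemma backward_value_nonneg: "x \<in> set_pmf (query_sample G c hubs u) \<Longrightarrow> 0 \<le> backward_value v x"
proof -
  have "0 \<le> p v" if "p \<in> set_pmf (backward hubs l w)" for l w p
  proof (cases "w \<in> hubs")
    case True
    then show ?thesis using that by simp
  next
    case False
    then have "p v = 0 \<or> 1 - a \<le> p v" using that vbbw_support[of w l] by auto
    then show ?thesis using a_less by linarith
  qed
  note nonneg = this
  assume "x \<in> set_pmf (query_sample G c hubs u)"
  then obtain t where t: "x \<in> set_pmf (if \<not> snd t then return_pmf None else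
        let w = last (fst t); l = length (fst t) - 1
        in walk G c w \<bind> (\<lambda>t1. walk G c w \<bind> (\<lambda>t2. if meet_later t1 t2 then return_pmf None
          else backward hubs l w \<bind> (\<lambda>p. return_pmf (Some ((l, w), p))))))"
    unfolding query_sample_def set_bind_pmf by blast
  define l w where "l = length (fst t) - 1" and "w = last (fst t)"
  show "0 \<le> backward_value v x"
  proof (cases "x = None")
    case True
    then show ?thesis by (simp add: backward_value_def)
  next
    case False
    then have "snd t" using t by (cases "snd t") auto
    then have "\<exists>t1\<in>set_pmf (walk G c w). \<exists>t2\<in>set_pmf (walk G c w). x \<in> set_pmf (if meet_later t1 t2 then return_pmf None
          else backward hubs l w \<bind> (\<lambda>p. return_pmf (Some ((l, w), p))))"
      using t by (simp only: Let_def not_True_eq_False if_False set_bind_pmf UN_iff l_def w_def)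
    then obtain t1 t2 :: "'a list \<times> bool" where "x \<in> set_pmf (if meet_later t1 t2 then return_pmf None
          else backward hubs l w \<bind> (\<lambda>p. return_pmf (Some ((l, w), p))))"
      by (elim bexE)
    then have "x \<in> set_pmf (backward hubs l w \<bind> (\<lambda>p. return_pmf (Some ((l, w), p))))"
      using False by (cases "meet_later t1 t2") auto
    then obtain p where "p \<in> set_pmf (backward hubs l w)" "x = Some ((l, w), p)"
      unfolding set_bind_pmf by auto
    then show ?thesis using nonneg by (simp add: backward_value_def)
  qed
qed

lemma backward_moment:
  assumes u: "u \<in> V" and k: "0 < k"
  shows "(\<integral>\<^sup>+x. ennreal (backward_value v x ^ k) \<partial>query_sample G c hubs u)
    = (\<Sum>l. ennreal (\<Sum>w\<in>V \<inter> - hubs. (1 - a) * hit l u w * (eta w *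
          (measure_pmf.expectation (vbbw G c w l) (\<lambda>p. p v ^ k) / ((1 - a)\<^sup>2) ^ k))))"
proof -
  let ?e = "\<lambda>l w. measure_pmf.expectation (vbbw G c w l) (\<lambda>p. p v ^ k) / ((1 - a)\<^sup>2) ^ k"
  have nonneg: "0 \<le> p v ^ k" if "p \<in> set_pmf (vbbw G c w l)" for p w l
  proof -
    have "p v = 0 \<or> 1 - a \<le> p v" using that vbbw_support[of w l] by auto
    then show ?thesis using a_less by (intro zero_le_power) linarith
  qed
  have e: "0 \<le> ?e l w" for l w
    using nonneg a_less by (intro divide_nonneg_nonneg Bochner_Integration.integral_nonneg_AE AE_pmfI) auto
  have inner: "(\<integral>\<^sup>+p. ennreal (backward_value v (Some ((l, w), p)) ^ k) \<partial>backward hubs l w)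
     = (if w \<in> hubs then 0 else ennreal (?e l w))" for l w
  proof (cases "w \<in> hubs")
    case True
    then show ?thesis using k by (simp add: backward_value_def)
  next
    case False
    have "integrable (measure_pmf (vbbw G c w l)) (\<lambda>p. p v ^ k / ((1 - a)\<^sup>2) ^ k)"
      by (rule integrable_measure_pmf_finite) (use vbbw_support in blast)
    then have "(\<integral>\<^sup>+p. ennreal (p v ^ k / ((1 - a)\<^sup>2) ^ k) \<partial>vbbw G c w l) = ennreal (?e l w)"
      using nonneg by (subst nn_integral_eq_integral) (auto intro!: AE_pmfI)
    then show ?thesis using False by (simp add: backward_value_def power_divide)
  qed
  have "(\<integral>\<^sup>+x. ennreal (backward_value v x ^ k) \<partial>query_sample G c hubs u) =
     (\<Sum>l. \<Sum>w\<in>V. ennreal ((1 - a) * hit l u w) * (ennreal (eta w) * (if w \<in> hubs then 0 else ennreal (?e l w))))"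
    using k by (subst nn_integral_query_sample[OF _ u]) (simp_all only: inner, simp add: backward_value_def)
  also have "\<dots> = (\<Sum>l. ennreal (\<Sum>w\<in>V \<inter> - hubs. (1 - a) * hit l u w * (eta w * ?e l w)))"
  proof (intro suminf_cong)
    fix l
    have "ennreal ((1 - a) * hit l u w) * (ennreal (eta w) * (if w \<in> hubs then 0 else ennreal (?e l w)))
       = ennreal (if w \<in> - hubs then (1 - a) * hit l u w * (eta w * ?e l w) else 0)" for w
      using hit_nonneg eta_bounds a_less e[of w l]
      by (simp add: ennreal_mult[symmetric] del: times_divide_eq_right)
    moreover have "0 \<le> (1 - a) * hit l u w * (eta w * ?e l w)" for w
      using hit_nonneg eta_bounds a_less e[of w l] by (intro mult_nonneg_nonneg) auto
    ultimately show "(\<Sum>w\<in>V. ennreal ((1 - a) * hit l u w) * (ennreal (eta w) * (if w \<in> hubs then 0 else ennreal (?e l w))))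
       = ennreal (\<Sum>w\<in>V \<inter> - hubs. (1 - a) * hit l u w * (eta w * ?e l w))"
      using finite_V by (simp only: sum.inter_restrict[OF finite_V]) (subst sum_ennreal, simp_all)
  qed
  finally show ?thesis .
qed

text \<open>The forward walk terminates with a factor \<open>1 - a\<close> and the backward walk has
  another one in its mean; both cancel against the division by \<open>(1 - a)^2\<close>.\<close>

lemma backward_value_mean:
  assumes u: "u \<in> V" and v: "v \<in> V"
  shows "integrable (measure_pmf (query_sample G c hubs u)) (backward_value v)"
    and "measure_pmf.expectation (query_sample G c hubs u) (backward_value v) = part_sum (- hubs) u v"
proof -
  have "(\<integral>\<^sup>+x. ennreal (backward_value v x ^ 1) \<partial>query_sample G c hubs u) = (\<Sum>l. ennreal (part_term (- hubs) u v l))"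
    unfolding backward_moment[OF u zero_less_one] part_term_def
  proof (intro suminf_cong arg_cong[where f=ennreal] sum.cong refl)
    fix l w
    have "(b * x) * (e * ((b * y) / (b\<^sup>2) ^ 1)) = x * y * e" if "b \<noteq> 0" for b x y e :: real
      using that by (simp add: power2_eq_square)
    from this[of "1 - a"] show "(1 - a) * hit l u w * (eta w *
          (measure_pmf.expectation (vbbw G c w l) (\<lambda>p. p v ^ 1) / ((1 - a)\<^sup>2) ^ 1)) = level_term l u v w"
      unfolding level_term_def power_one_right vbbw_moments(1) using a_less by simp
  qed
  also have "\<dots> = ennreal (part_sum (- hubs) u v)"
    unfolding part_sum_def by (intro suminf_ennreal2 part_term_nonneg part_summable u v)
  finally have "integrable (measure_pmf (query_sample G c hubs u)) (backward_value v) \<and>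
      measure_pmf.expectation (query_sample G c hubs u) (backward_value v) = part_sum (- hubs) u v"
    using part_sum_nonneg[OF u v] backward_value_nonneg
    by (subst (asm) nn_integral_eq_integrable) (auto intro!: AE_pmfI)
  then show "integrable (measure_pmf (query_sample G c hubs u)) (backward_value v)"
    "measure_pmf.expectation (query_sample G c hubs u) (backward_value v) = part_sum (- hubs) u v" by auto
qed

text \<open>By \<open>vbbw_moments\<close> the second moment is at most the sum of the level terms
  weighted by \<open>1 - a ^ Suc l\<close>, divided by \<open>(1 - a)^2\<close>. The decay of
  SimRank tails bounds this sum; the remaining \<open>(1 - a)^2\<close> is compensated by the number
  of samples.\<close>

lemma backward_value_square:
  assumes u: "u \<in> V" and v: "v \<in> V"
  shows "integrable (measure_pmf (query_sample G c hubs u)) (\<lambda>x. (backward_value v x)\<^sup>2)"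
    and "(1 - a)\<^sup>2 * (measure_pmf.expectation (query_sample G c hubs u) (\<lambda>x. (backward_value v x)\<^sup>2)
        - (part_sum (- hubs) u v)\<^sup>2) \<le> 2 / 5"
proof -
  let ?b = "part_sum (- hubs) u v"
  define B where "B = (1 - a) * (?b + a ^ 3 / (1 - a ^ 3)) / (1 - a)\<^sup>2"
  have b: "0 \<le> ?b" "?b \<le> 1" using part_sum_nonneg part_sum_le_1 u v by auto
  define g where "g = part_term (- hubs) u v"
  have part: "(\<Sum>l<m. g l * (1 - a ^ Suc l)) \<le> (1 - a) * (?b + a ^ 3 / (1 - a ^ 3))" for m
  proof (rule weighted_tail_sum_le[OF a_pos a_less _ _ b(1)])
    fix k m
    have "(\<Sum>l=k..<k + m. g l) \<le> (\<Sum>l=k..<k + m. \<Sum>w\<in>V. level_term l u v w)"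
      unfolding g_def by (intro sum_mono part_term_le)
    then show "(\<Sum>l=k..<k + m. g l) \<le> (a * a) ^ k" using level_sum_le[OF u v, of k m] unfolding a_sq by linarith
    show "(\<Sum>l<m. g l) \<le> ?b"
      unfolding part_sum_def g_def by (intro sum_le_suminf part_summable u v part_term_nonneg) auto
  qed
  have B0: "0 \<le> B"
  proof -
    have "0 \<le> (1 - a) * (?b + a ^ 3 / (1 - a ^ 3))" using part[of 0] by simp
    then show ?thesis by (simp add: B_def)
  qed
  have "(\<integral>\<^sup>+x. ennreal (backward_value v x ^ 2) \<partial>query_sample G c hubs u) \<le> (\<Sum>l. ennreal (g l * (1 - a ^ Suc l) / (1 - a)\<^sup>2))"
    unfolding backward_moment[OF u pos2]
  proof (intro suminf_le summableI ennreal_leI)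
    fix l
    have "(1 - a) * hit l u w * (eta w * (measure_pmf.expectation (vbbw G c w l) (\<lambda>p. p v ^ 2) / ((1 - a)\<^sup>2) ^ 2))
      \<le> level_term l u v w * (1 - a ^ Suc l) / (1 - a)\<^sup>2" for w
    proof -
      have "(1 - a) * hit l u w * (eta w * (measure_pmf.expectation (vbbw G c w l) (\<lambda>p. p v ^ 2) / ((1 - a)\<^sup>2) ^ 2))
        \<le> (1 - a) * hit l u w * (eta w * ((1 - a ^ Suc l) * ((1 - a) * hit l v w) / ((1 - a)\<^sup>2) ^ 2))"
        using hit_nonneg eta_bounds a_less
        by (intro mult_left_mono divide_right_mono vbbw_moments(2) mult_nonneg_nonneg) auto
      also have "\<dots> = level_term l u v w * (1 - a ^ Suc l) / (1 - a)\<^sup>2"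
      proof -
        have "(b * x) * (e * (k * (b * y) / (b\<^sup>2) ^ 2)) = x * y * e * k / b\<^sup>2" if "b \<noteq> 0" for b x y e k :: real
          using that by (simp add: power2_eq_square field_simps)
        from this[of "1 - a"] show ?thesis unfolding level_term_def using a_less by simp
      qed
      finally show ?thesis .
    qed
    then show "(\<Sum>w\<in>V \<inter> - hubs. (1 - a) * hit l u w * (eta w * (measure_pmf.expectation (vbbw G c w l) (\<lambda>p. p v ^ 2) / ((1 - a)\<^sup>2) ^ 2)))
      \<le> g l * (1 - a ^ Suc l) / (1 - a)\<^sup>2"
      unfolding g_def part_term_def sum_distrib_right sum_divide_distrib by (intro sum_mono)
  qed
  also have "\<dots> \<le> ennreal B"
  proof (intro suminf_le_const summableI)
    fix m
    have "0 \<le> g l * (1 - a ^ Suc l) / (1 - a)\<^sup>2" for l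
      using part_term_nonneg a_pos a_less unfolding g_def
      by (intro divide_nonneg_nonneg mult_nonneg_nonneg) (auto simp: power_le_one mult_le_one)
    then have "(\<Sum>l<m. ennreal (g l * (1 - a ^ Suc l) / (1 - a)\<^sup>2)) = ennreal ((\<Sum>l<m. g l * (1 - a ^ Suc l)) / (1 - a)\<^sup>2)"
      by (simp only: sum_ennreal sum_divide_distrib)
    also have "\<dots> \<le> ennreal B"
      unfolding B_def by (intro ennreal_leI divide_right_mono part) auto
    finally show "(\<Sum>l<m. ennreal (g l * (1 - a ^ Suc l) / (1 - a)\<^sup>2)) \<le> ennreal B" .
  qed
  finally have le: "(\<integral>\<^sup>+x. ennreal ((backward_value v x)\<^sup>2) \<partial>query_sample G c hubs u) \<le> ennreal B" .
  show int: "integrable (measure_pmf (query_sample G c hubs u)) (\<lambda>x. (backward_value v x)\<^sup>2)"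
    by (rule integrableI_nonneg) (use le_less_trans[OF le ennreal_less_top] in auto)
  have "ennreal (measure_pmf.expectation (query_sample G c hubs u) (\<lambda>x. (backward_value v x)\<^sup>2)) \<le> ennreal B"
    using le int by (subst (asm) nn_integral_eq_integral) auto
  then have "measure_pmf.expectation (query_sample G c hubs u) (\<lambda>x. (backward_value v x)\<^sup>2) \<le> B"
    using B0 by (simp add: ennreal_le_iff)
  then have "(1 - a)\<^sup>2 * (measure_pmf.expectation (query_sample G c hubs u) (\<lambda>x. (backward_value v x)\<^sup>2) - ?b\<^sup>2)
     \<le> (1 - a)\<^sup>2 * (B - ?b\<^sup>2)" by (intro mult_left_mono) auto
  also have "\<dots> = (1 - a) * (?b + a ^ 3 / (1 - a ^ 3)) - ((1 - a) * ?b)\<^sup>2"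
    using a_less by (simp add: B_def right_diff_distrib power_mult_distrib)
  also have "\<dots> \<le> 2 / 5" by (rule variance_constant[OF a_pos a_less b])
  finally show "(1 - a)\<^sup>2 * (measure_pmf.expectation (query_sample G c hubs u) (\<lambda>x. (backward_value v x)\<^sup>2) - ?b\<^sup>2) \<le> 2 / 5" .
qed


section \<open>Error of the index\<close>

context
  fixes \<epsilon> :: real and w :: 'a
  assumes eps: "0 < \<epsilon>"
begin

text \<open>The residue of level \<open>l\<close> at the moment when the levels below
  \<open>l\<close> have been processed and level \<open>l\<close> has not.\<close>

abbreviation (input) "res l \<equiv> fst (search_state G c \<epsilon> w l) l"

lemma r_max_pos: "0 < r_max c \<epsilon>"
  using eps a_less by (simp add: r_max_def)

lemma search_state_zero:
  "(\<forall>k>l. \<forall>v. fst (search_state G c \<epsilon> w l) k v = 0) \<and> (\<forall>k\<ge>l. \<forall>v. snd (search_state G c \<epsilon> w l) k v = 0)"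
proof (induction l)
  case (Suc l)
  obtain r \<psi> where s: "search_state G c \<epsilon> w l = (r, \<psi>)" by (cases "search_state G c \<epsilon> w l")
  then show ?case using Suc by (simp add: push_level_def Let_def)
qed simp

text \<open>The recursion of \<open>hit\<close>, except that residues not above \<open>r_max\<close>
  are not passed on.\<close>

lemma residue_Suc:
  "res (Suc l) z = a * ((\<Sum>x\<in>I z. if r_max c \<epsilon> < res l x then res l x else 0) / real (card (I z)))"
proof -
  obtain r \<psi> where s: "search_state G c \<epsilon> w l = (r, \<psi>)" by (cases "search_state G c \<epsilon> w l")
  have "r (Suc l) z = 0" using search_state_zero[of l] s by simp
  then have "res (Suc l) z = (\<Sum>v\<in>{v \<in> {v \<in> V. r l v > r_max c \<epsilon>}. z \<in> out_nbrs G v}. a * r l v / real (d_in G z))"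
    using s by (simp add: push_level_def Let_def)
  also have "{v \<in> {v \<in> V. r l v > r_max c \<epsilon>}. z \<in> out_nbrs G v} = {x \<in> I z. r l x > r_max c \<epsilon>}"
    using I_sub by (auto simp: out_nbrs_iff)
  also have "(\<Sum>v\<in>{x \<in> I z. r l x > r_max c \<epsilon>}. a * r l v / real (d_in G z))
     = (\<Sum>x\<in>I z. if r_max c \<epsilon> < r l x then a * r l x / real (d_in G z) else 0)"
    using finite_I by (rule sum.inter_filter)
  also have "\<dots> = a * ((\<Sum>x\<in>I z. if r_max c \<epsilon> < r l x then r l x else 0) / real (card (I z)))"
    unfolding sum_divide_distrib sum_distrib_left by (intro sum.cong refl) (simp add: d_in_def)
  moreover have "res l = r l" using s by simp
  ultimately show ?thesis by metis
qed

lemma reserve_eq: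
  "v \<in> V \<Longrightarrow> reserve G c \<epsilon> l v w = (if r_max c \<epsilon> < res l v then (1 - a) * res l v else 0)"
proof -
  assume v: "v \<in> V"
  obtain r \<psi> where s: "search_state G c \<epsilon> w l = (r, \<psi>)" by (cases "search_state G c \<epsilon> w l")
  have "\<psi> l v = 0" using search_state_zero[of l] s by simp
  then show ?thesis using v s by (simp add: reserve_def push_level_def Let_def)
qed

text \<open>One step adds at most \<open>r_max\<close> to the error by truncation and then scales it
  by \<open>a\<close>; the bound is the fixed point of this recursion.\<close>

lemma residue_bounds:
  "0 \<le> res l v \<and> res l v \<le> hit l v w \<and> hit l v w - res l v \<le> a * r_max c \<epsilon> / (1 - a)"
proof (induction l arbitrary: v)
  case 0
  have "0 \<le> a * r_max c \<epsilon> / (1 - a)" using r_max_pos a_pos a_less by (intro divide_nonneg_nonneg mult_nonneg_nonneg) auto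
  then show ?case by simp
next
  case (Suc l)
  let ?f = "\<lambda>x. if r_max c \<epsilon> < res l x then res l x else 0"
  let ?m = "\<lambda>g. a * ((\<Sum>x\<in>I v. g x) / real (card (I v)))"
  have f: "0 \<le> ?f x" "?f x \<le> hit l x w" "hit l x w - ?f x \<le> r_max c \<epsilon> / (1 - a)" for x
  proof -
    show "0 \<le> ?f x" using Suc[of x] by simp
    show "?f x \<le> hit l x w" using Suc[of x] hit_nonneg[of l x w] by simp
    have "a * r_max c \<epsilon> / (1 - a) + r_max c \<epsilon> = r_max c \<epsilon> / (1 - a)"
    proof -
      have "q * r / (1 - q) + r = r / (1 - q)" if "q < 1" for q r :: real
        using that by (simp add: field_simps)
      then show ?thesis using a_less by blast
    qed
    then show "hit l x w - ?f x \<le> r_max c \<epsilon> / (1 - a)"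
      using Suc[of x] r_max_pos by (cases "r_max c \<epsilon> < res l x") simp_all
  qed
  have r: "res (Suc l) v = ?m ?f" by (rule residue_Suc)
  have h: "hit (Suc l) v w = ?m (\<lambda>x. hit l x w)" by simp
  have "0 \<le> ?m ?f" using a_pos f(1) by (intro mult_nonneg_nonneg divide_nonneg_nonneg sum_nonneg) auto
  moreover have "?m ?f \<le> ?m (\<lambda>x. hit l x w)"
    using a_pos f(2) by (intro mult_left_mono divide_right_mono sum_mono) auto
  moreover have "?m (\<lambda>x. hit l x w) - ?m ?f = a * ((\<Sum>x\<in>I v. hit l x w - ?f x) / real (card (I v)))"
    by (simp only: sum_subtractf diff_divide_distrib right_diff_distrib)
  moreover have "\<dots> \<le> a * (r_max c \<epsilon> / (1 - a))"
    using a_pos a_less r_max_pos f(3) by (intro mult_left_mono average_le) (auto intro!: divide_nonneg_nonneg)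
  ultimately show ?case unfolding r h by (simp only: times_divide_eq_right)
qed

text \<open>A pushed residue inherits the error \<open>a * r_max\<close> from the earlier levels. An
  unpushed one loses at most \<open>(1 - a) * r_max\<close> more, and the two add up to
  \<open>r_max\<close>.\<close>

lemma reserve_bounds:
  assumes v: "v \<in> V"
  shows "0 \<le> reserve G c \<epsilon> l v w" "reserve G c \<epsilon> l v w \<le> (1 - a) * hit l v w"
    "(1 - a) * hit l v w - reserve G c \<epsilon> l v w \<le> r_max c \<epsilon>"
proof -
  note b = residue_bounds[of l v]
  have a1: "0 < 1 - a" using a_less by simp
  have diff: "(1 - a) * hit l v w \<le> (1 - a) * res l v + a * r_max c \<epsilon>"
  proof -
    have "(1 - a) * (hit l v w - res l v) \<le> (1 - a) * (a * r_max c \<epsilon> / (1 - a))"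
      using b a1 by (intro mult_left_mono) auto
    also have "\<dots> = a * r_max c \<epsilon>" using a1 by simp
    finally show ?thesis by (simp add: right_diff_distrib)
  qed
  have pos: "0 \<le> (1 - a) * hit l v w" "0 \<le> (1 - a) * res l v" "(1 - a) * res l v \<le> (1 - a) * hit l v w"
    using b a1 hit_nonneg by (auto intro!: mult_nonneg_nonneg mult_left_mono)
  show "0 \<le> reserve G c \<epsilon> l v w" "reserve G c \<epsilon> l v w \<le> (1 - a) * hit l v w"
    using pos by (simp_all add: reserve_eq[OF v])
  show "(1 - a) * hit l v w - reserve G c \<epsilon> l v w \<le> r_max c \<epsilon>"
  proof (cases "r_max c \<epsilon> < res l v")
    case True
    have "a * r_max c \<epsilon> \<le> 1 * r_max c \<epsilon>" using a_less r_max_pos by (intro mult_right_mono) auto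
    then show ?thesis using True diff by (simp add: reserve_eq[OF v])
  next
    case False
    then have "(1 - a) * res l v \<le> (1 - a) * r_max c \<epsilon>" using a1 by (intro mult_left_mono) auto
    then have "(1 - a) * hit l v w \<le> (1 - a) * r_max c \<epsilon> + a * r_max c \<epsilon>" using diff by linarith
    then show ?thesis using False by (simp add: reserve_eq[OF v] left_diff_distrib)
  qed
qed

end

section \<open>The index estimate compared with the exact hub average\<close>

lemma sum_hit_levels_le:
  assumes v: "v \<in> V"
  shows "(\<Sum>l<m. \<Sum>w\<in>V. (1 - a) * hit l v w) \<le> 1"
proof -
  have "(\<Sum>l<m. \<Sum>w\<in>V. (1 - a) * hit l v w) \<le> (\<Sum>l<m. (1 - a) * a ^ l)"
    unfolding sum_distrib_left[symmetric]
    using sum_hit_le[OF v] a_less by (intro mult_left_mono sum_mono) auto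
  also have "\<dots> = 1 - a ^ m" using one_diff_power_eq[of a m] by (simp add: sum_distrib_left)
  also have "\<dots> \<le> 1" using a_pos by simp
  finally show ?thesis .
qed

definition hub_estimate :: "real \<Rightarrow> real \<Rightarrow> 'a set \<Rightarrow> (nat \<times> nat \<Rightarrow> 'a sample) \<Rightarrow> 'a \<Rightarrow> real" where
  "hub_estimate \<epsilon> \<delta> hubs S v =
     (\<Sum>ij\<in>{..<f_r G \<delta>} \<times> {..<d_r c \<epsilon>}. hub_value hubs v (S ij)) / real (d_r c \<epsilon> * f_r G \<delta>)"

text \<open>A pair \<open>(w, l)\<close> with small frequency is dropped at a cost of at most
  \<open>\<epsilon> / 12 * hp l w\<close>; a kept pair costs at most
  \<open>\<epsilon> / 6 * e l w\<close>. Both the frequencies and the termination probabilities sum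
  to at most 1, so the total cost is at most \<open>\<epsilon> / 4\<close>.\<close>

lemma s_I_hat_bounds:
  assumes eps: "0 < \<epsilon>" and v: "v \<in> V" and hubs: "hubs \<subseteq> V"
  shows "hub_estimate \<epsilon> \<delta> hubs S v - \<epsilon> / 4 \<le> s_I_hat G c \<epsilon> \<delta> hubs S v"
    and "s_I_hat G c \<epsilon> \<delta> hubs S v \<le> hub_estimate \<epsilon> \<delta> hubs S v"
proof -
  let ?J = "{..<f_r G \<delta>} \<times> {..<d_r c \<epsilon>}"
  define N where "N = real (d_r c \<epsilon> * f_r G \<delta>)"
  \<comment> \<open>The hub pairs that were actually sampled: a finite set containing every pair
    whose frequency passes the threshold.\<close>
  define T where "T = {(w, l). w \<in> hubs \<and> (\<exists>ij\<in>?J. \<exists>p. S ij = Some ((l, w), p))}"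
  define e where "e l w = eta_pi_hat G c \<epsilon> \<delta> S l w" for l w
  define hp where "hp l w = (1 - a) * hit l v w" for l w
  \<comment> \<open>The reserve as it survives in the index: small ones are not stored, which adds a
    second \<open>r_max\<close> to the error.\<close>
  define \<sigma> where "\<sigma> l w = (if r_max c \<epsilon> < reserve G c \<epsilon> l v w then reserve G c \<epsilon> l v w else 0)" for l w
  let ?thr = "\<epsilon> / c_one c"
  let ?T' = "{(w, l). w \<in> hubs \<and> e l w > ?thr}"
  define b where "b = (1 - a)\<^sup>2"
  have b: "0 < b" using a_less by (simp add: b_def)
  have thr: "?thr = b * \<epsilon> / 12" and rm: "r_max c \<epsilon> = b * \<epsilon> / 12"
    by (simp_all add: c_one_def r_max_def b_def)
  have thr0: "0 < ?thr" unfolding thr using b eps by simp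
  have finT: "finite T"
  proof (rule finite_subset)
    show "T \<subseteq> (\<lambda>ij. case S ij of Some ((l, w), p) \<Rightarrow> (w, l)) ` ?J"
      by (force simp: T_def image_iff split: option.splits)
  qed simp
  have e0: "0 \<le> e l w" for l w
    unfolding e_def eta_pi_hat_def by (intro sum_nonneg) (auto split: option.splits)
  have T'_sub: "?T' \<subseteq> T"
  proof
    fix x assume "x \<in> ?T'"
    then obtain w l where x: "x = (w, l)" "w \<in> hubs" "e l w > ?thr" by auto
    have "\<exists>ij\<in>?J. (case S ij of None \<Rightarrow> 0 | Some (lw, p) \<Rightarrow> if lw = (l, w) then 1 / real (d_r c \<epsilon> * f_r G \<delta>) else 0) \<noteq> 0"
    proof (rule ccontr)
      assume "\<not> ?thesis"
      then have "e l w = 0" unfolding e_def eta_pi_hat_def by (intro sum.neutral) blast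
      then show False using x thr0 by simp
    qed
    then show "x \<in> T" using x by (fastforce simp: T_def split: option.splits if_splits)
  qed
  \<comment> \<open>Turns a sum over pairs weighted by frequencies into an average over
    samples.\<close>
  have swap: "(\<Sum>(w, l)\<in>T. e l w * F l w) = (\<Sum>ij\<in>?J. (case S ij of None \<Rightarrow> 0 | Some ((l, w), p) \<Rightarrow> if w \<in> hubs then F l w else 0) / N)"
    for F :: "nat \<Rightarrow> 'a \<Rightarrow> real"
  proof -
    have "(\<Sum>(w, l)\<in>T. e l w * F l w) = (\<Sum>x\<in>T. \<Sum>ij\<in>?J. (case S ij of None \<Rightarrow> 0 | Some (lw, p) \<Rightarrow> if lw = (snd x, fst x) then 1 / real (d_r c \<epsilon> * f_r G \<delta>) else 0) * F (snd x) (fst x))"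
      by (simp add: e_def eta_pi_hat_def sum_distrib_right case_prod_unfold)
    also have "\<dots> = (\<Sum>ij\<in>?J. \<Sum>x\<in>T. (case S ij of None \<Rightarrow> 0 | Some (lw, p) \<Rightarrow> if lw = (snd x, fst x) then 1 / real (d_r c \<epsilon> * f_r G \<delta>) else 0) * F (snd x) (fst x))"
      by (rule sum.swap)
    also have "\<dots> = (\<Sum>ij\<in>?J. (case S ij of None \<Rightarrow> 0 | Some ((l, w), p) \<Rightarrow> if w \<in> hubs then F l w else 0) / N)"
    proof (intro sum.cong refl)
      fix ij assume ij: "ij \<in> ?J"
      show "(\<Sum>x\<in>T. (case S ij of None \<Rightarrow> 0 | Some (lw, p) \<Rightarrow> if lw = (snd x, fst x) then 1 / real (d_r c \<epsilon> * f_r G \<delta>) else 0) * F (snd x) (fst x))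
         = (case S ij of None \<Rightarrow> 0 | Some ((l, w), p) \<Rightarrow> if w \<in> hubs then F l w else 0) / N"
      proof (cases "S ij")
        case (Some q)
        obtain l w p where q: "q = ((l, w), p)" by (cases q) auto
        have mem: "(w, l) \<in> T \<longleftrightarrow> w \<in> hubs" using Some q ij by (auto simp: T_def)
        have "(\<Sum>x\<in>T. (if (l, w) = (snd x, fst x) then 1 / real (d_r c \<epsilon> * f_r G \<delta>) else 0) * F (snd x) (fst x))
           = (\<Sum>x\<in>T. if x = (w, l) then F l w / N else 0)"
          by (intro sum.cong refl) (auto simp: N_def)
        then show ?thesis using Some q mem finT by simp
      qed simp
    qed
    finally show ?thesis .
  qed
  have Z: "hub_estimate \<epsilon> \<delta> hubs S v = (\<Sum>(w, l)\<in>T. e l w * (hp l w / b))"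
  proof -
    have hv: "hub_value hubs v (S ij) = (case S ij of None \<Rightarrow> 0 | Some ((l, w), p) \<Rightarrow> if w \<in> hubs then hp l w / b else 0)" for ij
      using a_less by (auto simp: hub_value_def hp_def b_def power2_eq_square split: option.splits)
    show ?thesis unfolding hub_estimate_def swap hv sum_divide_distrib N_def ..
  qed
  have I': "s_I_hat G c \<epsilon> \<delta> hubs S v = (\<Sum>(w, l)\<in>T. if e l w > ?thr then e l w * (\<sigma> l w / b) else 0)"
  proof -
    have inner: "(\<Sum>(x, \<psi>)\<in>{q \<in> index_list G c \<epsilon> l w. fst q = v}. e l w * \<psi> / (1 - a)\<^sup>2) = e l w * (\<sigma> l w / b)" for l w
    proof -
      have "{q \<in> index_list G c \<epsilon> l w. fst q = v} = (if r_max c \<epsilon> < reserve G c \<epsilon> l v w then {(v, reserve G c \<epsilon> l v w)} else {})"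
        using v by (auto simp: index_list_def)
      then show ?thesis by (simp add: \<sigma>_def b_def)
    qed
    have "s_I_hat G c \<epsilon> \<delta> hubs S v = (\<Sum>(w, l)\<in>?T'. e l w * (\<sigma> l w / b))"
      unfolding s_I_hat_def e_def[symmetric] inner ..
    also have "?T' = {x \<in> T. e (snd x) (fst x) > ?thr}" using T'_sub by (auto simp: T_def)
    also have "(\<Sum>(w, l)\<in>{x \<in> T. e (snd x) (fst x) > ?thr}. e l w * (\<sigma> l w / b)) = (\<Sum>(w, l)\<in>T. if e l w > ?thr then e l w * (\<sigma> l w / b) else 0)"
      unfolding case_prod_unfold using finT by (rule sum.inter_filter)
    finally show ?thesis .
  qed
  have \<sigma>: "0 \<le> \<sigma> l w" "\<sigma> l w \<le> hp l w" "hp l w - \<sigma> l w \<le> 2 * r_max c \<epsilon>" for l w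
    using reserve_bounds[OF eps v, where w=w and l=l] r_max_pos[OF eps] by (auto simp: \<sigma>_def hp_def)
  have hp0: "0 \<le> hp l w" for l w using hit_nonneg a_less by (simp add: hp_def)
  show "s_I_hat G c \<epsilon> \<delta> hubs S v \<le> hub_estimate \<epsilon> \<delta> hubs S v"
    unfolding Z I'
  proof (rule sum_mono)
    fix x assume "x \<in> T"
    obtain w l where x: "x = (w, l)" by (cases x)
    have "e l w * (\<sigma> l w / b) \<le> e l w * (hp l w / b)"
      using \<sigma> e0 b by (intro mult_left_mono divide_right_mono) auto
    moreover have "0 \<le> e l w * (hp l w / b)" using e0 hp0 b by (intro mult_nonneg_nonneg divide_nonneg_nonneg) auto
    ultimately show "(case x of (w, l) \<Rightarrow> if e l w > ?thr then e l w * (\<sigma> l w / b) else 0)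
        \<le> (case x of (w, l) \<Rightarrow> e l w * (hp l w / b))"
      by (simp add: x)
  qed
  have term_le: "e l w * (hp l w / b) - (if e l w > ?thr then e l w * (\<sigma> l w / b) else 0) \<le> \<epsilon> / 6 * e l w + \<epsilon> / 12 * hp l w" for l w
  proof (cases "e l w > ?thr")
    case True
    have "e l w * (hp l w / b) - e l w * (\<sigma> l w / b) = e l w * ((hp l w - \<sigma> l w) / b)"
      by (simp only: right_diff_distrib[symmetric] diff_divide_distrib[symmetric])
    also have "\<dots> \<le> e l w * (2 * r_max c \<epsilon> / b)" using \<sigma> e0 b by (intro mult_left_mono divide_right_mono) auto
    also have "2 * r_max c \<epsilon> / b = \<epsilon> / 6" using b by (simp add: rm)
    finally have "e l w * (hp l w / b) - e l w * (\<sigma> l w / b) \<le> \<epsilon> / 6 * e l w" by (simp only: mult.commute)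
    moreover have "0 \<le> \<epsilon> / 12 * hp l w" using hp0 eps by simp
    ultimately show ?thesis using True by simp
  next
    case False
    then have "e l w * (hp l w / b) \<le> ?thr * (hp l w / b)" using hp0 b by (intro mult_right_mono) auto
    also have "\<dots> = \<epsilon> / 12 * hp l w" using b by (simp add: thr)
    finally have "e l w * (hp l w / b) \<le> \<epsilon> / 12 * hp l w" .
    moreover have "0 \<le> \<epsilon> / 6 * e l w" using e0 eps by simp
    ultimately show ?thesis unfolding if_not_P[OF False] by linarith
  qed
  have sum_e: "(\<Sum>(w, l)\<in>T. e l w) \<le> 1"
  proof -
    have "(\<Sum>(w, l)\<in>T. e l w) = (\<Sum>ij\<in>?J. (case S ij of None \<Rightarrow> 0 | Some ((l, w), p) \<Rightarrow> if w \<in> hubs then 1 else 0) / N)"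
      using swap[of "\<lambda>_ _. 1"] by simp
    also have "\<dots> \<le> (\<Sum>ij\<in>?J. 1 / N)"
      by (intro sum_mono divide_right_mono) (auto simp: N_def split: option.splits)
    also have "\<dots> \<le> 1" by (simp add: N_def mult.commute)
    finally show ?thesis .
  qed
  have sum_hp: "(\<Sum>(w, l)\<in>T. hp l w) \<le> 1"
  proof -
    define m where "m = Suc (Max (snd ` T))"
    \<comment> \<open>Only finitely many levels occur, so \<open>sum_hit_levels_le\<close> applies
      to a box around \<open>T\<close>.\<close>
    have "T \<subseteq> V \<times> {..<m}"
    proof
      fix x assume x: "x \<in> T"
      then have "snd x \<le> Max (snd ` T)" using finT by (intro Max_ge) auto
      then show "x \<in> V \<times> {..<m}" using x hubs by (auto simp: m_def T_def)
    qed
    then have "(\<Sum>(w, l)\<in>T. hp l w) \<le> (\<Sum>(w, l)\<in>V \<times> {..<m}. hp l w)"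
      using finite_V hp0 by (intro sum_mono2) auto
    also have "\<dots> = (\<Sum>l<m. \<Sum>w\<in>V. hp l w)"
      by (simp add: sum.cartesian_product[symmetric] sum.swap[of _ V])
    also have "\<dots> \<le> 1" unfolding hp_def by (rule sum_hit_levels_le[OF v])
    finally show ?thesis .
  qed
  have "hub_estimate \<epsilon> \<delta> hubs S v - s_I_hat G c \<epsilon> \<delta> hubs S v
     = (\<Sum>(w, l)\<in>T. e l w * (hp l w / b) - (if e l w > ?thr then e l w * (\<sigma> l w / b) else 0))"
    unfolding Z I' by (simp add: case_prod_unfold sum_subtractf)
  also have "\<dots> \<le> (\<Sum>(w, l)\<in>T. \<epsilon> / 6 * e l w + \<epsilon> / 12 * hp l w)"
    using term_le by (intro sum_mono) auto
  also have "\<dots> = \<epsilon> / 6 * (\<Sum>(w, l)\<in>T. e l w) + \<epsilon> / 12 * (\<Sum>(w, l)\<in>T. hp l w)"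
    by (simp add: case_prod_unfold sum.distrib sum_distrib_left)
  also have "\<dots> \<le> \<epsilon> / 6 * 1 + \<epsilon> / 12 * 1"
    using sum_e sum_hp eps by (intro add_mono mult_left_mono) auto
  finally show "hub_estimate \<epsilon> \<delta> hubs S v - \<epsilon> / 4 \<le> s_I_hat G c \<epsilon> \<delta> hubs S v" by simp
qed

section \<open>Deviation of the estimates\<close>

lemma d_r_ge:
  assumes eps: "0 < \<epsilon>"
  shows "12 / ((1 - a)\<^sup>2 * \<epsilon>\<^sup>2) \<le> real (d_r c \<epsilon>)" "0 < d_r c \<epsilon>"
proof -
  have pos: "0 < 12 / ((1 - a)\<^sup>2 * \<epsilon>\<^sup>2)" using a_less eps by simp
  have "c_one c / \<epsilon>\<^sup>2 = 12 / ((1 - a)\<^sup>2 * \<epsilon>\<^sup>2)" by (simp add: c_one_def)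
  then show le: "12 / ((1 - a)\<^sup>2 * \<epsilon>\<^sup>2) \<le> real (d_r c \<epsilon>)"
    unfolding d_r_def using real_nat_ceiling_ge[of "12 / ((1 - a)\<^sup>2 * \<epsilon>\<^sup>2)"] by simp
  show "0 < d_r c \<epsilon>" using le pos by (cases "d_r c \<epsilon>") auto
qed

text \<open>One sample has variance at most \<open>2 / 5 / (1 - a)^2\<close> and a round averages at
  least \<open>12 / ((1 - a)^2 * \<epsilon>^2)\<close> of them, so the variance of a round is at
  most \<open>\<epsilon>^2 / 30\<close>. Chebyshev gives
  \<open>(1 / 30) / (21 / 40)^2 = 160 / 1323\<close>.\<close>

lemma prob_bad_round:
  assumes eps: "0 < \<epsilon>" and u: "u \<in> V" and v: "v \<in> V"
  shows "measure_pmf.prob (Pi_pmf ({i} \<times> {..<d_r c \<epsilon>}) None (\<lambda>_. query_sample G c hubs u))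
     {S. 21 / 40 * \<epsilon> \<le> \<bar>s_B_round c \<epsilon> S i v - part_sum (- hubs) u v\<bar>} \<le> 160 / 1323"
proof -
  let ?d = "d_r c \<epsilon>" and ?b = "part_sum (- hubs) u v" and ?Q = "query_sample G c hubs u"
  let ?J = "{i} \<times> {..<?d}"
  let ?P = "Pi_pmf ?J None (\<lambda>_. ?Q)"
  define g where "g x = backward_value v x / real ?d" for x
  have d: "0 < real ?d" using d_r_ge[OF eps] by simp
  have i1: "integrable (measure_pmf ?Q) g"
    unfolding g_def using backward_value_mean(1)[OF u v] by simp
  have i2: "integrable (measure_pmf ?Q) (\<lambda>x. (g x)\<^sup>2)"
    unfolding g_def power_divide using backward_value_square(1)[OF u v] by simp
  have mean: "measure_pmf.expectation ?Q g = ?b / real ?d"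
    unfolding g_def using backward_value_mean(2)[OF u v] by simp
  let ?V = "measure_pmf.expectation ?Q (\<lambda>x. (backward_value v x)\<^sup>2) - ?b\<^sup>2"
  have var1: "measure_pmf.expectation ?Q (\<lambda>x. (g x)\<^sup>2) - (measure_pmf.expectation ?Q g)\<^sup>2 = ?V / (real ?d)\<^sup>2"
    unfolding mean by (simp add: g_def power_divide diff_divide_distrib)
  have round: "s_B_round c \<epsilon> S i v = (\<Sum>ij\<in>?J. g (S ij))" for S
  proof -
    have "(\<Sum>ij\<in>?J. g (S ij)) = (\<Sum>j<?d. g (S (i, j)))"
    proof -
      have "?J = Pair i ` {..<?d}" by auto
      then show ?thesis by (simp add: sum.reindex inj_on_def)
    qed
    also have "\<dots> = s_B_round c \<epsilon> S i v"
      unfolding s_B_round_def by (intro sum.cong refl) (auto simp: g_def backward_value_def split: option.splits)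
    finally show ?thesis by simp
  qed
  note moments = Pi_pmf_sum_moments[where A = ?J and p = "\<lambda>_. ?Q" and g = "\<lambda>_. g" and d = None, OF _ i1 i2]
  have E1: "measure_pmf.expectation ?P (\<lambda>S. \<Sum>ij\<in>?J. g (S ij)) = ?b"
    using moments(2) d by (simp add: mean)
  have E2: "measure_pmf.expectation ?P (\<lambda>S. (\<Sum>ij\<in>?J. g (S ij))\<^sup>2) = ?b\<^sup>2 + ?V / real ?d"
    using moments(4) d unfolding var1 by (simp add: mean power2_eq_square)
  have "measure_pmf.prob ?P {S\<in>space ?P. 21 / 40 * \<epsilon> \<le> \<bar>(\<Sum>ij\<in>?J. g (S ij)) - measure_pmf.expectation ?P (\<lambda>S. \<Sum>ij\<in>?J. g (S ij))\<bar>}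
     \<le> measure_pmf.variance ?P (\<lambda>S. \<Sum>ij\<in>?J. g (S ij)) / (21 / 40 * \<epsilon>)\<^sup>2"
    by (rule measure_pmf.Chebyshev_inequality) (use moments(3) eps in auto)
  also have "measure_pmf.variance ?P (\<lambda>S. \<Sum>ij\<in>?J. g (S ij)) = ?V / real ?d"
    using measure_pmf.variance_eq[OF moments(1,3)] by (simp add: E1 E2)
  also have "?V / real ?d / (21 / 40 * \<epsilon>)\<^sup>2 \<le> 160 / 1323"
  proof -
    define B where "B = (1 - a)\<^sup>2"
    have B: "0 < B" using a_less by (simp add: B_def)
    have BV: "B * ?V \<le> 2 / 5" unfolding B_def by (rule backward_value_square(2)[OF u v])
    have "12 / (B * \<epsilon>\<^sup>2) \<le> real ?d" unfolding B_def by (rule d_r_ge(1)[OF eps])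
    then have Bd: "12 \<le> B * \<epsilon>\<^sup>2 * real ?d" using B eps by (simp add: divide_le_eq mult.commute)
    have "(?V / real ?d / (21 / 40 * \<epsilon>)\<^sup>2) = (B * ?V) / ((21 / 40)\<^sup>2 * (B * \<epsilon>\<^sup>2 * real ?d))"
      using B eps d by (simp add: power_mult_distrib field_simps)
    also have "\<dots> \<le> (2 / 5) / ((21 / 40)\<^sup>2 * (B * \<epsilon>\<^sup>2 * real ?d))"
      using BV B eps by (intro divide_right_mono) auto
    also have "\<dots> \<le> (2 / 5) / ((21 / 40)\<^sup>2 * 12)"
      using Bd by (intro divide_left_mono mult_left_mono) (auto intro!: mult_pos_pos)
    also have "\<dots> = 160 / 1323" by (simp add: power2_eq_square)
    finally show ?thesis .
  qed
  finally show ?thesis by (simp add: round E1)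
qed

text \<open>Hoeffding for all \<open>d_r * f_r\<close> samples, with range
  \<open>1 / (1 - a)\<close>: the lower bound on \<open>d_r\<close> cancels
  \<open>(1 - a)^2 * \<epsilon>^2\<close> and leaves the exponent
  \<open>2 * 12 * t^2 * f_r\<close>.\<close>

lemma prob_hub_estimate:
  fixes hubs :: "'a set"
  assumes eps: "0 < \<epsilon>" and u: "u \<in> V" and v: "v \<in> V" and f: "0 < f_r G \<delta>" and t: "0 \<le> t"
  defines "P \<equiv> Pi_pmf ({..<f_r G \<delta>} \<times> {..<d_r c \<epsilon>}) None (\<lambda>_. query_sample G c hubs u)"
  shows "measure_pmf.prob P {S. part_sum hubs u v + t * \<epsilon> \<le> hub_estimate \<epsilon> \<delta> hubs S v} \<le> exp (- 24 * t\<^sup>2 * real (f_r G \<delta>))"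
    and "measure_pmf.prob P {S. hub_estimate \<epsilon> \<delta> hubs S v \<le> part_sum hubs u v - t * \<epsilon>} \<le> exp (- 24 * t\<^sup>2 * real (f_r G \<delta>))"
proof -
  let ?f = "f_r G \<delta>" and ?d = "d_r c \<epsilon>"
  define N where "N = real (?d * ?f)"
  have ne: "{..<?f} \<times> {..<?d} \<noteq> {}" using f d_r_ge(2)[OF eps] by (auto simp: lessThan_empty_iff)
  have N: "N = real (card ({..<?f} \<times> {..<?d}))" by (simp add: N_def mult.commute)
  have fin: "finite ({..<?f} \<times> {..<?d})" by simp
  have B: "0 < 1 / (1 - a)" using a_less by simp
  have t': "0 \<le> t * \<epsilon>" using t eps by simp
  note H = Hoeffding_Pi_pmf[where d = None and q = "query_sample G c hubs u" and Y = "hub_value hubs v", OF fin ne B hub_value_bounds t' N,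
      unfolded expectation_hub_value[OF u v] N_def, folded hub_estimate_def P_def N_def]
  have "exp (- 2 * N * (t * \<epsilon>)\<^sup>2 / (1 / (1 - a))\<^sup>2) \<le> exp (- 24 * t\<^sup>2 * real ?f)"
  proof -
    define B where "B = (1 - a)\<^sup>2"
    have B: "0 < B" using a_less by (simp add: B_def)
    have "12 / (B * \<epsilon>\<^sup>2) \<le> real ?d" unfolding B_def by (rule d_r_ge(1)[OF eps])
    then have Bd: "12 \<le> B * \<epsilon>\<^sup>2 * real ?d" using B eps by (simp add: divide_le_eq mult.commute)
    have "2 * (t\<^sup>2 * real ?f) * 12 \<le> 2 * (t\<^sup>2 * real ?f) * (B * \<epsilon>\<^sup>2 * real ?d)"
      using Bd by (intro mult_left_mono) auto
    also have "\<dots> = 2 * N * (t * \<epsilon>)\<^sup>2 / (1 / (1 - a))\<^sup>2"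
      by (simp add: N_def B_def power_mult_distrib power_divide)
    finally show ?thesis by simp
  qed
  note bound = this
  show "measure_pmf.prob P {S. part_sum hubs u v + t * \<epsilon> \<le> hub_estimate \<epsilon> \<delta> hubs S v} \<le> exp (- 24 * t\<^sup>2 * real (f_r G \<delta>))"
    by (rule order_trans[OF H(1) bound])
  show "measure_pmf.prob P {S. hub_estimate \<epsilon> \<delta> hubs S v \<le> part_sum hubs u v - t * \<epsilon>} \<le> exp (- 24 * t\<^sup>2 * real (f_r G \<delta>))"
    by (rule order_trans[OF H(2) bound])
qed

end

text \<open>
  With a deviation \<open>21 / 40 * \<epsilon>\<close> of the median, an error \<open>19 / 40 * \<epsilon>\<close> of the hub average is
  tolerable from above, but only \<open>9 / 40 * \<epsilon>\<close> from below because of the bias \<open>\<epsilon> / 4\<close> of the index.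
\<close>

lemma failure_sum_le:
  fixes f :: nat
  assumes f: "0 < f"
  shows "exp (- 24 * (19 / 40)\<^sup>2 * real f) + exp (- 24 * (9 / 40)\<^sup>2 * real f) + (2 * sqrt (160 / 1323)) ^ f / 2
     \<le> exp (- real f / 3)"
proof -
  \<comment> \<open>As \<open>1 / 3 <= x\<close>, the ratio to \<open>exp (- f / 3)\<close> is
    largest at \<open>f = 1\<close>, so one numerical check serves all \<open>f\<close>.\<close>
  have small: "exp (- x * real f) \<le> exp (- real f / 3) * y"
    if x: "exp (1 / 3 - x) \<le> y" "1 / 3 \<le> x" for x y :: real
  proof -
    have "exp (- x * real f) = exp (- real f / 3) * exp ((1 / 3 - x) * real f)"
    proof -
      have "- x * real f = - real f / 3 + (1 / 3 - x) * real f" by (simp add: algebra_simps)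
      then show ?thesis by (simp only: exp_add)
    qed
    moreover have "exp ((1 / 3 - x) * real f) \<le> y"
    proof (rule order_trans[OF _ x(1)])
      have "(1 / 3 - x) * real f \<le> (1 / 3 - x) * 1" using f x by (intro mult_left_mono_neg) auto
      then show "exp ((1 / 3 - x) * real f) \<le> exp (1 / 3 - x)" by simp
    qed
    ultimately show ?thesis by (simp only: mult_left_mono[OF _ exp_ge_zero])
  qed
  \<comment> \<open>A rational upper bound from \<open>1 + x / 4 <= exp (x / 4)\<close>; the fourth
    power is sharp enough for the constants below.\<close>
  have neg_exp: "exp (- x) \<le> 1 / (1 + x / 4) ^ 4" if "0 \<le> x" for x :: real
  proof -
    have "(1 + x / 4) ^ 4 \<le> exp (x / 4) ^ 4"
      using that by (intro power_mono exp_ge_add_one_self) auto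
    also have "\<dots> = exp x" using exp_of_nat_mult[of 4 "x / 4"] by simp
    finally have "1 / exp x \<le> 1 / (1 + x / 4) ^ 4" using that by (intro divide_left_mono) auto
    then show ?thesis by (simp add: exp_minus inverse_eq_divide)
  qed
  have 1: "exp (- 24 * (19 / 40)\<^sup>2 * real f) \<le> exp (- real f / 3) * (1 / 26)"
  proof -
    have "exp (- 24 * (19 / 40)\<^sup>2 * real f) = exp (- (1083 / 200) * real f)" by (simp add: power2_eq_square)
    also have "exp (1 / 3 - 1083 / 200) \<le> (1 / 26 :: real)"
      using neg_exp[of "1083 / 200 - 1 / 3"] by (simp add: power4_eq_xxxx)
    then have "exp (- (1083 / 200) * real f) \<le> exp (- real f / 3) * (1 / 26)" by (intro small) auto
    finally show ?thesis .
  qed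
  have 2: "exp (- 24 * (9 / 40)\<^sup>2 * real f) \<le> exp (- real f / 3) * (23 / 50)"
  proof -
    have "exp (- 24 * (9 / 40)\<^sup>2 * real f) = exp (- (243 / 200) * real f)" by (simp add: power2_eq_square)
    also have "exp (1 / 3 - 243 / 200) \<le> (23 / 50 :: real)"
      using neg_exp[of "243 / 200 - 1 / 3"] by (simp add: power4_eq_xxxx)
    then have "exp (- (243 / 200) * real f) \<le> exp (- real f / 3) * (23 / 50)" by (intro small) auto
    finally show ?thesis .
  qed
  have 3: "(2 * sqrt (160 / 1323)) ^ f \<le> exp (- real f / 3)"
  proof -
    \<comment> \<open>The intermediate value comes from \<open>1 - 1 / 12 <= exp (- 1 / 12)\<close>,
      raised to the fourth power to reach \<open>exp (- 1 / 3)\<close>.\<close>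
    have "2 * sqrt (160 / 1323) \<le> (11 / 12 :: real) ^ 4"
    proof -
      have "sqrt (160 / 1323) \<le> (11 / 12) ^ 4 / 2"
        by (rule real_le_lsqrt) (simp_all add: power2_eq_square power4_eq_xxxx)
      then show ?thesis by simp
    qed
    also have "\<dots> \<le> exp (- (1 / 12)) ^ 4"
      using exp_ge_add_one_self[of "- (1 / 12)"] by (intro power_mono) auto
    also have "\<dots> = exp (- (1 / 3))" using exp_of_nat_mult[of 4 "- (1 / 12) :: real"] by simp
    finally have "(2 * sqrt (160 / 1323)) ^ f \<le> exp (- (1 / 3)) ^ f" by (intro power_mono) auto
    also have "\<dots> = exp (- real f / 3)" using exp_of_nat_mult[of f "- (1 / 3) :: real"] by simp
    finally show ?thesis .
  qed
  \<comment> \<open>The shares \<open>1 / 26\<close>, \<open>23 / 50\<close> and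
    \<open>1 / 2\<close> of \<open>exp (- f / 3)\<close> add up to less than 1.\<close>
  have "0 < exp (- real f / 3)" by simp
  then show ?thesis using 1 2 3 by linarith
qed

text \<open>Union bound over the \<open>n\<close> nodes: the number of rounds makes
  \<open>exp (- f_r / 3)\<close> at most \<open>\<delta> / n\<close>, which bounds the failure
  probability at a single node.\<close>

theorem theorem3p8:
  fixes G :: "'a pair_pre_digraph" and c \<epsilon> \<delta> :: real
    and ws :: "'a list" and j0 :: nat and u :: 'a
  assumes "pair_fin_digraph G"
    and "0 < c" "c < 1"
    and "0 < \<epsilon>"
    and "0 < \<delta>" "\<delta> < 1"
    and "pagerank_order G c ws"
    and "j0 \<le> card (pverts G)"
    and "u \<in> pverts G"
  shows "measure_pmf.prob (prsim_query G c \<epsilon> \<delta> (set (take j0 ws)) u)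
           {out. \<forall>v\<in>pverts G.
              \<bar>(case out v of None \<Rightarrow> 0 | Some x \<Rightarrow> x) - simrank G c u v\<bar> \<le> \<epsilon>} \<ge> 1 - \<delta>"
proof -
  interpret pagerank_graph G c by (rule pagerank_graph.intro) fact+
  define hubs where "hubs = set (take j0 ws)"
  have hubs: "hubs \<subseteq> V"
    using assms(7) set_take_subset[of j0 ws] by (auto simp: hubs_def pagerank_order_def)
  let ?f = "f_r G \<delta>" and ?d = "d_r c \<epsilon>"
  let ?P = "Pi_pmf ({..<?f} \<times> {..<?d}) None (\<lambda>_. query_sample G c hubs u)"
  define n where "n = real (card V)"
  have n: "1 \<le> n" using assms(9) finite_V by (auto simp: n_def Suc_le_eq card_gt_0_iff)
  have "1 < n / \<delta>" using n assms by (simp add: less_divide_eq)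
  then have ln: "0 < ln (n / \<delta>)" by simp
  have f3: "3 * ln (n / \<delta>) \<le> real ?f" unfolding f_r_def n_def by (rule real_nat_ceiling_ge)
  have f: "0 < ?f" using f3 ln by (cases ?f) auto
  have "exp (- real ?f / 3) \<le> exp (- ln (n / \<delta>))" using f3 by simp
  also have "\<dots> = \<delta> / n" using n assms by (simp add: exp_minus)
  finally have fail: "exp (- real ?f / 3) \<le> \<delta> / n" .
  have one: "measure_pmf.prob ?P {S. \<not> \<bar>s_hat G c \<epsilon> \<delta> hubs S v - s u v\<bar> \<le> \<epsilon>} \<le> \<delta> / n" if v: "v \<in> V" for v
  proof -
    let ?i = "part_sum hubs u v" and ?b = "part_sum (- hubs) u v"
    let ?bad = "\<lambda>i S. 21 / 40 * \<epsilon> \<le> \<bar>s_B_round c \<epsilon> S i v - ?b\<bar>"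
    let ?U = "{S. ?i + 19 / 40 * \<epsilon> \<le> hub_estimate \<epsilon> \<delta> hubs S v}"
    let ?L = "{S. hub_estimate \<epsilon> \<delta> hubs S v \<le> ?i - 9 / 40 * \<epsilon>}"
    let ?M = "{S. ?f \<le> 2 * card {i\<in>{..<?f}. ?bad i S}}"
    \<comment> \<open>Outside the three events the error is at most
      \<open>19 / 40 + 21 / 40 = 1\<close> times \<open>\<epsilon>\<close> from above and
      \<open>9 / 40 + 1 / 4 + 21 / 40 = 1\<close> times \<open>\<epsilon>\<close> from
      below.\<close>
    have "{S. \<not> \<bar>s_hat G c \<epsilon> \<delta> hubs S v - s u v\<bar> \<le> \<epsilon>} \<subseteq> ?U \<union> ?L \<union> ?M"
    proof (rule subsetI, rule ccontr)
      fix S assume S: "S \<in> {S. \<not> \<bar>s_hat G c \<epsilon> \<delta> hubs S v - s u v\<bar> \<le> \<epsilon>}" and "S \<notin> ?U \<union> ?L \<union> ?M"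
      then have U: "hub_estimate \<epsilon> \<delta> hubs S v < ?i + 19 / 40 * \<epsilon>" and L: "?i - 9 / 40 * \<epsilon> < hub_estimate \<epsilon> \<delta> hubs S v"
        and M: "2 * card {i\<in>{..<?f}. ?bad i S} < ?f" by auto
      let ?xs = "map (\<lambda>i. s_B_round c \<epsilon> S i v) [0..<?f]"
      have "{i. i < length ?xs \<and> \<bar>?xs ! i - ?b\<bar> \<ge> 21 / 40 * \<epsilon>} = {i\<in>{..<?f}. ?bad i S}" by auto
      then have "\<bar>median ?xs - ?b\<bar> \<le> 21 / 40 * \<epsilon>"
        using f M by (intro median_deviation_le) auto
      then have B: "\<bar>s_B_hat G c \<epsilon> \<delta> S v - ?b\<bar> \<le> 21 / 40 * \<epsilon>" by (simp add: s_B_hat_def)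
      have "s u v = ?i + ?b" using part_sum_split[OF assms(9) v, of hubs] by simp
      moreover note s_I_hat_bounds[OF assms(4) v hubs, of \<delta> S]
      ultimately have "\<bar>s_hat G c \<epsilon> \<delta> hubs S v - s u v\<bar> \<le> \<epsilon>"
        using U L B unfolding s_hat_def by linarith
      then show False using S by simp
    qed
    then have "measure_pmf.prob ?P {S. \<not> \<bar>s_hat G c \<epsilon> \<delta> hubs S v - s u v\<bar> \<le> \<epsilon>}
       \<le> measure_pmf.prob ?P (?U \<union> ?L \<union> ?M)"
      by (intro measure_pmf.finite_measure_mono) auto
    also have "\<dots> \<le> measure_pmf.prob ?P ?U + measure_pmf.prob ?P ?L + measure_pmf.prob ?P ?M"
      using measure_Un_le[of "?U \<union> ?L" "measure_pmf ?P" ?M] measure_Un_le[of ?U "measure_pmf ?P" ?L] by simp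
    also have "\<dots> \<le> exp (- 24 * (19 / 40)\<^sup>2 * real ?f) + exp (- 24 * (9 / 40)\<^sup>2 * real ?f) + (2 * sqrt (160 / 1323)) ^ ?f / 2"
    proof (intro add_mono)
      show "measure_pmf.prob ?P ?U \<le> exp (- 24 * (19 / 40)\<^sup>2 * real ?f)"
        by (rule prob_hub_estimate(1)[OF assms(4,9) v f]) simp
      show "measure_pmf.prob ?P ?L \<le> exp (- 24 * (9 / 40)\<^sup>2 * real ?f)"
        by (rule prob_hub_estimate(2)[OF assms(4,9) v f]) simp
      show "measure_pmf.prob ?P ?M \<le> (2 * sqrt (160 / 1323)) ^ ?f / 2"
      proof (rule prob_half_blocks_bad[OF f])
        show "?bad i S = ?bad i S'" if "\<And>j. j \<in> {..<?d} \<Longrightarrow> S (i, j) = S' (i, j)" for i S S'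
          using that by (simp add: s_B_round_def)
      qed (use prob_bad_round[OF assms(4,9) v] in auto)
    qed
    also have "\<dots> \<le> exp (- real ?f / 3)" by (rule failure_sum_le[OF f])
    also note fail
    finally show ?thesis .
  qed
  let ?good = "{S. \<forall>v\<in>V. \<bar>s_hat G c \<epsilon> \<delta> hubs S v - s u v\<bar> \<le> \<epsilon>}"
  have "measure_pmf.prob ?P (\<Union>v\<in>V. {S. \<not> \<bar>s_hat G c \<epsilon> \<delta> hubs S v - s u v\<bar> \<le> \<epsilon>})
     \<le> (\<Sum>v\<in>V. measure_pmf.prob ?P {S. \<not> \<bar>s_hat G c \<epsilon> \<delta> hubs S v - s u v\<bar> \<le> \<epsilon>})"
    by (rule measure_UNION_le[OF finite_V]) auto
  also have "\<dots> \<le> (\<Sum>v\<in>V. \<delta> / n)" by (intro sum_mono one)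
  also have "\<dots> = \<delta>" using n by (simp add: n_def)
  also have "(\<Union>v\<in>V. {S. \<not> \<bar>s_hat G c \<epsilon> \<delta> hubs S v - s u v\<bar> \<le> \<epsilon>}) = UNIV - ?good" by auto
  finally have "1 - measure_pmf.prob ?P ?good \<le> \<delta>"
    using measure_pmf.prob_compl[of ?good ?P] by simp
  \<comment> \<open>A node is missing from the output exactly when its estimate is 0, so reading
    \<open>None\<close> as 0 recovers \<open>s_hat\<close> on all of \<open>V\<close>.\<close>
  moreover have "measure_pmf.prob (prsim_query G c \<epsilon> \<delta> hubs u)
     {out. \<forall>v\<in>V. \<bar>(case out v of None \<Rightarrow> 0 | Some x \<Rightarrow> x) - s u v\<bar> \<le> \<epsilon>} = measure_pmf.prob ?P ?good"
    unfolding prsim_query_def measure_map_pmf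
    by (intro arg_cong[where f="measure_pmf.prob ?P"]) (auto simp: query_output_def)
  ultimately show ?thesis unfolding hubs_def by linarith
qed

end
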